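(* Let $k$ be a field and $D$ a finite-dimensional division algebra over $k$. The finite-dimensional chain coalgebras over $k$ of type $D$ are in correspondence to the finite-dimensional chain rings $A$ (over $k$) whose residue field is isomorphic to $D$ and whose left ideals are the powers of $\mathrm{Jac}(A)$.
   Context: Coalgebras are coassociative and counital over $k$. A right coideal of a coalgebra $C$ is a right $C$-subcomodule of $C$. A chain coalgebra is a coalgebra whose right coideals are linearly ordered by inclusion (equivalently, whose left coideals are linearly ordered by inclusion). $C^*=\mathrm{Hom}_k(C,k)$ is the dual algebra with the convolution product. $C_0$ denotes the coradical of $C$, i.e. the socle of $C$ as a left $C^*$-module; for a chain coalgebra it is a simple subcoalgebra. A chain coalgebra $C$ is of type $D$ if $D\simeq (C_0)^*$. A finite-dimensional chain ring over $k$ is a finite-dimensional $k$-algebra whose left ideals are linearly ordered by inclusion. $\mathrm{Jac}(A)$ is the Jacobson radical of $A$, with $\mathrm{Jac}(A)^0=A$, and the residue field of $A$ is $A/\mathrm{Jac}(A)$ (a division ring, not necessarily commutative). *)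

theory Defs
  imports
    "HOL-Algebra.QuotRing"
    "HOL-Algebra.Ideal_Product"
    "Jordan_Normal_Form.Missing_VectorSpace"
begin

text \<open>
  Vector spaces are carrier-based: \<^locale>\<open>vectorspace\<close> over module records. Module records also
  contain a multiplication and a unit. These are part of the structure of an algebra, and are
  never referred to when the record is just a vector space or a coalgebra.
\<close>

section \<open>Quotients, free modules and tensor products\<close>

definition quotient_algebra ::
  "('k, 'a, 'm) module_scheme \<Rightarrow> 'a set \<Rightarrow> ('k, 'a set) module"
  where "quotient_algebra M N =
    \<lparr>carrier = a_rcosets\<^bsub>M\<^esub> N, mult = rcoset_mult M N, one = N +>\<^bsub>M\<^esub> \<one>\<^bsub>M\<^esub>,
     zero = N, add = set_add M,
     smult = (\<lambda>a X. N <+>\<^bsub>M\<^esub> ((\<lambda>x. a \<odot>\<^bsub>M\<^esub> x) ` X))\<rparr>"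

definition self_module :: "('k, 'r) ring_scheme \<Rightarrow> ('k, 'k) module"
  where "self_module k =
    \<lparr>carrier = carrier k, mult = mult k, one = \<one>\<^bsub>k\<^esub>, zero = \<zero>\<^bsub>k\<^esub>, add = add k, smult = mult k\<rparr>"

text \<open>Functions on \<open>X\<close> with finite support, extended by zero outside \<open>X\<close>.\<close>

definition free_module :: "('k, 'r) ring_scheme \<Rightarrow> 'x set \<Rightarrow> ('k, 'x \<Rightarrow> 'k) module"
  where "free_module k X =
    \<lparr>carrier = {t. range t \<subseteq> carrier k \<and> finite {x. t x \<noteq> \<zero>\<^bsub>k\<^esub>} \<and> {x. t x \<noteq> \<zero>\<^bsub>k\<^esub>} \<subseteq> X},
     mult = (\<lambda>_ _ _. \<zero>\<^bsub>k\<^esub>), one = (\<lambda>_. \<zero>\<^bsub>k\<^esub>),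
     zero = (\<lambda>_. \<zero>\<^bsub>k\<^esub>), add = (\<lambda>s t x. s x \<oplus>\<^bsub>k\<^esub> t x),
     smult = (\<lambda>a t x. a \<otimes>\<^bsub>k\<^esub> t x)\<rparr>"

definition free_gen :: "('k, 'r) ring_scheme \<Rightarrow> 'x \<Rightarrow> 'x \<Rightarrow> 'k"
  where "free_gen k x = (\<lambda>y. if y = x then \<one>\<^bsub>k\<^esub> else \<zero>\<^bsub>k\<^esub>)"

definition tensor_relations ::
  "('k, 'r) ring_scheme \<Rightarrow> ('k, 'v, 'm) module_scheme \<Rightarrow> ('k, 'w, 'n) module_scheme
    \<Rightarrow> ('v \<times> 'w \<Rightarrow> 'k) set"
  where "tensor_relations k V W =
    (let F = free_module k (carrier V \<times> carrier W); \<delta> = (\<lambda>v w. free_gen k (v, w)) in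
      module.span k F
       ({\<delta> (v \<oplus>\<^bsub>V\<^esub> v') w \<ominus>\<^bsub>F\<^esub> (\<delta> v w \<oplus>\<^bsub>F\<^esub> \<delta> v' w) | v v' w.
            v \<in> carrier V \<and> v' \<in> carrier V \<and> w \<in> carrier W}
        \<union> {\<delta> v (w \<oplus>\<^bsub>W\<^esub> w') \<ominus>\<^bsub>F\<^esub> (\<delta> v w \<oplus>\<^bsub>F\<^esub> \<delta> v w') | v w w'.
            v \<in> carrier V \<and> w \<in> carrier W \<and> w' \<in> carrier W}
        \<union> {\<delta> (a \<odot>\<^bsub>V\<^esub> v) w \<ominus>\<^bsub>F\<^esub> a \<odot>\<^bsub>F\<^esub> \<delta> v w | a v w.
            a \<in> carrier k \<and> v \<in> carrier V \<and> w \<in> carrier W}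
        \<union> {\<delta> v (a \<odot>\<^bsub>W\<^esub> w) \<ominus>\<^bsub>F\<^esub> a \<odot>\<^bsub>F\<^esub> \<delta> v w | a v w.
            a \<in> carrier k \<and> v \<in> carrier V \<and> w \<in> carrier W}))"

definition tensor ::
  "('k, 'r) ring_scheme \<Rightarrow> ('k, 'v, 'm) module_scheme \<Rightarrow> ('k, 'w, 'n) module_scheme
    \<Rightarrow> ('k, ('v \<times> 'w \<Rightarrow> 'k) set) module"
  where "tensor k V W =
    quotient_algebra (free_module k (carrier V \<times> carrier W)) (tensor_relations k V W)"

definition pure_tensor ::
  "('k, 'r) ring_scheme \<Rightarrow> ('k, 'v, 'm) module_scheme \<Rightarrow> ('k, 'w, 'n) module_scheme
    \<Rightarrow> 'v \<Rightarrow> 'w \<Rightarrow> ('v \<times> 'w \<Rightarrow> 'k) set"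
  where "pure_tensor k V W v w =
    tensor_relations k V W +>\<^bsub>free_module k (carrier V \<times> carrier W)\<^esub> free_gen k (v, w)"

text \<open>
  The linear map \<open>V \<otimes> W \<rightarrow> U\<close> with \<open>v \<otimes> w \<mapsto> b v w\<close> induced by a bilinear map \<open>b\<close>. A tensor is
  a coset, and for bilinear \<open>b\<close> all its representatives yield the same value.
\<close>

definition tensor_lift ::
  "('k, 'r) ring_scheme \<Rightarrow> ('k, 'u, 'm) module_scheme
    \<Rightarrow> ('v \<Rightarrow> 'w \<Rightarrow> 'u) \<Rightarrow> ('v \<times> 'w \<Rightarrow> 'k) set \<Rightarrow> 'u"
  where "tensor_lift k U b X =
    the_elem ((\<lambda>t. \<Oplus>\<^bsub>U\<^esub>p\<in>{p. t p \<noteq> \<zero>\<^bsub>k\<^esub>}. t p \<odot>\<^bsub>U\<^esub> b (fst p) (snd p)) ` X)"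

definition tensor_map ::
  "('k, 'r) ring_scheme \<Rightarrow> ('k, 'v, 'm) module_scheme \<Rightarrow> ('k, 'w, 'n) module_scheme
    \<Rightarrow> ('x \<Rightarrow> 'v) \<Rightarrow> ('y \<Rightarrow> 'w) \<Rightarrow> ('x \<times> 'y \<Rightarrow> 'k) set \<Rightarrow> ('v \<times> 'w \<Rightarrow> 'k) set"
  where "tensor_map k V W f g =
    tensor_lift k (tensor k V W) (\<lambda>x y. pure_tensor k V W (f x) (g y))"

text \<open>The associator \<open>(U \<otimes> V) \<otimes> W \<rightarrow> U \<otimes> (V \<otimes> W)\<close>.\<close>

definition tensor_assoc ::
  "('k, 'r) ring_scheme \<Rightarrow> ('k, 'u, 'l) module_scheme \<Rightarrow> ('k, 'v, 'm) module_scheme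
    \<Rightarrow> ('k, 'w, 'n) module_scheme
    \<Rightarrow> (('u \<times> 'v \<Rightarrow> 'k) set \<times> 'w \<Rightarrow> 'k) set \<Rightarrow> ('u \<times> ('v \<times> 'w \<Rightarrow> 'k) set \<Rightarrow> 'k) set"
  where "tensor_assoc k U V W =
    (let T = tensor k U (tensor k V W) in
      tensor_lift k T (\<lambda>x w.
        tensor_lift k T
          (\<lambda>u v. pure_tensor k U (tensor k V W) u (pure_tensor k V W v w)) x))"


section \<open>Coalgebras\<close>

record ('k, 'c) coalgebra = "('k, 'c) module" +
  comult :: "'c \<Rightarrow> ('c \<times> 'c \<Rightarrow> 'k) set" (\<open>\<Delta>\<index>\<close>)
  counit :: "'c \<Rightarrow> 'k" (\<open>\<epsilon>\<index>\<close>)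

locale coalgebra = vectorspace k C
  for k :: "('k, 'r) ring_scheme" and C :: "('k, 'c, 'm) coalgebra_scheme" +
  assumes comult_linear: "\<Delta>\<^bsub>C\<^esub> \<in> module_hom k C (tensor k C C)"
    and counit_linear: "\<epsilon>\<^bsub>C\<^esub> \<in> module_hom k C (self_module k)"
    and coassoc: "c \<in> carrier C \<Longrightarrow>
      tensor_assoc k C C C (tensor_map k (tensor k C C) C \<Delta>\<^bsub>C\<^esub> (\<lambda>v. v) (\<Delta>\<^bsub>C\<^esub> c)) =
      tensor_map k C (tensor k C C) (\<lambda>u. u) \<Delta>\<^bsub>C\<^esub> (\<Delta>\<^bsub>C\<^esub> c)"
    and counit_left: "c \<in> carrier C \<Longrightarrow> tensor_lift k C (\<lambda>u v. \<epsilon>\<^bsub>C\<^esub> u \<odot>\<^bsub>C\<^esub> v) (\<Delta>\<^bsub>C\<^esub> c) = c"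
    and counit_right: "c \<in> carrier C \<Longrightarrow> tensor_lift k C (\<lambda>u v. \<epsilon>\<^bsub>C\<^esub> v \<odot>\<^bsub>C\<^esub> u) (\<Delta>\<^bsub>C\<^esub> c) = c"

definition coalgebra_iso ::
  "('k, 'r) ring_scheme \<Rightarrow> ('k, 'c, 'm) coalgebra_scheme \<Rightarrow> ('k, 'd, 'n) coalgebra_scheme
    \<Rightarrow> ('c \<Rightarrow> 'd) set"
  where "coalgebra_iso k C D =
    {h \<in> module_hom k C D. bij_betw h (carrier C) (carrier D) \<and>
      (\<forall>c \<in> carrier C. \<Delta>\<^bsub>D\<^esub> (h c) = tensor_map k D D h h (\<Delta>\<^bsub>C\<^esub> c) \<and> \<epsilon>\<^bsub>D\<^esub> (h c) = \<epsilon>\<^bsub>C\<^esub> c)}"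

definition coalgebra_isomorphic ::
  "('k, 'r) ring_scheme \<Rightarrow> ('k, 'c, 'm) coalgebra_scheme \<Rightarrow> ('k, 'd, 'n) coalgebra_scheme \<Rightarrow> bool"
  where "coalgebra_isomorphic k C D \<longleftrightarrow> coalgebra_iso k C D \<noteq> {}"

text \<open>Here \<open>I \<otimes> C\<close> is regarded as a subspace of \<open>C \<otimes> C\<close>, via the map induced by the inclusion.\<close>

definition right_coideal ::
  "('k, 'r) ring_scheme \<Rightarrow> ('k, 'c, 'm) coalgebra_scheme \<Rightarrow> 'c set \<Rightarrow> bool"
  where "right_coideal k C I \<longleftrightarrow> submodule k I C \<and>
    \<Delta>\<^bsub>C\<^esub> ` I \<subseteq>
      tensor_map k C C (\<lambda>u. u) (\<lambda>v. v) ` carrier (tensor k (C\<lparr>carrier := I\<rparr>) C)"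

definition chain_coalgebra ::
  "('k, 'r) ring_scheme \<Rightarrow> ('k, 'c, 'm) coalgebra_scheme \<Rightarrow> bool"
  where "chain_coalgebra k C \<longleftrightarrow> coalgebra k C \<and>
    (\<forall>I J. right_coideal k C I \<and> right_coideal k C J \<longrightarrow> I \<subseteq> J \<or> J \<subseteq> I)"

text \<open>
  The dual algebra \<open>C\<^sup>*\<close>: linear forms on \<open>C\<close>, made extensional so that equality of functions is
  equality on the carrier, with the convolution product \<open>f * g : c \<mapsto> \<Sum> f(c\<^sub>1) g(c\<^sub>2)\<close>.
\<close>

definition dual_algebra ::
  "('k, 'r) ring_scheme \<Rightarrow> ('k, 'c, 'm) coalgebra_scheme \<Rightarrow> ('k, 'c \<Rightarrow> 'k) module"
  where "dual_algebra k C =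
    \<lparr>carrier = module_hom k C (self_module k) \<inter> extensional (carrier C),
     mult = (\<lambda>f g. \<lambda>c\<in>carrier C. tensor_lift k (self_module k) (\<lambda>u v. f u \<otimes>\<^bsub>k\<^esub> g v) (\<Delta>\<^bsub>C\<^esub> c)),
     one = (\<lambda>c\<in>carrier C. \<epsilon>\<^bsub>C\<^esub> c),
     zero = (\<lambda>c\<in>carrier C. \<zero>\<^bsub>k\<^esub>),
     add = (\<lambda>f g. \<lambda>c\<in>carrier C. f c \<oplus>\<^bsub>k\<^esub> g c),
     smult = (\<lambda>a f. \<lambda>c\<in>carrier C. a \<otimes>\<^bsub>k\<^esub> f c)\<rparr>"

text \<open>The left action of \<open>C\<^sup>*\<close> on \<open>C\<close>: \<open>f \<cdot> c = \<Sum> c\<^sub>1 f(c\<^sub>2)\<close>.\<close>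

definition dual_action ::
  "('k, 'r) ring_scheme \<Rightarrow> ('k, 'c, 'm) coalgebra_scheme \<Rightarrow> ('c \<Rightarrow> 'k) \<Rightarrow> 'c \<Rightarrow> 'c"
  where "dual_action k C f c = tensor_lift k C (\<lambda>u v. f v \<odot>\<^bsub>C\<^esub> u) (\<Delta>\<^bsub>C\<^esub> c)"

definition dual_submodule ::
  "('k, 'r) ring_scheme \<Rightarrow> ('k, 'c, 'm) coalgebra_scheme \<Rightarrow> 'c set \<Rightarrow> bool"
  where "dual_submodule k C S \<longleftrightarrow> submodule k S C \<and>
    (\<forall>f \<in> carrier (dual_algebra k C). \<forall>c \<in> S. dual_action k C f c \<in> S)"

definition simple_dual_submodule ::
  "('k, 'r) ring_scheme \<Rightarrow> ('k, 'c, 'm) coalgebra_scheme \<Rightarrow> 'c set \<Rightarrow> bool"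
  where "simple_dual_submodule k C S \<longleftrightarrow> dual_submodule k C S \<and> S \<noteq> {\<zero>\<^bsub>C\<^esub>} \<and>
    (\<forall>T. dual_submodule k C T \<and> T \<subseteq> S \<longrightarrow> T = {\<zero>\<^bsub>C\<^esub>} \<or> T = S)"

definition coradical ::
  "('k, 'r) ring_scheme \<Rightarrow> ('k, 'c, 'm) coalgebra_scheme \<Rightarrow> 'c set"
  where "coradical k C = module.span k C (\<Union> {S. simple_dual_submodule k C S})"

text \<open>
  The coalgebra structure induced on a subcoalgebra \<open>S\<close>: over a field \<open>S \<otimes> S \<rightarrow> C \<otimes> C\<close> is
  injective, and \<open>\<Delta> c\<close> for \<open>c \<in> S\<close> is pulled back along it.
\<close>

definition sub_coalgebra ::
  "('k, 'r) ring_scheme \<Rightarrow> ('k, 'c, 'm) coalgebra_scheme \<Rightarrow> 'c set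
    \<Rightarrow> ('k, 'c, 'm) coalgebra_scheme"
  where "sub_coalgebra k C S = C
    \<lparr>carrier := S,
     comult := (\<lambda>c. THE t. t \<in> carrier (tensor k (C\<lparr>carrier := S\<rparr>) (C\<lparr>carrier := S\<rparr>)) \<and>
        tensor_map k C C (\<lambda>u. u) (\<lambda>v. v) t = \<Delta>\<^bsub>C\<^esub> c)\<rparr>"


section \<open>Algebras and chain rings\<close>

text \<open>The locale \<^locale>\<open>algebra\<close> of the library is restricted to commutative algebras.\<close>

locale assoc_algebra = vectorspace k A + A: ring A
  for k :: "('k, 'r) ring_scheme" and A :: "('k, 'a, 'm) module_scheme" +
  assumes smult_mult_left: "\<lbrakk>a \<in> carrier k; x \<in> carrier A; y \<in> carrier A\<rbrakk> \<Longrightarrow>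
      (a \<odot>\<^bsub>A\<^esub> x) \<otimes>\<^bsub>A\<^esub> y = a \<odot>\<^bsub>A\<^esub> (x \<otimes>\<^bsub>A\<^esub> y)"
    and smult_mult_right: "\<lbrakk>a \<in> carrier k; x \<in> carrier A; y \<in> carrier A\<rbrakk> \<Longrightarrow>
      x \<otimes>\<^bsub>A\<^esub> (a \<odot>\<^bsub>A\<^esub> y) = a \<odot>\<^bsub>A\<^esub> (x \<otimes>\<^bsub>A\<^esub> y)"

locale division_algebra = assoc_algebra +
  assumes one_neq_zero: "\<one>\<^bsub>A\<^esub> \<noteq> \<zero>\<^bsub>A\<^esub>"
    and units: "Units A = carrier A - {\<zero>\<^bsub>A\<^esub>}"

definition algebra_iso ::
  "('k, 'r) ring_scheme \<Rightarrow> ('k, 'a, 'm) module_scheme \<Rightarrow> ('k, 'b, 'n) module_scheme \<Rightarrow> ('a \<Rightarrow> 'b) set"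
  where "algebra_iso k A B = ring_iso A B \<inter> module_hom k A B"

definition algebra_isomorphic ::
  "('k, 'r) ring_scheme \<Rightarrow> ('k, 'a, 'm) module_scheme \<Rightarrow> ('k, 'b, 'n) module_scheme \<Rightarrow> bool"
  where "algebra_isomorphic k A B \<longleftrightarrow> algebra_iso k A B \<noteq> {}"

definition left_ideal :: "'a set \<Rightarrow> ('a, 'm) ring_scheme \<Rightarrow> bool"
  where "left_ideal I A \<longleftrightarrow> additive_subgroup I A \<and>
    (\<forall>a \<in> carrier A. \<forall>x \<in> I. a \<otimes>\<^bsub>A\<^esub> x \<in> I)"

definition maximal_left_ideal :: "'a set \<Rightarrow> ('a, 'm) ring_scheme \<Rightarrow> bool"
  where "maximal_left_ideal I A \<longleftrightarrow> left_ideal I A \<and> I \<noteq> carrier A \<and>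
    (\<forall>J. left_ideal J A \<and> I \<subseteq> J \<longrightarrow> J = I \<or> J = carrier A)"

definition Jac :: "('a, 'm) ring_scheme \<Rightarrow> 'a set"
  where "Jac A = {x \<in> carrier A. \<forall>I. maximal_left_ideal I A \<longrightarrow> x \<in> I}"

primrec ideal_power :: "('a, 'm) ring_scheme \<Rightarrow> 'a set \<Rightarrow> nat \<Rightarrow> 'a set"
  where
    "ideal_power A I 0 = carrier A"
  | "ideal_power A I (Suc n) = ideal_prod A (ideal_power A I n) I"

definition fin_dim_chain_ring ::
  "('k, 'r) ring_scheme \<Rightarrow> ('k, 'a, 'm) module_scheme \<Rightarrow> bool"
  where "fin_dim_chain_ring k A \<longleftrightarrow> assoc_algebra k A \<and> vectorspace.fin_dim k A \<and>
    (\<forall>I J. left_ideal I A \<and> left_ideal J A \<longrightarrow> I \<subseteq> J \<or> J \<subseteq> I)"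


section \<open>The two sides of the correspondence\<close>

definition fin_dim_chain_coalgebra_of_type ::
  "('k, 'r) ring_scheme \<Rightarrow> ('k, 'd, 'n) module_scheme \<Rightarrow> ('k, 'c, 'm) coalgebra_scheme \<Rightarrow> bool"
  where "fin_dim_chain_coalgebra_of_type k D C \<longleftrightarrow>
    chain_coalgebra k C \<and> vectorspace.fin_dim k C \<and>
    algebra_isomorphic k D (dual_algebra k (sub_coalgebra k C (coradical k C)))"

definition chain_ring_with_residue_field ::
  "('k, 'r) ring_scheme \<Rightarrow> ('k, 'd, 'n) module_scheme \<Rightarrow> ('k, 'a, 'm) module_scheme \<Rightarrow> bool"
  where "chain_ring_with_residue_field k D A \<longleftrightarrow>
    fin_dim_chain_ring k A \<and>
    algebra_isomorphic k (quotient_algebra A (Jac A)) D \<and>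
    {I. left_ideal I A} = range (ideal_power A (Jac A))"

end

theory Submission
  imports Defs
begin

text \<open>
  A finite-dimensional coalgebra \<open>C\<close> and its dual algebra \<open>A = C\<^sup>*\<close> determine each other, and the
  whole correspondence is linear duality between \<open>C\<close> and \<open>A\<close>. Two facts make this precise. Tensors
  are separated by products of functionals, so \<open>\<Delta> c\<close> is known as soon as all the scalars
  \<open>(f \<otimes> g)(\<Delta> c) = (f * g)(c)\<close> are known; and every functional on \<open>A\<close> is evaluation at a point of
  \<open>C\<close>. Hence the coalgebra axioms are exactly the algebra axioms of \<open>A\<close> (\<open>dual_is_algebra\<close>,
  \<open>coalgebraI\<close>), isomorphisms of coalgebras are the transposes of isomorphisms of dual algebras
  (\<open>coalgebra_isomorphic_iff_dual\<close>), and every finite-dimensional algebra is the dual of a coalgebra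
  structure on its dual space (\<open>dual_coalgebra\<close>, \<open>evaluation_iso\<close>).

  A right coideal of \<open>C\<close> is the same as a subspace stable under the action \<open>f \<cdot> c = \<Sum> c\<^sub>1 f(c\<^sub>2)\<close>
  (\<open>right_coideal_iff\<close>), because \<open>\<Delta> c = \<Sum> (b\<^sup>* \<cdot> c) \<otimes> b\<close> for a basis of elements \<open>b\<close>. Since
  \<open>g (f \<cdot> c) = (g * f)(c)\<close>, taking annihilators is an inclusion-reversing bijection between right
  coideals of \<open>C\<close> and right ideals of \<open>A\<close>. So \<open>C\<close> is a chain coalgebra iff the \<^emph>\<open>right\<close> ideals of
  \<open>A\<close> form a chain (\<open>chain_coalgebra_iff\<close>).

  The definition of a chain ring asks for \<^emph>\<open>left\<close> ideals instead, and the passage between the two sides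
  is the one ring-theoretic step (\<open>left_chain_uniformizer\<close>). If the left ideals of \<open>A \<noteq> 0\<close> form a
  chain, then the nonunits are the largest left ideal, they form a two-sided nilpotent ideal, and they
  are generated by one element, say \<open>A x\<close>. Every nonzero element is \<open>u x\<^sup>i\<close> with a unit \<open>u\<close>, from
  which it follows that \<open>x a = 0\<close> iff \<open>a x = 0\<close>. Left and right multiplication by \<open>x\<close> therefore have
  the same kernel, so their images \<open>x A \<subseteq> A x\<close> have the same dimension and coincide. Finite
  dimension over \<open>k\<close> is essential here. Once the nonunits are \<open>A x = x A\<close>, the left ideals and the
  right ideals are precisely the sets \<open>A x\<^sup>i\<close>, and the latter are the powers of the Jacobson radical
  (\<open>left_ideals_eq_powers\<close>).

  Finally, let \<open>M\<close> be the ideal of nonunits. It is the largest proper right ideal, so its annihilator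
  in \<open>C\<close> is the smallest nonzero right coideal, which is the coradical \<open>C\<^sub>0\<close> (\<open>coradical_eq\<close>). Restriction
  of functionals to \<open>C\<^sub>0\<close> is a surjective homomorphism \<open>A \<rightarrow> C\<^sub>0\<^sup>*\<close> with kernel \<open>M\<close>, and so
  \<open>A / Jac A\<close> is isomorphic to \<open>C\<^sub>0\<^sup>*\<close>: the type of \<open>C\<close> is the residue field of \<open>A\<close>.
\<close>

section \<open>Linear maps and functionals\<close>

lemma module_homI:
  assumes "\<And>v. v \<in> carrier V \<Longrightarrow> f v \<in> carrier W"
    and "\<And>v w. v \<in> carrier V \<Longrightarrow> w \<in> carrier V \<Longrightarrow> f (v \<oplus>\<^bsub>V\<^esub> w) = f v \<oplus>\<^bsub>W\<^esub> f w"
    and "\<And>a v. a \<in> carrier k \<Longrightarrow> v \<in> carrier V \<Longrightarrow> f (a \<odot>\<^bsub>V\<^esub> v) = a \<odot>\<^bsub>W\<^esub> f v"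
  shows "f \<in> module_hom k V W"
  unfolding module_hom_def using assms by blast

lemma hom_in: "f \<in> module_hom k V W \<Longrightarrow> v \<in> carrier V \<Longrightarrow> f v \<in> carrier W"
  unfolding module_hom_def by blast

lemma mod_homI: "module k V \<Longrightarrow> module k W \<Longrightarrow> f \<in> module_hom k V W \<Longrightarrow> mod_hom k V W f"
  by (simp add: mod_hom.intro mod_hom_axioms.intro)

lemma hom_zero:
  "module k V \<Longrightarrow> module k W \<Longrightarrow> f \<in> module_hom k V W \<Longrightarrow> f \<zero>\<^bsub>V\<^esub> = \<zero>\<^bsub>W\<^esub>"
  using mod_hom.f0_is_0[OF mod_homI] .

lemma hom_minus:
  assumes "module k V" "module k W" "f \<in> module_hom k V W" "v \<in> carrier V" "w \<in> carrier V"
  shows "f (v \<ominus>\<^bsub>V\<^esub> w) = f v \<ominus>\<^bsub>W\<^esub> f w"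
  by (rule mod_hom.f_minus[OF mod_homI[OF assms(1-3)] assms(4,5)])

lemma hom_finsum:
  assumes V: "module k V" and W: "module k W" and f: "f \<in> module_hom k V W"
    and I: "finite I" and g: "g \<in> I \<rightarrow> carrier V"
  shows "f (\<Oplus>\<^bsub>V\<^esub>i\<in>I. g i) = (\<Oplus>\<^bsub>W\<^esub>i\<in>I. f (g i))"
proof -
  interpret V: module k V by fact
  interpret W: module k W by fact
  show ?thesis using I g
  proof (induction I)
    case empty show ?case using hom_zero[OF V W f] by simp
  next
    case (insert i I)
    then have gi: "g i \<in> carrier V" and gI: "g \<in> I \<rightarrow> carrier V" by auto
    have fI: "(\<lambda>j. f (g j)) \<in> I \<rightarrow> carrier W" using gI hom_in[OF f] by blast
    have "f (\<Oplus>\<^bsub>V\<^esub>j\<in>insert i I. g j) = f (g i \<oplus>\<^bsub>V\<^esub> (\<Oplus>\<^bsub>V\<^esub>j\<in>I. g j))"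
      using insert gi gI by simp
    also have "\<dots> = f (g i) \<oplus>\<^bsub>W\<^esub> (\<Oplus>\<^bsub>W\<^esub>j\<in>I. f (g j))"
      using module_hom_add[OF f gi V.finsum_closed[OF gI]] insert.IH[OF gI] by simp
    also have "\<dots> = (\<Oplus>\<^bsub>W\<^esub>j\<in>insert i I. f (g j))"
      using W.finsum_insert[OF insert(1,2) fI hom_in[OF f gi]] by simp
    finally show ?case .
  qed
qed

lemma hom_cong:
  assumes f: "f \<in> module_hom k V W" and eq: "\<And>v. v \<in> carrier V \<Longrightarrow> f v = g v"
    and V: "module k V"
  shows "g \<in> module_hom k V W"
proof -
  interpret V: module k V by fact
  show ?thesis
  proof (rule module_homI)
    show "g v \<in> carrier W" if "v \<in> carrier V" for v
      using hom_in[OF f that] eq[OF that] by simp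
    show "g (v \<oplus>\<^bsub>V\<^esub> w) = g v \<oplus>\<^bsub>W\<^esub> g w" if "v \<in> carrier V" "w \<in> carrier V" for v w
      using module_hom_add[OF f that] eq that by simp
    show "g (a \<odot>\<^bsub>V\<^esub> v) = a \<odot>\<^bsub>W\<^esub> g v" if "a \<in> carrier k" "v \<in> carrier V" for a v
      using module_hom_smult[OF f that] eq that by simp
  qed
qed

lemma hom_compose:
  assumes f: "f \<in> module_hom k V W" and g: "g \<in> module_hom k W U"
  shows "(\<lambda>v. g (f v)) \<in> module_hom k V U"
  by (rule module_homI)
    (simp_all add: hom_in[OF f] hom_in[OF g] module_hom_add[OF f] module_hom_add[OF g]
      module_hom_smult[OF f] module_hom_smult[OF g])

lemma self_module_simps [simp]:
  "carrier (self_module k) = carrier k" "zero (self_module k) = \<zero>\<^bsub>k\<^esub>"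
  "add (self_module k) = add k" "smult (self_module k) = mult k"
  by (simp_all add: self_module_def)

lemma hom_smult_const:
  assumes W: "module k W" and f: "f \<in> module_hom k V (self_module k)" and w: "w \<in> carrier W"
  shows "(\<lambda>v. f v \<odot>\<^bsub>W\<^esub> w) \<in> module_hom k V W"
proof -
  interpret W: module k W by fact
  have c: "f v \<in> carrier k" if "v \<in> carrier V" for v using hom_in[OF f that] by simp
  show ?thesis
    using module_hom_add[OF f] module_hom_smult[OF f] w
    by (intro module_homI) (simp_all add: c W.smult_l_distr W.smult_assoc1)
qed

lemma hom_id: "(\<lambda>v. v) \<in> module_hom k V V"
  by (rule module_homI) auto

lemma self_module_module: "cring k \<Longrightarrow> module k (self_module k)"
proof -
  assume "cring k"
  then interpret k: cring k .
  have "\<exists>y\<in>carrier k. x \<oplus>\<^bsub>k\<^esub> y = \<zero>\<^bsub>k\<^esub>" if "x \<in> carrier k" for x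
    using that k.r_neg k.a_inv_closed by blast
  with k.is_cring show ?thesis
    by (intro module_criteria)
      (simp_all add: k.m_assoc k.l_distr k.r_distr k.add.m_ac)
qed

lemma submodule_finsum:
  assumes "submodule k S V" "finite I" "\<And>i. i \<in> I \<Longrightarrow> g i \<in> S"
  shows "(\<Oplus>\<^bsub>V\<^esub>i\<in>I. g i) \<in> S"
proof -
  interpret S: submodule k S V by fact
  interpret V: module k V by (fact S.module)
  show ?thesis using assms(2,3)
  proof (induction I)
    case (insert i I)
    then have "g i \<in> carrier V" "g \<in> I \<rightarrow> carrier V" using S.subset by auto
    with insert show ?case by simp
  qed simp
qed

text \<open>
  Finite-dimensional duality is developed from frames: finitely many vectors \<open>b\<close> with functionals
  \<open>e b\<close> such that \<open>v = \<Sum> e b v \<cdot> b\<close>. A frame adapted to a subspace \<open>S\<close> comes from extending a maximal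
  independent subset of \<open>S\<close> to a basis; the coordinates of a vector of \<open>S\<close> at basis vectors outside
  \<open>S\<close> then vanish.
\<close>

lemma (in vectorspace) adapted_frame:
  assumes fd: "fin_dim" and S: "submodule K S V"
  obtains B e where "finite B" "B \<subseteq> carrier V"
    "\<And>b. b \<in> B \<Longrightarrow> e b \<in> module_hom K V (self_module K)"
    "\<And>v. v \<in> carrier V \<Longrightarrow> v = (\<Oplus>\<^bsub>V\<^esub>b\<in>B. e b v \<odot>\<^bsub>V\<^esub> b)"
    "\<And>s b. s \<in> S \<Longrightarrow> b \<in> B - S \<Longrightarrow> e b s = \<zero>\<^bsub>K\<^esub>"
proof -
  interpret S: submodule K S V by fact
  have bound: "finite X \<and> card X \<le> dim" if "X \<subseteq> carrier V" "lin_indpt X" for X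
    using li_le_dim[OF fd that] by auto
  have empty: "lin_indpt {}" by (rule finite_lin_indpt2) auto
  obtain A where A: "maximal A (\<lambda>X. X \<subseteq> S \<and> lin_indpt X)"
    using maximal_exists[of "\<lambda>X. X \<subseteq> S \<and> lin_indpt X" dim "{}"] bound S.subset empty by blast
  then have AS: "A \<subseteq> S" and Ali: "lin_indpt A"
    and Amax: "\<And>X. A \<subseteq> X \<Longrightarrow> X \<subseteq> S \<Longrightarrow> lin_indpt X \<Longrightarrow> X = A"
    by (auto simp: maximal_def)
  have AV: "A \<subseteq> carrier V" using AS S.subset by blast
  have finA: "finite A" using bound AV Ali by blast
  obtain B where B: "maximal B (\<lambda>X. A \<subseteq> X \<and> X \<subseteq> carrier V \<and> lin_indpt X)"
    using maximal_exists[of "\<lambda>X. A \<subseteq> X \<and> X \<subseteq> carrier V \<and> lin_indpt X" dim A] bound AV Ali by blast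
  have AB: "A \<subseteq> B" and BV: "B \<subseteq> carrier V"
    using B unfolding maximal_def by blast+
  have "maximal B (\<lambda>X. X \<subseteq> carrier V \<and> lin_indpt X)"
    using B AB unfolding maximal_def by blast
  then have basis: "basis B" by (intro max_li_is_basis)
  have finB: "finite B" using bound basis by (auto simp: basis_def)
  have ex1: "\<exists>!a. a \<in> B \<rightarrow>\<^sub>E carrier K \<and> lincomb a B = v" if "v \<in> carrier V" for v
    using basis_criterion[OF finB BV] basis that by blast
  define c where "c v = (THE a. a \<in> B \<rightarrow>\<^sub>E carrier K \<and> lincomb a B = v)" for v
  have c: "c v \<in> B \<rightarrow>\<^sub>E carrier K" "lincomb (c v) B = v" if "v \<in> carrier V" for v
    using theI'[OF ex1[OF that]] by (auto simp: c_def)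
  have uniq: "c v b = a b" if "a \<in> B \<rightarrow> carrier K" "lincomb a B = v" "b \<in> B" for v a b
  proof -
    have v: "v \<in> carrier V" using that BV by blast
    have "restrict a B \<in> B \<rightarrow>\<^sub>E carrier K" using that by auto
    moreover have "lincomb (restrict a B) B = v"
      using lincomb_cong[of B B "restrict a B" a] that BV by auto
    ultimately have "restrict a B = c v" using ex1[OF v] c[OF v] by blast
    then show ?thesis using that(3) by (metis restrict_apply')
  qed
  have c1: "c v b \<in> carrier K" if "v \<in> carrier V" "b \<in> B" for v b using c[OF that(1)] that by auto
  have add: "c (v \<oplus>\<^bsub>V\<^esub> w) b = c v b \<oplus>\<^bsub>K\<^esub> c w b"
    if "v \<in> carrier V" "w \<in> carrier V" "b \<in> B" for v w b
  proof (rule uniq[OF _ _ that(3)])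
    show "(\<lambda>b. c v b \<oplus>\<^bsub>K\<^esub> c w b) \<in> B \<rightarrow> carrier K" using c1 that by auto
    have "lincomb (\<lambda>b. c v b \<oplus>\<^bsub>K\<^esub> c w b) B = (\<Oplus>\<^bsub>V\<^esub>b\<in>B. c v b \<odot>\<^bsub>V\<^esub> b \<oplus>\<^bsub>V\<^esub> c w b \<odot>\<^bsub>V\<^esub> b)"
      unfolding lincomb_def using BV c1 that
      by (intro finsum_cong') (auto simp: smult_l_distr subset_iff)
    also have "\<dots> = lincomb (c v) B \<oplus>\<^bsub>V\<^esub> lincomb (c w) B"
      unfolding lincomb_def using BV c1 that by (intro finsum_addf) (auto simp: subset_iff)
    finally show "lincomb (\<lambda>b. c v b \<oplus>\<^bsub>K\<^esub> c w b) B = v \<oplus>\<^bsub>V\<^esub> w" using c that by simp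
  qed
  have smult: "c (a \<odot>\<^bsub>V\<^esub> v) b = a \<otimes>\<^bsub>K\<^esub> c v b"
    if "a \<in> carrier K" "v \<in> carrier V" "b \<in> B" for v a b
  proof (rule uniq[OF _ _ that(3)])
    show "(\<lambda>b. a \<otimes>\<^bsub>K\<^esub> c v b) \<in> B \<rightarrow> carrier K" using c1 that by auto
    show "lincomb (\<lambda>b. a \<otimes>\<^bsub>K\<^esub> c v b) B = a \<odot>\<^bsub>V\<^esub> v"
      using lincomb_smult[OF BV _ that(1), of "c v"] c c1 that by auto
  qed
  show ?thesis
  proof (rule that[of B "\<lambda>b v. c v b"])
    show "finite B" "B \<subseteq> carrier V" by fact+
    show "(\<lambda>v. c v b) \<in> module_hom K V (self_module K)" if "b \<in> B" for b
      using that c1 add smult by (intro module_homI) auto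
    show "v = (\<Oplus>\<^bsub>V\<^esub>b\<in>B. c v b \<odot>\<^bsub>V\<^esub> b)" if "v \<in> carrier V" for v
      using c(2)[OF that] by (simp add: lincomb_def)
    show "c s b = \<zero>\<^bsub>K\<^esub>" if s: "s \<in> S" and b: "b \<in> B - S" for s b
    proof -
      have sV: "s \<in> carrier V" using s S.subset by auto
      have "s \<in> span A"
      proof (rule ccontr)
        assume "s \<notin> span A"
        moreover from this have "s \<notin> A" using in_own_span[OF AV] by blast
        ultimately have "lin_indpt (A \<union> {s})" using lin_dep_iff_in_span[OF AV Ali sV] by blast
        then show False using Amax[of "A \<union> {s}"] AS s \<open>s \<notin> A\<close> by blast
      qed
      then obtain a where a: "a \<in> A \<rightarrow> carrier K" "lincomb a A = s"
        using finite_in_span[OF finA AV] by blast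
      define a' where "a' x = (if x \<in> A then a x else \<zero>\<^bsub>K\<^esub>)" for x
      have a': "a' \<in> B \<rightarrow> carrier K" using a by (auto simp: a'_def)
      have "lincomb a' B = lincomb a' A \<oplus>\<^bsub>V\<^esub> lincomb a' (B - A)"
      proof -
        have "A \<union> (B - A) = B" using AB by blast
        then show ?thesis using lincomb_union[of A "B - A" a'] finB finA AV BV a' by auto
      qed
      moreover have "lincomb a' (B - A) = \<zero>\<^bsub>V\<^esub>"
        using BV by (intro lincomb_zero) (auto simp: a'_def)
      moreover have "lincomb a' A = lincomb a A"
        using a AV by (intro lincomb_cong) (auto simp: a'_def)
      ultimately have "lincomb a' B = s" using a sV by simp
      then have "c s b = a' b" using uniq[OF a'] b by blast
      then show ?thesis using b AS by (auto simp: a'_def)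
    qed
  qed
qed

lemma (in vectorspace) zero_submodule: "submodule K {\<zero>\<^bsub>V\<^esub>} V"
  using module_axioms by (simp add: submodule_def)

lemma (in vectorspace) frame:
  assumes "fin_dim"
  obtains B e where "finite B" "B \<subseteq> carrier V"
    "\<And>b. b \<in> B \<Longrightarrow> e b \<in> module_hom K V (self_module K)"
    "\<And>v. v \<in> carrier V \<Longrightarrow> v = (\<Oplus>\<^bsub>V\<^esub>b\<in>B. e b v \<odot>\<^bsub>V\<^esub> b)"
  by (rule adapted_frame[OF assms zero_submodule]) (rule that)

text \<open>
  One of the coordinate functionals of an adapted frame does it: if all those belonging to vectors
  outside \<open>S\<close> vanished at \<open>v\<close>, the expansion of \<open>v\<close> would lie in \<open>S\<close>.
\<close>

lemma (in vectorspace) separating_functional: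
  assumes fd: "fin_dim" and S: "submodule K S V" and v: "v \<in> carrier V" "v \<notin> S"
  obtains f where "f \<in> module_hom K V (self_module K)" "\<And>s. s \<in> S \<Longrightarrow> f s = \<zero>\<^bsub>K\<^esub>" "f v \<noteq> \<zero>\<^bsub>K\<^esub>"
proof -
  obtain B e where B: "finite B" "B \<subseteq> carrier V"
    "\<And>b. b \<in> B \<Longrightarrow> e b \<in> module_hom K V (self_module K)"
    "\<And>v. v \<in> carrier V \<Longrightarrow> v = (\<Oplus>\<^bsub>V\<^esub>b\<in>B. e b v \<odot>\<^bsub>V\<^esub> b)"
    "\<And>s b. s \<in> S \<Longrightarrow> b \<in> B - S \<Longrightarrow> e b s = \<zero>\<^bsub>K\<^esub>"
    by (rule adapted_frame[OF fd S]) (rule that)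
  have e: "e b v \<in> carrier K" if "b \<in> B" for b using hom_in[OF B(3)[OF that] v(1)] by simp
  interpret S: submodule K S V by fact
  have "\<exists>b\<in>B - S. e b v \<noteq> \<zero>\<^bsub>K\<^esub>"
  proof (rule ccontr)
    assume *: "\<not> ?thesis"
    have "e b v \<odot>\<^bsub>V\<^esub> b \<in> S" if b: "b \<in> B" for b
    proof (cases "b \<in> S")
      case True then show ?thesis using e[OF b] by blast
    next
      case False
      then have "e b v = \<zero>\<^bsub>K\<^esub>" using * b by blast
      moreover have "b \<in> carrier V" using B(2) b by blast
      ultimately show ?thesis by simp
    qed
    then have "(\<Oplus>\<^bsub>V\<^esub>b\<in>B. e b v \<odot>\<^bsub>V\<^esub> b) \<in> S" by (rule submodule_finsum[OF S B(1)])
    then show False using B(4)[OF v(1)] v(2) by metis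
  qed
  then obtain b where b: "b \<in> B" "b \<notin> S" "e b v \<noteq> \<zero>\<^bsub>K\<^esub>" by blast
  show ?thesis
    by (rule that[OF B(3)[OF b(1)] _ b(3)], rule B(5)) (use b in auto)
qed

lemma (in vectorspace) functionals_separate:
  assumes fd: "fin_dim" and v: "v \<in> carrier V" "w \<in> carrier V"
    and eq: "\<And>f. f \<in> module_hom K V (self_module K) \<Longrightarrow> f v = f w"
  shows "v = w"
proof (rule ccontr)
  assume "v \<noteq> w"
  then have "v \<ominus>\<^bsub>V\<^esub> w \<notin> {\<zero>\<^bsub>V\<^esub>}" using v by simp
  then obtain f where f: "f \<in> module_hom K V (self_module K)" "f (v \<ominus>\<^bsub>V\<^esub> w) \<noteq> \<zero>\<^bsub>K\<^esub>"
    using separating_functional[OF fd zero_submodule] v by (metis minus_closed)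
  have "f (v \<ominus>\<^bsub>V\<^esub> w) = f v \<ominus>\<^bsub>self_module K\<^esub> f w"
    by (rule hom_minus[OF module_axioms self_module_module f(1) v]) unfold_locales
  also have "\<dots> = \<zero>\<^bsub>K\<^esub>"
    using eq[OF f(1)] hom_in[OF f(1) v(2)]
      abelian_group.minus_other_side[OF module.axioms(2)[OF self_module_module]]
    by (metis R.cring_axioms self_module_simps(1,2))
  finally show False using f by simp
qed

text \<open>
  The projection keeps those terms of the expansion in an adapted frame that belong to \<open>S\<close>.
\<close>

lemma (in vectorspace) submodule_projection:
  assumes fd: "fin_dim" and S: "submodule K S V"
  obtains p where "p \<in> module_hom K V V" "\<And>v. v \<in> carrier V \<Longrightarrow> p v \<in> S" "\<And>s. s \<in> S \<Longrightarrow> p s = s"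
proof -
  interpret S: submodule K S V by fact
  obtain B e where B: "finite B" "B \<subseteq> carrier V"
    "\<And>b. b \<in> B \<Longrightarrow> e b \<in> module_hom K V (self_module K)"
    "\<And>v. v \<in> carrier V \<Longrightarrow> v = (\<Oplus>\<^bsub>V\<^esub>b\<in>B. e b v \<odot>\<^bsub>V\<^esub> b)"
    "\<And>s b. s \<in> S \<Longrightarrow> b \<in> B - S \<Longrightarrow> e b s = \<zero>\<^bsub>K\<^esub>"
    by (rule adapted_frame[OF fd S]) (rule that)
  have e: "e b v \<in> carrier K" if "b \<in> B" "v \<in> carrier V" for b v
    using hom_in[OF B(3)[OF that(1)] that(2)] by simp
  have [simp]: "b \<in> carrier V" if "b \<in> B" for b using that B by auto
  define p where "p v = (\<Oplus>\<^bsub>V\<^esub>b\<in>B \<inter> S. e b v \<odot>\<^bsub>V\<^esub> b)" for v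
  show ?thesis
  proof (rule that[of p])
    show "p \<in> module_hom K V V"
    proof (rule module_homI)
      fix v w assume vw: "v \<in> carrier V" "w \<in> carrier V"
      have "p (v \<oplus>\<^bsub>V\<^esub> w) = (\<Oplus>\<^bsub>V\<^esub>b\<in>B \<inter> S. e b v \<odot>\<^bsub>V\<^esub> b \<oplus>\<^bsub>V\<^esub> e b w \<odot>\<^bsub>V\<^esub> b)"
        unfolding p_def using vw e
        by (intro finsum_cong') (auto simp: module_hom_add[OF B(3)] smult_l_distr)
      also have "\<dots> = p v \<oplus>\<^bsub>V\<^esub> p w"
        unfolding p_def using vw e by (intro finsum_addf) auto
      finally show "p (v \<oplus>\<^bsub>V\<^esub> w) = p v \<oplus>\<^bsub>V\<^esub> p w" .
    next
      fix a v assume av: "a \<in> carrier K" "v \<in> carrier V"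
      have "p (a \<odot>\<^bsub>V\<^esub> v) = (\<Oplus>\<^bsub>V\<^esub>b\<in>B \<inter> S. a \<odot>\<^bsub>V\<^esub> (e b v \<odot>\<^bsub>V\<^esub> b))"
        unfolding p_def using av e
        by (intro finsum_cong') (auto simp: module_hom_smult[OF B(3)] smult_assoc1)
      also have "\<dots> = a \<odot>\<^bsub>V\<^esub> p v"
        unfolding p_def using av e B(1) by (intro finsum_smult_ldistr[symmetric]) auto
      finally show "p (a \<odot>\<^bsub>V\<^esub> v) = a \<odot>\<^bsub>V\<^esub> p v" .
    qed (use e in \<open>auto simp: p_def\<close>)
    show "p v \<in> S" if "v \<in> carrier V" for v
      unfolding p_def using that e B(1) by (intro submodule_finsum[OF S]) auto
    show "p s = s" if s: "s \<in> S" for s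
    proof -
      have sV: "s \<in> carrier V" using s S.subset by auto
      have "(\<Oplus>\<^bsub>V\<^esub>b\<in>B. e b s \<odot>\<^bsub>V\<^esub> b) = p s"
        unfolding p_def using B(1) e[OF _ sV] B(5)[OF s]
        by (intro add.finprod_mono_neutral_cong_left[symmetric]) auto
      then show ?thesis using B(4)[OF sV] by simp
    qed
  qed
qed

lemma (in vectorspace) submodule_subspace: "submodule K S V \<longleftrightarrow> subspace K S V"
  using vectorspace_axioms by (auto simp: subspace_def)

lemma (in vectorspace) submodule_fin_dim:
  assumes fd: "fin_dim" and S: "submodule K S V"
  shows "vectorspace.fin_dim K (V\<lparr>carrier := S\<rparr>)"
proof -
  obtain p where p: "p \<in> module_hom K V V" "\<And>v. v \<in> carrier V \<Longrightarrow> p v \<in> S" "\<And>s. s \<in> S \<Longrightarrow> p s = s"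
    using submodule_projection[OF fd S] by metis
  have SV: "vectorspace K (V\<lparr>carrier := S\<rparr>)"
    using subspace_is_vs S submodule_subspace by blast
  have "p \<in> module_hom K V (V\<lparr>carrier := S\<rparr>)" using p by (auto simp: module_hom_def)
  then have "linear_map K V (V\<lparr>carrier := S\<rparr>) p"
    using SV vectorspace_axioms mod_homI by (auto simp: linear_map_def vectorspace_def)
  moreover have "p ` carrier V = carrier (V\<lparr>carrier := S\<rparr>)"
    using p S by (force simp: submodule_def image_iff)
  ultimately show ?thesis using linear_map.rank_nullity_main(2) fd by blast
qed

lemma (in vectorspace) dim_submodule_less:
  assumes fd: "fin_dim" and S: "submodule K S V" and ne: "S \<noteq> carrier V"
  shows "vectorspace.dim K (V\<lparr>carrier := S\<rparr>) < dim"
proof -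
  interpret S: vectorspace K "V\<lparr>carrier := S\<rparr>"
    using subspace_is_vs S submodule_subspace by blast
  have Sfd: "S.fin_dim" using submodule_fin_dim[OF fd S] .
  then obtain B where B: "finite B" "S.basis B" using S.finite_basis_exists by blast
  have BS: "B \<subseteq> S" and li: "S.lin_indpt B" and BV: "B \<subseteq> carrier V"
    using B S by (auto simp: S.basis_def submodule_def)
  have "lin_indpt B" "span B = S.span B"
    using span_li_not_depend[OF BS S] li by auto
  then have li': "lin_indpt B" and sp: "span B = S" using B by (auto simp: S.basis_def)
  have "\<not> dim \<le> card B"
    using dim_li_is_basis[OF fd B(1) BV li'] sp ne by (auto simp: basis_def)
  then show ?thesis using S.dim_basis[OF B] by simp
qed

lemma (in vectorspace) submodule_eqI:
  assumes "fin_dim" "submodule K S V" "vectorspace.dim K (V\<lparr>carrier := S\<rparr>) = dim"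
  shows "S = carrier V"
  using dim_submodule_less assms by fastforce

lemma (in vectorspace) injective_endo_surjective:
  assumes fd: "fin_dim" and T: "T \<in> module_hom K V V"
    and inj: "inj_on T (carrier V)"
  shows "T ` carrier V = carrier V"
proof -
  interpret T: linear_map K V V T
    using mod_homI[OF module_axioms module_axioms T] vectorspace_axioms by (simp add: linear_map_def)
  have "vectorspace.dim K (vs T.ker) = 0" using inj by (rule T.inj_imp_dim_ker0)
  then have "vectorspace.dim K (vs T.im) = dim" using T.rank_nullity[OF fd] by simp
  then have "T.im = carrier V" by (rule submodule_eqI[OF fd T.im_is_submodule])
  then show ?thesis by (simp add: T.im_def)
qed

section \<open>Finite-dimensional algebras whose left ideals form a chain\<close>

lemma (in vectorspace) dim_submodule_strict_mono:
  assumes fd: "fin_dim" and S: "submodule K S V" and T: "submodule K T V" and "S \<subset> T"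
  shows "vectorspace.dim K (V\<lparr>carrier := S\<rparr>) < vectorspace.dim K (V\<lparr>carrier := T\<rparr>)"
proof -
  interpret T: vectorspace K "V\<lparr>carrier := T\<rparr>"
    using subspace_is_vs T submodule_subspace by blast
  have "submodule K S (V\<lparr>carrier := T\<rparr>)"
    using S \<open>S \<subset> T\<close> T.module_axioms by (auto simp: submodule_def)
  then show ?thesis
    using T.dim_submodule_less[OF submodule_fin_dim[OF fd T]] \<open>S \<subset> T\<close> by fastforce
qed

text \<open>
  Statements about right ideals are obtained from those about left ideals by passing to the opposite
  algebra. The notion of a uniformizer below is invariant under this passage, and this is how a chain
  of left ideals gives information about right ideals.
\<close>

definition opposite :: "('k, 'a, 'm) module_scheme \<Rightarrow> ('k, 'a, 'm) module_scheme"
  where "opposite A = A\<lparr>mult := (\<lambda>x y. y \<otimes>\<^bsub>A\<^esub> x)\<rparr>"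

definition right_ideal :: "'a set \<Rightarrow> ('a, 'm) ring_scheme \<Rightarrow> bool"
  where "right_ideal I A \<longleftrightarrow> additive_subgroup I A \<and>
    (\<forall>a \<in> carrier A. \<forall>x \<in> I. x \<otimes>\<^bsub>A\<^esub> a \<in> I)"

text \<open>
  A nilpotent element that generates the set of all nonunits both as a left ideal and as a right ideal,
  as in a truncated discrete valuation ring.
\<close>

definition uniformizer :: "('a, 'm) ring_scheme \<Rightarrow> 'a \<Rightarrow> bool"
  where "uniformizer A x \<longleftrightarrow> x \<in> carrier A \<and> (\<exists>n::nat. x [^]\<^bsub>A\<^esub> n = \<zero>\<^bsub>A\<^esub>) \<and>
    carrier A - Units A = (\<lambda>a. a \<otimes>\<^bsub>A\<^esub> x) ` carrier A \<and>
    carrier A - Units A = (\<lambda>a. x \<otimes>\<^bsub>A\<^esub> a) ` carrier A"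

lemma (in module) submodule_additive_subgroup:
  assumes "submodule R S M" shows "additive_subgroup S M"
proof -
  interpret S: submodule R S M by fact
  have "\<ominus>\<^bsub>M\<^esub> x \<in> S" if "x \<in> S" for x
  proof -
    have "(\<ominus>\<^bsub>R\<^esub> \<one>\<^bsub>R\<^esub>) \<odot>\<^bsub>M\<^esub> x \<in> S" using that by simp
    then show ?thesis using that S.subset smult_minus_1 by (metis subsetD)
  qed
  moreover have "S \<noteq> {}" using S.zero_closed by blast
  ultimately show ?thesis
    using S.subset unfolding additive_subgroup_def
    by (intro M.add.subgroupI) (auto simp: a_inv_def)
qed

locale fin_dim_algebra = assoc_algebra +
  assumes fin_dim: "vectorspace.fin_dim k A"
begin

lemma mult_right_hom: "x \<in> carrier A \<Longrightarrow> (\<lambda>a. a \<otimes>\<^bsub>A\<^esub> x) \<in> module_hom k A A"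
  by (rule module_homI) (simp_all add: A.l_distr smult_mult_left)

lemma mult_left_hom: "x \<in> carrier A \<Longrightarrow> (\<lambda>a. x \<otimes>\<^bsub>A\<^esub> a) \<in> module_hom k A A"
  by (rule module_homI) (simp_all add: A.r_distr smult_mult_right)

lemma mult_right_linear: "x \<in> carrier A \<Longrightarrow> linear_map k A A (\<lambda>a. a \<otimes>\<^bsub>A\<^esub> x)"
  using mod_homI[OF module_axioms module_axioms mult_right_hom] vectorspace_axioms
  by (simp add: linear_map_def)

lemma mult_left_linear: "x \<in> carrier A \<Longrightarrow> linear_map k A A (\<lambda>a. x \<otimes>\<^bsub>A\<^esub> a)"
  using mod_homI[OF module_axioms module_axioms mult_left_hom] vectorspace_axioms
  by (simp add: linear_map_def)

lemma principal_submodules: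
  assumes "x \<in> carrier A"
  shows "submodule k ((\<lambda>a. a \<otimes>\<^bsub>A\<^esub> x) ` carrier A) A" "submodule k ((\<lambda>a. x \<otimes>\<^bsub>A\<^esub> a) ` carrier A) A"
proof -
  interpret r: linear_map k A A "\<lambda>a. a \<otimes>\<^bsub>A\<^esub> x" by (rule mult_right_linear[OF assms])
  interpret l: linear_map k A A "\<lambda>a. x \<otimes>\<^bsub>A\<^esub> a" by (rule mult_left_linear[OF assms])
  show "submodule k ((\<lambda>a. a \<otimes>\<^bsub>A\<^esub> x) ` carrier A) A" using r.im_is_submodule by (simp add: r.im_def)
  show "submodule k ((\<lambda>a. x \<otimes>\<^bsub>A\<^esub> a) ` carrier A) A" using l.im_is_submodule by (simp add: l.im_def)
qed

text \<open>
  Right multiplication by \<open>y\<close> is injective because \<open>x\<close> undoes it, hence surjective by finite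
  dimension. So \<open>y\<close> also has a left inverse, and that is \<open>x\<close>.
\<close>

lemma one_sided_inverse_unit:
  assumes x: "x \<in> carrier A" and y: "y \<in> carrier A" and yx: "y \<otimes>\<^bsub>A\<^esub> x = \<one>\<^bsub>A\<^esub>"
  shows "x \<in> Units A" "y \<in> Units A"
proof -
  have cancel: "(a \<otimes>\<^bsub>A\<^esub> y) \<otimes>\<^bsub>A\<^esub> x = a" if "a \<in> carrier A" for a
    using that x y yx by (simp add: A.m_assoc)
  have "inj_on (\<lambda>a. a \<otimes>\<^bsub>A\<^esub> y) (carrier A)" by (rule inj_onI) (metis cancel)
  then have "(\<lambda>a. a \<otimes>\<^bsub>A\<^esub> y) ` carrier A = carrier A"
    by (rule injective_endo_surjective[OF fin_dim mult_right_hom[OF y]])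
  then obtain a where a: "a \<in> carrier A" "a \<otimes>\<^bsub>A\<^esub> y = \<one>\<^bsub>A\<^esub>" using A.one_closed by (metis imageE)
  then have "a = x" using cancel[OF a(1)] x by simp
  then show "x \<in> Units A" "y \<in> Units A" using a yx x y by (auto simp: Units_def)
qed

lemma nonunit_mult:
  assumes x: "x \<in> carrier A - Units A" and a: "a \<in> carrier A"
  shows "a \<otimes>\<^bsub>A\<^esub> x \<in> carrier A - Units A" "x \<otimes>\<^bsub>A\<^esub> a \<in> carrier A - Units A"
proof -
  have "a \<otimes>\<^bsub>A\<^esub> x \<notin> Units A"
  proof
    assume u: "a \<otimes>\<^bsub>A\<^esub> x \<in> Units A"
    have "(inv\<^bsub>A\<^esub> (a \<otimes>\<^bsub>A\<^esub> x) \<otimes>\<^bsub>A\<^esub> a) \<otimes>\<^bsub>A\<^esub> x = \<one>\<^bsub>A\<^esub>"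
      using x a A.Units_l_inv[OF u] A.Units_inv_closed[OF u] by (simp add: A.m_assoc)
    then show False using one_sided_inverse_unit(1) x a A.Units_inv_closed[OF u] by blast
  qed
  then show "a \<otimes>\<^bsub>A\<^esub> x \<in> carrier A - Units A" using x a by simp
  have "x \<otimes>\<^bsub>A\<^esub> a \<notin> Units A"
  proof
    assume u: "x \<otimes>\<^bsub>A\<^esub> a \<in> Units A"
    have "x \<otimes>\<^bsub>A\<^esub> (a \<otimes>\<^bsub>A\<^esub> inv\<^bsub>A\<^esub> (x \<otimes>\<^bsub>A\<^esub> a)) = \<one>\<^bsub>A\<^esub>"
      using x a A.Units_r_inv[OF u] A.Units_inv_closed[OF u] by (simp add: A.m_assoc)
    then show False using one_sided_inverse_unit(2) x a A.Units_inv_closed[OF u] by blast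
  qed
  then show "x \<otimes>\<^bsub>A\<^esub> a \<in> carrier A - Units A" using x a by simp
qed

lemma principal_left_ideal: "x \<in> carrier A \<Longrightarrow> left_ideal ((\<lambda>a. a \<otimes>\<^bsub>A\<^esub> x) ` carrier A) A"
proof -
  assume x: "x \<in> carrier A"
  interpret S: submodule k "(\<lambda>a. a \<otimes>\<^bsub>A\<^esub> x) ` carrier A" A by (rule principal_submodules(1)[OF x])
  show ?thesis unfolding left_ideal_def
  proof (intro conjI ballI)
    show "additive_subgroup ((\<lambda>a. a \<otimes>\<^bsub>A\<^esub> x) ` carrier A) A"
      by (rule submodule_additive_subgroup[OF S.submodule_axioms])
    fix b y assume "b \<in> carrier A" "y \<in> (\<lambda>a. a \<otimes>\<^bsub>A\<^esub> x) ` carrier A"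
    then show "b \<otimes>\<^bsub>A\<^esub> y \<in> (\<lambda>a. a \<otimes>\<^bsub>A\<^esub> x) ` carrier A"
      using x by (auto simp: A.m_assoc[symmetric])
  qed
qed

text \<open>
  Of two nonunits one is a left multiple of the other, because the left ideals they generate are
  comparable; then so is their sum, and multiples of nonunits are nonunits.
\<close>

lemma nonunits_add:
  assumes chain: "\<And>I J. left_ideal I A \<Longrightarrow> left_ideal J A \<Longrightarrow> I \<subseteq> J \<or> J \<subseteq> I"
    and x: "x \<in> carrier A - Units A" and y: "y \<in> carrier A - Units A"
  shows "x \<oplus>\<^bsub>A\<^esub> y \<in> carrier A - Units A"
proof -
  have *: "x \<oplus>\<^bsub>A\<^esub> y \<in> carrier A - Units A"
    if "x \<in> carrier A - Units A" "b \<in> carrier A" "y = b \<otimes>\<^bsub>A\<^esub> x" for x y b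
  proof -
    have "x \<oplus>\<^bsub>A\<^esub> y = (\<one>\<^bsub>A\<^esub> \<oplus>\<^bsub>A\<^esub> b) \<otimes>\<^bsub>A\<^esub> x" using that by (simp add: A.l_distr)
    then show ?thesis using nonunit_mult(1)[OF that(1), of "\<one>\<^bsub>A\<^esub> \<oplus>\<^bsub>A\<^esub> b"] that(2) by simp
  qed
  have "z \<in> (\<lambda>a. a \<otimes>\<^bsub>A\<^esub> z) ` carrier A" if "z \<in> carrier A" for z
    using that A.l_one[OF that] A.one_closed by (metis image_eqI)
  then have "x \<in> (\<lambda>a. a \<otimes>\<^bsub>A\<^esub> y) ` carrier A \<or> y \<in> (\<lambda>a. a \<otimes>\<^bsub>A\<^esub> x) ` carrier A"
    using chain[OF principal_left_ideal principal_left_ideal, of x y] x y by blast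
  then show ?thesis using *[OF x] *[OF y] x y M.a_comm by (metis (no_types, lifting) DiffE imageE)
qed

lemma one_minus_unit:
  assumes add: "\<And>x y. x \<in> carrier A - Units A \<Longrightarrow> y \<in> carrier A - Units A \<Longrightarrow>
      x \<oplus>\<^bsub>A\<^esub> y \<in> carrier A - Units A"
    and m: "m \<in> carrier A - Units A"
  shows "\<one>\<^bsub>A\<^esub> \<ominus>\<^bsub>A\<^esub> m \<in> Units A"
proof (rule ccontr)
  assume "\<one>\<^bsub>A\<^esub> \<ominus>\<^bsub>A\<^esub> m \<notin> Units A"
  then have "(\<one>\<^bsub>A\<^esub> \<ominus>\<^bsub>A\<^esub> m) \<oplus>\<^bsub>A\<^esub> m \<in> carrier A - Units A" using add m by simp
  moreover have "(\<one>\<^bsub>A\<^esub> \<ominus>\<^bsub>A\<^esub> m) \<oplus>\<^bsub>A\<^esub> m = \<one>\<^bsub>A\<^esub>"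
    using m by (simp add: a_minus_def M.a_assoc M.l_neg)
  ultimately show False by simp
qed

text \<open>
  The form of Nakayama's lemma used throughout: \<open>(1 - m) z = 0\<close> and \<open>1 - m\<close> is a unit.
\<close>

lemma fixed_by_nonunit_zero:
  assumes add: "\<And>x y. x \<in> carrier A - Units A \<Longrightarrow> y \<in> carrier A - Units A \<Longrightarrow>
      x \<oplus>\<^bsub>A\<^esub> y \<in> carrier A - Units A"
    and m: "m \<in> carrier A - Units A" and z: "z \<in> carrier A" "z = m \<otimes>\<^bsub>A\<^esub> z"
  shows "z = \<zero>\<^bsub>A\<^esub>"
proof -
  let ?u = "\<one>\<^bsub>A\<^esub> \<ominus>\<^bsub>A\<^esub> m"
  have u: "?u \<in> Units A" by (rule one_minus_unit[OF add m])
  have "?u \<otimes>\<^bsub>A\<^esub> z = z \<ominus>\<^bsub>A\<^esub> m \<otimes>\<^bsub>A\<^esub> z"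
    using m z(1) by (simp add: a_minus_def A.l_distr A.l_minus)
  also have "\<dots> = z \<ominus>\<^bsub>A\<^esub> z" using z(2) by simp
  also have "\<dots> = \<zero>\<^bsub>A\<^esub>" using z(1) by (simp add: a_minus_def M.r_neg)
  finally have "inv\<^bsub>A\<^esub> ?u \<otimes>\<^bsub>A\<^esub> (?u \<otimes>\<^bsub>A\<^esub> z) = \<zero>\<^bsub>A\<^esub>" using A.Units_inv_closed[OF u] by simp
  then show ?thesis
    using A.m_assoc[of "inv\<^bsub>A\<^esub> ?u" ?u z] A.Units_inv_closed[OF u] A.Units_closed[OF u]
      A.Units_l_inv[OF u] z(1) by simp
qed

text \<open>
  The left ideals \<open>A x\<^sup>i\<close> decrease, so \<open>A x\<^sup>i = A x\<^sup>i\<^sup>+\<^sup>1\<close> for some \<open>i\<close>, namely one of least dimension.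
  Then \<open>x\<^sup>i = (a x) x\<^sup>i\<close> with the nonunit \<open>a x\<close>.
\<close>

lemma nonunit_nilpotent:
  assumes add: "\<And>x y. x \<in> carrier A - Units A \<Longrightarrow> y \<in> carrier A - Units A \<Longrightarrow>
      x \<oplus>\<^bsub>A\<^esub> y \<in> carrier A - Units A"
    and x: "x \<in> carrier A - Units A"
  shows "\<exists>n::nat. x [^]\<^bsub>A\<^esub> n = \<zero>\<^bsub>A\<^esub>"
proof -
  define I where "I i = (\<lambda>a. a \<otimes>\<^bsub>A\<^esub> (x [^]\<^bsub>A\<^esub> i)) ` carrier A" for i :: nat
  have xc [simp]: "x \<in> carrier A" using x by simp
  have I: "submodule k (I i) A" for i unfolding I_def by (rule principal_submodules) simp
  have sub: "I (Suc i) \<subseteq> I i" for i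
  proof
    fix z assume "z \<in> I (Suc i)"
    then obtain a where a: "a \<in> carrier A" "z = a \<otimes>\<^bsub>A\<^esub> (x [^]\<^bsub>A\<^esub> Suc i)" by (auto simp: I_def)
    then have "z = (a \<otimes>\<^bsub>A\<^esub> x) \<otimes>\<^bsub>A\<^esub> (x [^]\<^bsub>A\<^esub> i)"
      by (simp only: A.nat_pow_Suc2[OF xc] A.m_assoc xc A.nat_pow_closed)
    then show "z \<in> I i" unfolding I_def by (rule image_eqI) (use a(1) in simp)
  qed
  define d where "d i = vectorspace.dim k (A\<lparr>carrier := I i\<rparr>)" for i
  obtain i where i: "\<And>j. d i \<le> d j"
    using ex_has_least_nat[of "\<lambda>_. True" 0 d] by blast
  have "I (Suc i) = I i"
  proof (rule ccontr)
    assume "I (Suc i) \<noteq> I i"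
    then have "d (Suc i) < d i"
      unfolding d_def using sub by (intro dim_submodule_strict_mono[OF fin_dim I I]) blast
    then show False using i[of "Suc i"] by simp
  qed
  moreover have "x [^]\<^bsub>A\<^esub> i \<in> I i"
    unfolding I_def by (rule image_eqI[of _ _ "\<one>\<^bsub>A\<^esub>"]) simp_all
  ultimately obtain a where a: "a \<in> carrier A" "x [^]\<^bsub>A\<^esub> i = a \<otimes>\<^bsub>A\<^esub> (x [^]\<^bsub>A\<^esub> Suc i)"
    by (auto simp: I_def)
  then have "x [^]\<^bsub>A\<^esub> i = (a \<otimes>\<^bsub>A\<^esub> x) \<otimes>\<^bsub>A\<^esub> (x [^]\<^bsub>A\<^esub> i)"
    using A.nat_pow_Suc2[OF xc, of i] A.m_assoc[OF a(1) xc A.nat_pow_closed[OF xc, of i]] by argo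
  then show ?thesis
    using fixed_by_nonunit_zero[OF add nonunit_mult(1)[OF x a(1)]] xc A.nat_pow_closed by blast
qed

text \<open>
  A nonunit \<open>x\<close> for which \<open>A x\<close> has the largest dimension generates all nonunits: \<open>A x\<close> is comparable
  with every \<open>A y\<close> and cannot be properly contained in one.
\<close>

lemma nonunits_principal:
  assumes chain: "\<And>I J. left_ideal I A \<Longrightarrow> left_ideal J A \<Longrightarrow> I \<subseteq> J \<or> J \<subseteq> I"
    and nontriv: "\<one>\<^bsub>A\<^esub> \<noteq> \<zero>\<^bsub>A\<^esub>"
  obtains x where "x \<in> carrier A - Units A" "carrier A - Units A = (\<lambda>a. a \<otimes>\<^bsub>A\<^esub> x) ` carrier A"
proof -
  define I where "I x = (\<lambda>a. a \<otimes>\<^bsub>A\<^esub> x) ` carrier A" for x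
  define d where "d x = vectorspace.dim k (A\<lparr>carrier := I x\<rparr>)" for x
  have I: "submodule k (I x) A" if "x \<in> carrier A" for x
    unfolding I_def by (rule principal_submodules(1)[OF that])
  have bound: "d x \<le> dim" if "x \<in> carrier A" for x
    using dim_submodule_less[OF fin_dim I[OF that]] by (cases "I x = carrier A") (auto simp: d_def)
  have zero: "\<zero>\<^bsub>A\<^esub> \<in> carrier A - Units A"
    using nontriv by (auto simp: Units_def)
  have "\<forall>y. y \<in> carrier A - Units A \<longrightarrow> d y < Suc dim" using bound by (simp add: le_imp_less_Suc)
  then obtain x where x: "x \<in> carrier A - Units A"
    and max: "\<And>y. y \<in> carrier A - Units A \<Longrightarrow> d y \<le> d x"
    using ex_has_greatest_nat[of "\<lambda>y. y \<in> carrier A - Units A", OF zero, of d "Suc dim"] by blast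
  have self: "y \<in> I y" if "y \<in> carrier A" for y
    unfolding I_def using that by (intro image_eqI[of _ _ "\<one>\<^bsub>A\<^esub>"]) simp_all
  have "y \<in> I x" if y: "y \<in> carrier A - Units A" for y
  proof (rule ccontr)
    assume "y \<notin> I x"
    then have "I x \<subset> I y"
      using chain[OF principal_left_ideal principal_left_ideal, of x y] x y self[of y]
      unfolding I_def by blast
    then have "d x < d y" unfolding d_def using x y
      by (intro dim_submodule_strict_mono[OF fin_dim I I]) auto
    then show False using max[OF y] by simp
  qed
  moreover have "I x \<subseteq> carrier A - Units A" using nonunit_mult(1)[OF x] by (auto simp: I_def)
  ultimately show ?thesis using that x unfolding I_def by blast
qed

text \<open>
  As long as the coefficient of \<open>x\<^sup>m\<close> is not a unit, another factor \<open>x\<close> can be split off from it; for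
  a nonzero element this stops before \<open>x\<^sup>m\<close> vanishes.
\<close>

lemma unit_times_power:
  assumes x: "x \<in> carrier A" and n: "x [^]\<^bsub>A\<^esub> (n::nat) = \<zero>\<^bsub>A\<^esub>"
    and M: "carrier A - Units A \<subseteq> (\<lambda>a. a \<otimes>\<^bsub>A\<^esub> x) ` carrier A"
    and a: "a \<in> carrier A" "a \<noteq> \<zero>\<^bsub>A\<^esub>"
  obtains u and i :: nat where "u \<in> Units A" "a = u \<otimes>\<^bsub>A\<^esub> (x [^]\<^bsub>A\<^esub> i)"
proof -
  have "(\<exists>u\<in>Units A. \<exists>i::nat. a = u \<otimes>\<^bsub>A\<^esub> (x [^]\<^bsub>A\<^esub> i)) \<or> (\<exists>b\<in>carrier A. a = b \<otimes>\<^bsub>A\<^esub> (x [^]\<^bsub>A\<^esub> m))"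
    for m :: nat
  proof (induction m)
    case 0 show ?case using a by auto
  next
    case (Suc m)
    then show ?case
    proof
      assume "\<exists>b\<in>carrier A. a = b \<otimes>\<^bsub>A\<^esub> (x [^]\<^bsub>A\<^esub> m)"
      then obtain b where b: "b \<in> carrier A" "a = b \<otimes>\<^bsub>A\<^esub> (x [^]\<^bsub>A\<^esub> m)" by blast
      show ?case
      proof (cases "b \<in> Units A")
        case False
        then obtain c where c: "c \<in> carrier A" "b = c \<otimes>\<^bsub>A\<^esub> x" using M b by blast
        then have "a = c \<otimes>\<^bsub>A\<^esub> (x [^]\<^bsub>A\<^esub> Suc m)"
          using b x by (simp only: A.nat_pow_Suc2[OF x] A.m_assoc A.nat_pow_closed)
        then show ?thesis using c by blast
      qed (use b in blast)
    qed blast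
  qed
  from this[of n] n a show ?thesis using that by auto
qed

text \<open>
  The passage from left to right. The nonunits are \<open>A x\<close>, which contains \<open>x A\<close>. If \<open>u\<close> is a unit, then
  \<open>x u = v x\<close> for a unit \<open>v\<close>. Hence for \<open>a = u x\<^sup>i\<close> both \<open>x a = v x\<^sup>i\<^sup>+\<^sup>1\<close> and
  \<open>a x = u x\<^sup>i\<^sup>+\<^sup>1\<close> vanish under the same condition \<open>x\<^sup>i\<^sup>+\<^sup>1 = 0\<close>. By rank-nullity \<open>x A\<close> and \<open>A x\<close>
  have equal dimension, and so they are equal.
\<close>

theorem left_chain_uniformizer:
  assumes chain: "\<And>I J. left_ideal I A \<Longrightarrow> left_ideal J A \<Longrightarrow> I \<subseteq> J \<or> J \<subseteq> I"
    and nontriv: "\<one>\<^bsub>A\<^esub> \<noteq> \<zero>\<^bsub>A\<^esub>"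
  shows "\<exists>x. uniformizer A x"
proof -
  note add = nonunits_add[OF chain]
  obtain x where x: "x \<in> carrier A - Units A"
    and M: "carrier A - Units A = (\<lambda>a. a \<otimes>\<^bsub>A\<^esub> x) ` carrier A"
    using nonunits_principal[OF chain nontriv] by blast
  have xc [simp]: "x \<in> carrier A" using x by simp
  obtain n :: nat where n: "x [^]\<^bsub>A\<^esub> n = \<zero>\<^bsub>A\<^esub>" using nonunit_nilpotent[OF add x] by blast
  have comm: "\<exists>v\<in>Units A. x \<otimes>\<^bsub>A\<^esub> u = v \<otimes>\<^bsub>A\<^esub> x" if u: "u \<in> Units A" for u
  proof -
    have uc [simp]: "u \<in> carrier A" "inv\<^bsub>A\<^esub> u \<in> carrier A" using u by auto
    obtain v where v: "v \<in> carrier A" "x \<otimes>\<^bsub>A\<^esub> u = v \<otimes>\<^bsub>A\<^esub> x"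
      using nonunit_mult(2)[OF x, of u] M uc by auto
    show ?thesis
    proof (cases "v \<in> Units A")
      case False
      \<comment> \<open>If \<open>v\<close> is a nonunit, then \<open>x u = w x x\<close>, which puts \<open>x\<close> into \<open>M x\<close> and forces \<open>x = 0\<close>; then \<open>v\<close> can be replaced by \<open>1\<close>.\<close>
      obtain w where w: "w \<in> carrier A" "v = w \<otimes>\<^bsub>A\<^esub> x" using False v M by blast
      have "x = (x \<otimes>\<^bsub>A\<^esub> u) \<otimes>\<^bsub>A\<^esub> inv\<^bsub>A\<^esub> u" using u by (simp add: A.m_assoc)
      also have "\<dots> = (w \<otimes>\<^bsub>A\<^esub> x) \<otimes>\<^bsub>A\<^esub> (x \<otimes>\<^bsub>A\<^esub> inv\<^bsub>A\<^esub> u)" using v w by (simp add: A.m_assoc)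
      finally have e: "x = (w \<otimes>\<^bsub>A\<^esub> x) \<otimes>\<^bsub>A\<^esub> (x \<otimes>\<^bsub>A\<^esub> inv\<^bsub>A\<^esub> u)" .
      obtain w' where w': "w' \<in> carrier A" "x \<otimes>\<^bsub>A\<^esub> inv\<^bsub>A\<^esub> u = w' \<otimes>\<^bsub>A\<^esub> x"
        using nonunit_mult(2)[OF x, of "inv\<^bsub>A\<^esub> u"] M uc by auto
      have "x = ((w \<otimes>\<^bsub>A\<^esub> x) \<otimes>\<^bsub>A\<^esub> w') \<otimes>\<^bsub>A\<^esub> x" using e w' w by (simp add: A.m_assoc)
      moreover have "(w \<otimes>\<^bsub>A\<^esub> x) \<otimes>\<^bsub>A\<^esub> w' \<in> carrier A - Units A"
        using nonunit_mult x w w' by blast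
      ultimately have "x = \<zero>\<^bsub>A\<^esub>" using fixed_by_nonunit_zero[OF add] xc by blast
      then show ?thesis using uc by (intro bexI[of _ "\<one>\<^bsub>A\<^esub>"]) auto
    qed (use v in blast)
  qed
  have ann: "x \<otimes>\<^bsub>A\<^esub> a = \<zero>\<^bsub>A\<^esub> \<longleftrightarrow> a \<otimes>\<^bsub>A\<^esub> x = \<zero>\<^bsub>A\<^esub>" if a: "a \<in> carrier A" for a
  proof (cases "a = \<zero>\<^bsub>A\<^esub>")
    case False
    then obtain u and i :: nat where u: "u \<in> Units A" "a = u \<otimes>\<^bsub>A\<^esub> (x [^]\<^bsub>A\<^esub> i)"
      using unit_times_power[OF xc n _ a] M by blast
    obtain v where v: "v \<in> Units A" "x \<otimes>\<^bsub>A\<^esub> u = v \<otimes>\<^bsub>A\<^esub> x" using comm[OF u(1)] by blast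
    have unit0: "w \<otimes>\<^bsub>A\<^esub> z = \<zero>\<^bsub>A\<^esub> \<longleftrightarrow> z = \<zero>\<^bsub>A\<^esub>" if "w \<in> Units A" "z \<in> carrier A" for w z
      using A.Units_l_cancel[of w z "\<zero>\<^bsub>A\<^esub>"] that A.r_null[OF A.Units_closed[OF that(1)]]
      by simp
    have "x \<otimes>\<^bsub>A\<^esub> a = (x \<otimes>\<^bsub>A\<^esub> u) \<otimes>\<^bsub>A\<^esub> (x [^]\<^bsub>A\<^esub> i)"
      using u A.Units_closed[OF u(1)] by (simp add: A.m_assoc)
    also have "\<dots> = v \<otimes>\<^bsub>A\<^esub> (x [^]\<^bsub>A\<^esub> Suc i)"
      using v A.Units_closed[OF v(1)]
      by (simp only: A.nat_pow_Suc2[OF xc] A.m_assoc xc A.nat_pow_closed)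
    finally have "x \<otimes>\<^bsub>A\<^esub> a = \<zero>\<^bsub>A\<^esub> \<longleftrightarrow> x [^]\<^bsub>A\<^esub> Suc i = \<zero>\<^bsub>A\<^esub>" using unit0[OF v(1)] by simp
    moreover have "a \<otimes>\<^bsub>A\<^esub> x = u \<otimes>\<^bsub>A\<^esub> (x [^]\<^bsub>A\<^esub> Suc i)"
      using u A.Units_closed[OF u(1)] by (simp add: A.m_assoc)
    then have "a \<otimes>\<^bsub>A\<^esub> x = \<zero>\<^bsub>A\<^esub> \<longleftrightarrow> x [^]\<^bsub>A\<^esub> Suc i = \<zero>\<^bsub>A\<^esub>" using unit0[OF u(1)] by simp
    ultimately show ?thesis by simp
  qed simp
  interpret r: linear_map k A A "\<lambda>a. a \<otimes>\<^bsub>A\<^esub> x" by (rule mult_right_linear[OF xc])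
  interpret l: linear_map k A A "\<lambda>a. x \<otimes>\<^bsub>A\<^esub> a" by (rule mult_left_linear[OF xc])
  have "r.ker = l.ker" using ann by (auto simp: r.ker_def l.ker_def)
  then have dims: "vectorspace.dim k (A\<lparr>carrier := l.im\<rparr>) = vectorspace.dim k (A\<lparr>carrier := r.im\<rparr>)"
    using r.rank_nullity[OF fin_dim] l.rank_nullity[OF fin_dim] by simp
  have "l.im \<subseteq> r.im"
    using nonunit_mult(2)[OF x] M by (auto simp: l.im_def r.im_def)
  then have "l.im = r.im"
    using dims dim_submodule_strict_mono[OF fin_dim l.im_is_submodule r.im_is_submodule] by fastforce
  then show ?thesis
    using M n unfolding uniformizer_def l.im_def r.im_def by (intro exI[of _ x]) auto
qed

lemma left_ideal_unit:
  assumes I: "left_ideal I A" and u: "u \<in> I" "u \<in> Units A"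
  shows "I = carrier A"
proof -
  have "I \<subseteq> carrier A"
    using I by (auto simp: left_ideal_def additive_subgroup_def dest: subgroup.mem_carrier)
  moreover have "a \<in> I" if a: "a \<in> carrier A" for a
  proof -
    have "a = (a \<otimes>\<^bsub>A\<^esub> inv\<^bsub>A\<^esub> u) \<otimes>\<^bsub>A\<^esub> u"
      using a u(2) A.Units_closed[OF u(2)] by (simp add: A.m_assoc)
    moreover have "(a \<otimes>\<^bsub>A\<^esub> inv\<^bsub>A\<^esub> u) \<otimes>\<^bsub>A\<^esub> u \<in> I"
      using I u a unfolding left_ideal_def by blast
    ultimately show ?thesis by simp
  qed
  ultimately show ?thesis by blast
qed

context
  fixes x
  assumes x: "uniformizer A x" and nontriv: "\<one>\<^bsub>A\<^esub> \<noteq> \<zero>\<^bsub>A\<^esub>"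
begin

lemma uniformizer_closed: "x \<in> carrier A" using x by (simp add: uniformizer_def)

lemma power_ideal_antimono:
  assumes "i \<le> j"
  shows "(\<lambda>a. a \<otimes>\<^bsub>A\<^esub> (x [^]\<^bsub>A\<^esub> (j::nat))) ` carrier A \<subseteq> (\<lambda>a. a \<otimes>\<^bsub>A\<^esub> (x [^]\<^bsub>A\<^esub> i)) ` carrier A"
proof
  fix z assume "z \<in> (\<lambda>a. a \<otimes>\<^bsub>A\<^esub> (x [^]\<^bsub>A\<^esub> j)) ` carrier A"
  then obtain a where a: "a \<in> carrier A" "z = a \<otimes>\<^bsub>A\<^esub> (x [^]\<^bsub>A\<^esub> j)" by blast
  have "x [^]\<^bsub>A\<^esub> j = (x [^]\<^bsub>A\<^esub> (j - i)) \<otimes>\<^bsub>A\<^esub> (x [^]\<^bsub>A\<^esub> i)"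
    using A.nat_pow_mult[OF uniformizer_closed, of "j - i" i] assms by simp
  then have "z = (a \<otimes>\<^bsub>A\<^esub> (x [^]\<^bsub>A\<^esub> (j - i))) \<otimes>\<^bsub>A\<^esub> (x [^]\<^bsub>A\<^esub> i)"
    using a uniformizer_closed by (simp add: A.m_assoc)
  then show "z \<in> (\<lambda>a. a \<otimes>\<^bsub>A\<^esub> (x [^]\<^bsub>A\<^esub> i)) ` carrier A"
    by (rule image_eqI) (use a(1) uniformizer_closed in simp)
qed

text \<open>
  A left ideal is determined by the least power of \<open>x\<close> that it contains, since it contains
  \<open>u x\<^sup>j\<close> with a unit \<open>u\<close> iff it contains \<open>x\<^sup>j\<close>.
\<close>

lemma left_ideal_power:
  assumes I: "left_ideal I A"
  shows "\<exists>i::nat. I = (\<lambda>a. a \<otimes>\<^bsub>A\<^esub> (x [^]\<^bsub>A\<^esub> i)) ` carrier A"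
proof -
  obtain n :: nat where n: "x [^]\<^bsub>A\<^esub> n = \<zero>\<^bsub>A\<^esub>" using x by (auto simp: uniformizer_def)
  have IA: "I \<subseteq> carrier A"
    using I by (auto simp: left_ideal_def additive_subgroup_def dest: subgroup.mem_carrier)
  have mult: "a \<otimes>\<^bsub>A\<^esub> z \<in> I" if "a \<in> carrier A" "z \<in> I" for a z
    using I that by (simp add: left_ideal_def)
  have zero: "\<zero>\<^bsub>A\<^esub> \<in> I" using I by (simp add: left_ideal_def additive_subgroup.zero_closed)
  define i where "i = (LEAST i::nat. x [^]\<^bsub>A\<^esub> i \<in> I)"
  have i: "x [^]\<^bsub>A\<^esub> i \<in> I" unfolding i_def by (rule LeastI[of _ n]) (simp add: n zero)
  have "a \<in> (\<lambda>a. a \<otimes>\<^bsub>A\<^esub> (x [^]\<^bsub>A\<^esub> i)) ` carrier A" if a: "a \<in> I" for a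
  proof (cases "a = \<zero>\<^bsub>A\<^esub>")
    case True then show ?thesis using uniformizer_closed by (intro image_eqI[of _ _ "\<zero>\<^bsub>A\<^esub>"]) auto
  next
    case False
    have "carrier A - Units A \<subseteq> (\<lambda>a. a \<otimes>\<^bsub>A\<^esub> x) ` carrier A" using x by (simp add: uniformizer_def)
    then obtain u and j :: nat where u: "u \<in> Units A" "a = u \<otimes>\<^bsub>A\<^esub> (x [^]\<^bsub>A\<^esub> j)"
      using unit_times_power[OF uniformizer_closed n _ _ False] a IA by blast
    have "x [^]\<^bsub>A\<^esub> j = inv\<^bsub>A\<^esub> u \<otimes>\<^bsub>A\<^esub> a"
      using u uniformizer_closed A.Units_closed[OF u(1)] A.m_assoc[of "inv\<^bsub>A\<^esub> u" u "x [^]\<^bsub>A\<^esub> j"] by simp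
    then have "x [^]\<^bsub>A\<^esub> j \<in> I" using mult a u(1) by simp
    then have "i \<le> j" unfolding i_def by (rule Least_le)
    then show ?thesis using power_ideal_antimono A.Units_closed[OF u(1)] u(2) by blast
  qed
  moreover have "(\<lambda>a. a \<otimes>\<^bsub>A\<^esub> (x [^]\<^bsub>A\<^esub> i)) ` carrier A \<subseteq> I" using mult i by blast
  ultimately show ?thesis by blast
qed

lemma left_ideals_chain: "left_ideal I A \<Longrightarrow> left_ideal J A \<Longrightarrow> I \<subseteq> J \<or> J \<subseteq> I"
  using left_ideal_power power_ideal_antimono by (metis nat_le_linear)

lemma nonunits_left_ideal: "left_ideal (carrier A - Units A) A"
  using x principal_left_ideal[OF uniformizer_closed] by (simp add: uniformizer_def)

text \<open>
  A left ideal without units consists of nonunits, so the nonunits are the only maximal left ideal and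
  the Jacobson radical is the set of all nonunits.
\<close>

lemma nonunits_maximal: "maximal_left_ideal I A \<longleftrightarrow> I = carrier A - Units A"
proof
  assume "maximal_left_ideal I A"
  then have I: "left_ideal I A" "I \<noteq> carrier A"
    "\<And>J. left_ideal J A \<Longrightarrow> I \<subseteq> J \<Longrightarrow> J = I \<or> J = carrier A"
    unfolding maximal_left_ideal_def by blast+
  have "I \<subseteq> carrier A"
    using I(1) by (auto simp: left_ideal_def additive_subgroup_def dest: subgroup.mem_carrier)
  then have "I \<subseteq> carrier A - Units A" using left_ideal_unit[OF I(1)] I(2) by blast
  then have "carrier A - Units A = I \<or> carrier A - Units A = carrier A"
    using I(3)[OF nonunits_left_ideal] by blast
  then show "I = carrier A - Units A" using A.Units_one_closed A.one_closed by blast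
next
  assume I: "I = carrier A - Units A"
  have "J = I \<or> J = carrier A" if J: "left_ideal J A" "I \<subseteq> J" for J
  proof -
    have "J \<subseteq> carrier A"
      using J(1) by (auto simp: left_ideal_def additive_subgroup_def dest: subgroup.mem_carrier)
    then show ?thesis using left_ideal_unit[OF J(1)] J(2) I by blast
  qed
  moreover have "I \<noteq> carrier A" using I A.Units_one_closed A.one_closed by blast
  ultimately show "maximal_left_ideal I A"
    using nonunits_left_ideal I unfolding maximal_left_ideal_def by blast
qed

lemma Jac_nonunits: "Jac A = carrier A - Units A"
  by (auto simp: Jac_def nonunits_maximal)

lemma power_commute:
  assumes "b \<in> carrier A"
  shows "\<exists>b'\<in>carrier A. x [^]\<^bsub>A\<^esub> (i::nat) \<otimes>\<^bsub>A\<^esub> b = b' \<otimes>\<^bsub>A\<^esub> (x [^]\<^bsub>A\<^esub> i)"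
  using assms
proof (induction i arbitrary: b)
  case 0 then show ?case by auto
next
  case (Suc i)
  have "x \<otimes>\<^bsub>A\<^esub> b \<in> (\<lambda>a. a \<otimes>\<^bsub>A\<^esub> x) ` carrier A"
    using x Suc.prems unfolding uniformizer_def by blast
  then obtain c where c: "c \<in> carrier A" "x \<otimes>\<^bsub>A\<^esub> b = c \<otimes>\<^bsub>A\<^esub> x" by blast
  obtain d where d: "d \<in> carrier A" "x [^]\<^bsub>A\<^esub> i \<otimes>\<^bsub>A\<^esub> c = d \<otimes>\<^bsub>A\<^esub> (x [^]\<^bsub>A\<^esub> i)"
    using Suc.IH[OF c(1)] by blast
  have "x [^]\<^bsub>A\<^esub> Suc i \<otimes>\<^bsub>A\<^esub> b = x [^]\<^bsub>A\<^esub> i \<otimes>\<^bsub>A\<^esub> (c \<otimes>\<^bsub>A\<^esub> x)"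
    using uniformizer_closed Suc.prems c by (simp add: A.m_assoc)
  also have "\<dots> = (x [^]\<^bsub>A\<^esub> i \<otimes>\<^bsub>A\<^esub> c) \<otimes>\<^bsub>A\<^esub> x" using uniformizer_closed c(1) by (simp add: A.m_assoc)
  also have "\<dots> = d \<otimes>\<^bsub>A\<^esub> (x [^]\<^bsub>A\<^esub> Suc i)" using uniformizer_closed d by (simp add: A.m_assoc)
  finally show ?case using d(1) by blast
qed

text \<open>
  The product of \<open>A x\<^sup>i\<close> and \<open>A x\<close> stays in \<open>A x\<^sup>i\<^sup>+\<^sup>1\<close> because \<open>x\<^sup>i\<close> can be moved past any element
  of \<open>A\<close> at the cost of changing that element.
\<close>

lemma ideal_power_Jac:
  "ideal_power A (Jac A) i = (\<lambda>a. a \<otimes>\<^bsub>A\<^esub> (x [^]\<^bsub>A\<^esub> i)) ` carrier A"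
proof (induction i)
  case 0
  show ?case by (auto simp: image_iff)
next
  case (Suc i)
  let ?P = "\<lambda>i::nat. (\<lambda>a. a \<otimes>\<^bsub>A\<^esub> (x [^]\<^bsub>A\<^esub> i)) ` carrier A"
  have J: "Jac A = (\<lambda>a. a \<otimes>\<^bsub>A\<^esub> x) ` carrier A" using x Jac_nonunits by (simp add: uniformizer_def)
  interpret P: submodule k "?P (Suc i)" A by (rule principal_submodules(1)) (use uniformizer_closed in simp)
  have "z \<in> ?P (Suc i)" if "z \<in> ideal_prod A (?P i) (Jac A)" for z
    using that
  proof induction
    case (prod y z)
    then obtain a b where a: "a \<in> carrier A" "y = a \<otimes>\<^bsub>A\<^esub> (x [^]\<^bsub>A\<^esub> i)"
      and b: "b \<in> carrier A" "z = b \<otimes>\<^bsub>A\<^esub> x" using J by blast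
    obtain b' where b': "b' \<in> carrier A" "x [^]\<^bsub>A\<^esub> i \<otimes>\<^bsub>A\<^esub> b = b' \<otimes>\<^bsub>A\<^esub> (x [^]\<^bsub>A\<^esub> i)"
      using power_commute[OF b(1)] by blast
    have "y \<otimes>\<^bsub>A\<^esub> z = a \<otimes>\<^bsub>A\<^esub> (x [^]\<^bsub>A\<^esub> i \<otimes>\<^bsub>A\<^esub> b) \<otimes>\<^bsub>A\<^esub> x"
      using a b uniformizer_closed by (simp add: A.m_assoc)
    also have "\<dots> = (a \<otimes>\<^bsub>A\<^esub> b') \<otimes>\<^bsub>A\<^esub> (x [^]\<^bsub>A\<^esub> Suc i)"
      using a(1) b'(1) uniformizer_closed unfolding b'(2) by (simp add: A.m_assoc)
    finally show ?case by (rule image_eqI) (use a(1) b'(1) in simp)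
  next
    case (sum s1 s2)
    show ?case using sum.IH by (rule P.m_closed)
  qed
  moreover have "?P (Suc i) \<subseteq> ideal_prod A (?P i) (Jac A)"
  proof
    fix z assume "z \<in> ?P (Suc i)"
    then obtain a where a: "a \<in> carrier A" "z = a \<otimes>\<^bsub>A\<^esub> (x [^]\<^bsub>A\<^esub> Suc i)" by blast
    then have "z = (a \<otimes>\<^bsub>A\<^esub> (x [^]\<^bsub>A\<^esub> i)) \<otimes>\<^bsub>A\<^esub> x" using uniformizer_closed by (simp add: A.m_assoc)
    moreover have "x \<in> Jac A" unfolding J
      using uniformizer_closed by (intro image_eqI[of _ _ "\<one>\<^bsub>A\<^esub>"]) simp_all
    ultimately show "z \<in> ideal_prod A (?P i) (Jac A)" using a(1) by (simp add: ideal_prod.prod)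
  qed
  ultimately show ?case unfolding ideal_power.simps Suc.IH by blast
qed

theorem left_ideals_eq_powers: "{I. left_ideal I A} = range (ideal_power A (Jac A))"
proof -
  have "left_ideal (ideal_power A (Jac A) i) A" for i
    unfolding ideal_power_Jac by (rule principal_left_ideal) (use uniformizer_closed in simp)
  moreover have "I \<in> range (ideal_power A (Jac A))" if "left_ideal I A" for I
    using left_ideal_power[OF that] by (auto simp: ideal_power_Jac)
  ultimately show ?thesis by blast
qed

end

end

lemma opposite_simps [simp]:
  "carrier (opposite A) = carrier A" "mult (opposite A) = (\<lambda>x y. y \<otimes>\<^bsub>A\<^esub> x)"
  "one (opposite A) = \<one>\<^bsub>A\<^esub>" "zero (opposite A) = \<zero>\<^bsub>A\<^esub>" "add (opposite A) = add A"
  "smult (opposite A) = smult A"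
  by (simp_all add: opposite_def)

lemma Units_opposite [simp]: "Units (opposite A) = Units A"
  by (auto simp: Units_def)

lemma left_ideal_opposite: "left_ideal I (opposite A) \<longleftrightarrow> right_ideal I A"
  by (simp add: left_ideal_def right_ideal_def additive_subgroup_def opposite_def)

lemma module_transfer:
  assumes V: "module k V" and eq: "carrier W = carrier V" "add W = add V" "zero W = zero V" "smult W = smult V"
  shows "module k W"
proof -
  interpret V: module k V by fact
  have "\<exists>y\<in>carrier V. x \<oplus>\<^bsub>V\<^esub> y = \<zero>\<^bsub>V\<^esub>" if "x \<in> carrier V" for x
    using that V.M.r_neg V.M.a_inv_closed by blast
  then show ?thesis
    by (intro module_criteria) (simp_all add: eq V.R.cring_axioms V.M.a_ac V.smult_l_distr
        V.smult_r_distr V.smult_assoc1)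
qed

lemma vectorspace_transfer:
  assumes V: "vectorspace k V" and eq: "carrier W = carrier V" "add W = add V" "zero W = zero V" "smult W = smult V"
  shows "vectorspace k W" "vectorspace.fin_dim k W \<longleftrightarrow> vectorspace.fin_dim k V"
proof -
  interpret V: vectorspace k V by fact
  interpret W: module k W by (rule module_transfer[OF V.module_axioms eq])
  show vs: "vectorspace k W" by unfold_locales
  interpret W: vectorspace k W by (rule vs)
  have "finsum W g S = finsum V g S" for g and S :: "'c set"
    by (simp add: finsum_def finprod_def eq)
  then have "W.lincomb a S = V.lincomb a S" for a S
    by (simp add: W.lincomb_def V.lincomb_def eq)
  then have "W.span = V.span" by (intro ext) (simp add: W.span_def V.span_def)
  then show "W.fin_dim \<longleftrightarrow> V.fin_dim" by (simp add: W.fin_dim_def V.fin_dim_def eq)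
qed

lemma (in fin_dim_algebra) opposite_algebra: "fin_dim_algebra k (opposite A)"
proof -
  have "vectorspace k (opposite A)" "vectorspace.fin_dim k (opposite A)"
    using vectorspace_transfer[OF vectorspace_axioms, of "opposite A"] fin_dim by simp_all
  moreover have "ring (opposite A)"
    using vectorspace.axioms(1)[OF calculation(1), THEN module.axioms(2)]
    by (intro ringI) (auto intro!: monoidI simp: A.m_assoc A.l_distr A.r_distr)
  ultimately show ?thesis
    by (simp add: fin_dim_algebra_def fin_dim_algebra_axioms_def assoc_algebra_def
        assoc_algebra_axioms_def smult_mult_left smult_mult_right)
qed

lemma (in fin_dim_algebra) power_opposite:
  assumes "x \<in> carrier A" shows "x [^]\<^bsub>opposite A\<^esub> (n::nat) = x [^]\<^bsub>A\<^esub> n"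
proof -
  interpret O: fin_dim_algebra k "opposite A" by (rule opposite_algebra)
  show ?thesis
  proof (induction n)
    case (Suc n)
    then show ?case using O.A.nat_pow_Suc[of x n] A.nat_pow_Suc2[OF assms, of n] by simp
  qed simp
qed

lemma (in fin_dim_algebra) uniformizer_opposite: "uniformizer (opposite A) x \<longleftrightarrow> uniformizer A x"
proof (cases "x \<in> carrier A")
  case True
  show ?thesis unfolding uniformizer_def power_opposite[OF True] opposite_simps Units_opposite by blast
qed (simp add: uniformizer_def)

lemma (in fin_dim_algebra) right_chain_uniformizer:
  assumes "\<And>I J. right_ideal I A \<Longrightarrow> right_ideal J A \<Longrightarrow> I \<subseteq> J \<or> J \<subseteq> I"
    and "\<one>\<^bsub>A\<^esub> \<noteq> \<zero>\<^bsub>A\<^esub>"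
  shows "\<exists>x. uniformizer A x"
  using fin_dim_algebra.left_chain_uniformizer[OF opposite_algebra] assms uniformizer_opposite
  by (simp add: left_ideal_opposite)

lemma (in fin_dim_algebra) right_ideals_chain:
  assumes "uniformizer A x" "\<one>\<^bsub>A\<^esub> \<noteq> \<zero>\<^bsub>A\<^esub>" "right_ideal I A" "right_ideal J A"
  shows "I \<subseteq> J \<or> J \<subseteq> I"
  using fin_dim_algebra.left_ideals_chain[OF opposite_algebra, of x I J] assms uniformizer_opposite
  by (simp add: left_ideal_opposite)

section \<open>Quotients, free modules and tensor products\<close>

lemma hom_finsum_fun:
  assumes V: "module k V" and W: "module k W" and I: "finite I"
    and f: "\<And>i. i \<in> I \<Longrightarrow> f i \<in> module_hom k V W"
  shows "(\<lambda>v. \<Oplus>\<^bsub>W\<^esub>i\<in>I. f i v) \<in> module_hom k V W"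
proof -
  interpret W: module k W by fact
  have c: "f i v \<in> carrier W" if "i \<in> I" "v \<in> carrier V" for i v using hom_in[OF f] that by blast
  show ?thesis
  proof (rule module_homI)
    show "(\<Oplus>\<^bsub>W\<^esub>i\<in>I. f i v) \<in> carrier W" if "v \<in> carrier V" for v using c that by auto
    show "(\<Oplus>\<^bsub>W\<^esub>i\<in>I. f i (v \<oplus>\<^bsub>V\<^esub> w)) = (\<Oplus>\<^bsub>W\<^esub>i\<in>I. f i v) \<oplus>\<^bsub>W\<^esub> (\<Oplus>\<^bsub>W\<^esub>i\<in>I. f i w)"
      if vw: "v \<in> carrier V" "w \<in> carrier V" for v w
    proof -
      have "(\<Oplus>\<^bsub>W\<^esub>i\<in>I. f i (v \<oplus>\<^bsub>V\<^esub> w)) = (\<Oplus>\<^bsub>W\<^esub>i\<in>I. f i v \<oplus>\<^bsub>W\<^esub> f i w)"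
        using c vw by (intro W.finsum_cong') (auto simp: module_hom_add[OF f])
      also have "\<dots> = (\<Oplus>\<^bsub>W\<^esub>i\<in>I. f i v) \<oplus>\<^bsub>W\<^esub> (\<Oplus>\<^bsub>W\<^esub>i\<in>I. f i w)"
        using c vw by (intro W.finsum_addf) auto
      finally show ?thesis .
    qed
    show "(\<Oplus>\<^bsub>W\<^esub>i\<in>I. f i (a \<odot>\<^bsub>V\<^esub> v)) = a \<odot>\<^bsub>W\<^esub> (\<Oplus>\<^bsub>W\<^esub>i\<in>I. f i v)"
      if av: "a \<in> carrier k" "v \<in> carrier V" for a v
    proof -
      have "(\<Oplus>\<^bsub>W\<^esub>i\<in>I. f i (a \<odot>\<^bsub>V\<^esub> v)) = (\<Oplus>\<^bsub>W\<^esub>i\<in>I. a \<odot>\<^bsub>W\<^esub> f i v)"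
        using c av by (intro W.finsum_cong') (auto simp: module_hom_smult[OF f])
      also have "\<dots> = a \<odot>\<^bsub>W\<^esub> (\<Oplus>\<^bsub>W\<^esub>i\<in>I. f i v)"
        using c av I by (intro W.finsum_smult_ldistr[symmetric]) auto
      finally show ?thesis .
    qed
  qed
qed

lemma quotient_algebra_simps [simp]:
  "carrier (quotient_algebra M N) = a_rcosets\<^bsub>M\<^esub> N"
  "mult (quotient_algebra M N) = rcoset_mult M N"
  "one (quotient_algebra M N) = N +>\<^bsub>M\<^esub> \<one>\<^bsub>M\<^esub>"
  "zero (quotient_algebra M N) = N"
  "add (quotient_algebra M N) = set_add M"
  "smult (quotient_algebra M N) = (\<lambda>a X. N <+>\<^bsub>M\<^esub> ((\<lambda>x. a \<odot>\<^bsub>M\<^esub> x) ` X))"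
  by (simp_all add: quotient_algebra_def)

context module
begin

lemma submodule_abelian_subgroup: "submodule R N M \<Longrightarrow> abelian_subgroup N M"
  by (rule abelian_subgroupI3[OF submodule_additive_subgroup M.abelian_group_axioms])

text \<open>
  The set \<open>{a y | y \<in> N + x}\<close> alone is only contained in the coset of \<open>a x\<close>, and for \<open>a = 0\<close> it is a
  single point; adding \<open>N\<close> fills it up to the whole coset.
\<close>

lemma quotient_smult:
  assumes N: "submodule R N M" and a: "a \<in> carrier R" and x: "x \<in> carrier M"
  shows "N <+>\<^bsub>M\<^esub> ((\<lambda>y. a \<odot>\<^bsub>M\<^esub> y) ` (N +>\<^bsub>M\<^esub> x)) = N +>\<^bsub>M\<^esub> (a \<odot>\<^bsub>M\<^esub> x)"
proof -
  interpret N: submodule R N M by fact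
  have sub: "n \<in> carrier M" if "n \<in> N" for n using that N.subset by blast
  show ?thesis
  proof
    show "N <+>\<^bsub>M\<^esub> ((\<lambda>y. a \<odot>\<^bsub>M\<^esub> y) ` (N +>\<^bsub>M\<^esub> x)) \<subseteq> N +>\<^bsub>M\<^esub> (a \<odot>\<^bsub>M\<^esub> x)"
    proof
      fix z assume "z \<in> N <+>\<^bsub>M\<^esub> ((\<lambda>y. a \<odot>\<^bsub>M\<^esub> y) ` (N +>\<^bsub>M\<^esub> x))"
      then obtain n m where nm: "n \<in> N" "m \<in> N" "z = n \<oplus>\<^bsub>M\<^esub> a \<odot>\<^bsub>M\<^esub> (m \<oplus>\<^bsub>M\<^esub> x)"
        by (auto simp: set_add_def' a_r_coset_def')
      then have "z = (n \<oplus>\<^bsub>M\<^esub> a \<odot>\<^bsub>M\<^esub> m) \<oplus>\<^bsub>M\<^esub> a \<odot>\<^bsub>M\<^esub> x"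
        using a x sub by (simp add: smult_r_distr M.a_assoc)
      moreover have "n \<oplus>\<^bsub>M\<^esub> a \<odot>\<^bsub>M\<^esub> m \<in> N" using nm a by simp
      ultimately show "z \<in> N +>\<^bsub>M\<^esub> (a \<odot>\<^bsub>M\<^esub> x)" by (auto simp: a_r_coset_def')
    qed
    show "N +>\<^bsub>M\<^esub> (a \<odot>\<^bsub>M\<^esub> x) \<subseteq> N <+>\<^bsub>M\<^esub> ((\<lambda>y. a \<odot>\<^bsub>M\<^esub> y) ` (N +>\<^bsub>M\<^esub> x))"
    proof
      fix z assume "z \<in> N +>\<^bsub>M\<^esub> (a \<odot>\<^bsub>M\<^esub> x)"
      then obtain n where n: "n \<in> N" "z = n \<oplus>\<^bsub>M\<^esub> a \<odot>\<^bsub>M\<^esub> x" by (auto simp: a_r_coset_def')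
      have "x \<in> N +>\<^bsub>M\<^esub> x" unfolding a_r_coset_def' using x by (intro UN_I[OF N.zero_closed]) simp
      then have "a \<odot>\<^bsub>M\<^esub> x \<in> (\<lambda>y. a \<odot>\<^bsub>M\<^esub> y) ` (N +>\<^bsub>M\<^esub> x)" by (rule imageI)
      then show "z \<in> N <+>\<^bsub>M\<^esub> ((\<lambda>y. a \<odot>\<^bsub>M\<^esub> y) ` (N +>\<^bsub>M\<^esub> x))"
        unfolding set_add_def' n(2) by (intro UN_I[OF n(1)] UN_I) auto
    qed
  qed
qed

context
  fixes N assumes N: "submodule R N M"
begin

interpretation N: abelian_subgroup N M by (rule submodule_abelian_subgroup[OF N])

lemma coset_in: "x \<in> carrier M \<Longrightarrow> N +>\<^bsub>M\<^esub> x \<in> carrier (quotient_algebra M N)"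
  by (auto simp: A_RCOSETS_def')

lemma coset_cases:
  assumes "X \<in> carrier (quotient_algebra M N)"
  obtains x where "x \<in> carrier M" "X = N +>\<^bsub>M\<^esub> x"
  using assms by (auto simp: A_RCOSETS_def')

lemma coset_hom: "(\<lambda>x. N +>\<^bsub>M\<^esub> x) \<in> module_hom R M (quotient_algebra M N)"
  by (rule module_homI[OF coset_in]) (simp_all add: N.a_rcos_sum quotient_smult[OF N])

lemma quotient_module: "module R (quotient_algebra M N)"
proof -
  let ?Q = "quotient_algebra M N"
  note add = module_hom_add[OF coset_hom, symmetric] and smult = module_hom_smult[OF coset_hom, symmetric]
  have zero: "\<zero>\<^bsub>?Q\<^esub> = N +>\<^bsub>M\<^esub> \<zero>\<^bsub>M\<^esub>"
    using M.a_coset_join2[OF M.zero_closed] N.a_subgroup by simp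
  have neg: "\<exists>Y\<in>carrier ?Q. X \<oplus>\<^bsub>?Q\<^esub> Y = \<zero>\<^bsub>?Q\<^esub>" if X: "X \<in> carrier ?Q" for X
  proof -
    obtain x where x: "x \<in> carrier M" "X = N +>\<^bsub>M\<^esub> x" by (rule coset_cases[OF X])
    have "X \<oplus>\<^bsub>?Q\<^esub> (N +>\<^bsub>M\<^esub> (\<ominus>\<^bsub>M\<^esub> x)) = \<zero>\<^bsub>?Q\<^esub>"
      unfolding x(2) zero using x(1) by (simp del: quotient_algebra_simps add: add M.r_neg)
    then show ?thesis using coset_in[of "\<ominus>\<^bsub>M\<^esub> x"] x(1) by blast
  qed
  show ?thesis
    by (rule module_criteria; (intro allI impI)?; (elim conjE)?; (rule ballI)?; (elim coset_cases)?)
      (use R.is_cring neg in \<open>auto simp del: quotient_algebra_simps simp: zero add smult coset_in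
        smult_r_distr smult_l_distr smult_assoc1 M.a_ac\<close>)
qed

lemma coset_eq_iff:
  assumes "x \<in> carrier M" "y \<in> carrier M"
  shows "N +>\<^bsub>M\<^esub> x = N +>\<^bsub>M\<^esub> y \<longleftrightarrow> y \<ominus>\<^bsub>M\<^esub> x \<in> N"
proof -
  have "N +>\<^bsub>M\<^esub> x = N +>\<^bsub>M\<^esub> y \<longleftrightarrow> y \<in> N +>\<^bsub>M\<^esub> x"
    using assms N.a_repr_independence' N.a_repr_independenceD by blast
  also have "\<dots> \<longleftrightarrow> y \<ominus>\<^bsub>M\<^esub> x \<in> N"
  proof
    assume "y \<in> N +>\<^bsub>M\<^esub> x"
    then obtain n where n: "n \<in> N" "y = n \<oplus>\<^bsub>M\<^esub> x" by (auto simp: a_r_coset_def')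
    then have "y \<ominus>\<^bsub>M\<^esub> x = n" using assms N.a_Hcarr by (simp add: a_minus_def M.a_assoc M.r_neg)
    then show "y \<ominus>\<^bsub>M\<^esub> x \<in> N" using n by simp
  next
    assume "y \<ominus>\<^bsub>M\<^esub> x \<in> N"
    moreover have "y = (y \<ominus>\<^bsub>M\<^esub> x) \<oplus>\<^bsub>M\<^esub> x" using assms by (simp add: a_minus_def M.a_assoc M.l_neg)
    ultimately show "y \<in> N +>\<^bsub>M\<^esub> x" unfolding a_r_coset_def' by blast
  qed
  finally show ?thesis .
qed

end

end

lemma free_module_simps [simp]:
  "zero (free_module k X) = (\<lambda>_. \<zero>\<^bsub>k\<^esub>)"
  "add (free_module k X) = (\<lambda>s t x. s x \<oplus>\<^bsub>k\<^esub> t x)"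
  "smult (free_module k X) = (\<lambda>a t x. a \<otimes>\<^bsub>k\<^esub> t x)"
  by (simp_all add: free_module_def)

lemma free_module_carrier:
  "t \<in> carrier (free_module k X) \<longleftrightarrow> (\<forall>x. t x \<in> carrier k) \<and> finite {x. t x \<noteq> \<zero>\<^bsub>k\<^esub>} \<and>
    (\<forall>x. t x \<noteq> \<zero>\<^bsub>k\<^esub> \<longrightarrow> x \<in> X)"
  by (auto simp: free_module_def)

context cring
begin

lemma free_module_closedI:
  assumes "s \<in> carrier (free_module R X)" "t \<in> carrier (free_module R X)"
    and "\<And>x. h x \<in> carrier R" and h: "\<And>x. s x = \<zero> \<Longrightarrow> t x = \<zero> \<Longrightarrow> h x = \<zero>"
  shows "h \<in> carrier (free_module R X)"
proof -
  have "{x. h x \<noteq> \<zero>} \<subseteq> {x. s x \<noteq> \<zero>} \<union> {x. t x \<noteq> \<zero>}" using h by blast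
  then show ?thesis
    using assms(1-3) unfolding free_module_carrier by (auto dest: finite_subset)
qed

lemma free_module_module: "module R (free_module R X)"
proof -
  let ?F = "free_module R X"
  have c: "t x \<in> carrier R" if "t \<in> carrier ?F" for t x
    using that by (simp add: free_module_carrier)
  have add: "(\<lambda>x. s x \<oplus> t x) \<in> carrier ?F" if "s \<in> carrier ?F" "t \<in> carrier ?F" for s t
    by (rule free_module_closedI[OF that]) (simp_all add: c[OF that(1)] c[OF that(2)])
  have smult: "(\<lambda>x. a \<otimes> t x) \<in> carrier ?F" if "a \<in> carrier R" "t \<in> carrier ?F" for a t
    by (rule free_module_closedI[OF that(2) that(2)]) (simp_all add: that(1) c[OF that(2)])
  have neg: "\<exists>s\<in>carrier ?F. (\<lambda>x. t x \<oplus> s x) = (\<lambda>_. \<zero>)" if t: "t \<in> carrier ?F" for t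
  proof
    show "(\<lambda>x. (\<ominus> \<one>) \<otimes> t x) \<in> carrier ?F" by (rule smult[OF _ t]) simp
    show "(\<lambda>x. t x \<oplus> (\<ominus> \<one>) \<otimes> t x) = (\<lambda>_. \<zero>)" using c[OF t] by (simp add: l_minus r_neg)
  qed
  have zero: "(\<lambda>_. \<zero>) \<in> carrier ?F" by (simp add: free_module_carrier)
  show ?thesis
    by (rule module_criteria; (intro allI impI ballI)?; (elim conjE)?)
      (simp_all add: is_cring zero add smult neg c m_assoc l_distr r_distr a_ac)
qed

lemma free_gen_closed: "x \<in> X \<Longrightarrow> free_gen R x \<in> carrier (free_module R X)"
  by (auto simp: free_module_carrier free_gen_def)

definition free_extend :: "('a, 'u, 'm) module_scheme \<Rightarrow> ('x \<Rightarrow> 'u) \<Rightarrow> ('x \<Rightarrow> 'a) \<Rightarrow> 'u"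
  where "free_extend U g t = (\<Oplus>\<^bsub>U\<^esub>p\<in>{p. t p \<noteq> \<zero>}. t p \<odot>\<^bsub>U\<^esub> g p)"

context
  fixes U :: "('a, 'u, 'm) module_scheme" and g :: "'x \<Rightarrow> 'u" and X
  assumes U: "module R U" and g: "\<And>x. x \<in> X \<Longrightarrow> g x \<in> carrier U"
begin

interpretation U: module R U by (rule U)

lemma free_extend_eq:
  assumes t: "t \<in> carrier (free_module R X)" and S: "finite S" "{p. t p \<noteq> \<zero>} \<subseteq> S" "S \<subseteq> X"
  shows "free_extend U g t = (\<Oplus>\<^bsub>U\<^esub>p\<in>S. t p \<odot>\<^bsub>U\<^esub> g p)"
  unfolding free_extend_def
  by (rule U.add.finprod_mono_neutral_cong_left) (use t S g in \<open>auto simp: free_module_carrier subset_iff\<close>)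

lemma free_extend_hom: "free_extend U g \<in> module_hom R (free_module R X) U"
proof (rule module_homI)
  note [simp] = free_module_carrier
  interpret F: module R "free_module R X" by (rule free_module_module)
  show "free_extend U g t \<in> carrier U" if "t \<in> carrier (free_module R X)" for t
    unfolding free_extend_def using that g by (intro U.finsum_closed) auto
  show "free_extend U g (s \<oplus>\<^bsub>free_module R X\<^esub> t) = free_extend U g s \<oplus>\<^bsub>U\<^esub> free_extend U g t"
    if s: "s \<in> carrier (free_module R X)" and t: "t \<in> carrier (free_module R X)" for s t
  proof -
    let ?S = "{p. s p \<noteq> \<zero>} \<union> {p. t p \<noteq> \<zero>}"
    have S: "finite ?S" "?S \<subseteq> X" using s t by auto
    have sub: "{p. s p \<oplus> t p \<noteq> \<zero>} \<subseteq> ?S" by auto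
    have "free_extend U g (s \<oplus>\<^bsub>free_module R X\<^esub> t) = (\<Oplus>\<^bsub>U\<^esub>p\<in>?S. (s p \<oplus> t p) \<odot>\<^bsub>U\<^esub> g p)"
      using free_extend_eq[OF F.add.m_closed[OF s t], of ?S] S sub by simp
    also have "\<dots> = (\<Oplus>\<^bsub>U\<^esub>p\<in>?S. s p \<odot>\<^bsub>U\<^esub> g p \<oplus>\<^bsub>U\<^esub> t p \<odot>\<^bsub>U\<^esub> g p)"
      using s t S g by (intro U.finsum_cong') (auto simp: U.smult_l_distr subset_iff)
    also have "\<dots> = (\<Oplus>\<^bsub>U\<^esub>p\<in>?S. s p \<odot>\<^bsub>U\<^esub> g p) \<oplus>\<^bsub>U\<^esub> (\<Oplus>\<^bsub>U\<^esub>p\<in>?S. t p \<odot>\<^bsub>U\<^esub> g p)"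
      using s t S g by (intro U.finsum_addf) (auto simp: subset_iff)
    also have "\<dots> = free_extend U g s \<oplus>\<^bsub>U\<^esub> free_extend U g t"
      using free_extend_eq[OF s, of ?S] free_extend_eq[OF t, of ?S] S by simp
    finally show ?thesis .
  qed
  show "free_extend U g (a \<odot>\<^bsub>free_module R X\<^esub> t) = a \<odot>\<^bsub>U\<^esub> free_extend U g t"
    if a: "a \<in> carrier R" and t: "t \<in> carrier (free_module R X)" for a t
  proof -
    let ?S = "{p. t p \<noteq> \<zero>}"
    have S: "finite ?S" "?S \<subseteq> X" using t by auto
    have "{p. a \<otimes> t p \<noteq> \<zero>} \<subseteq> ?S" using a by auto
    then have "free_extend U g (a \<odot>\<^bsub>free_module R X\<^esub> t) = (\<Oplus>\<^bsub>U\<^esub>p\<in>?S. (a \<otimes> t p) \<odot>\<^bsub>U\<^esub> g p)"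
      using free_extend_eq[OF F.smult_closed[OF a t], of ?S] S by simp
    also have "\<dots> = (\<Oplus>\<^bsub>U\<^esub>p\<in>?S. a \<odot>\<^bsub>U\<^esub> (t p \<odot>\<^bsub>U\<^esub> g p))"
      using a t S g by (intro U.finsum_cong') (auto simp: U.smult_assoc1)
    also have "\<dots> = a \<odot>\<^bsub>U\<^esub> free_extend U g t"
      unfolding free_extend_def using a t S g by (intro U.finsum_smult_ldistr[symmetric]) auto
    finally show ?thesis .
  qed
qed

lemma free_extend_gen:
  assumes x: "x \<in> X" shows "free_extend U g (free_gen R x) = g x"
proof -
  have "{p. free_gen R x p \<noteq> \<zero>} \<subseteq> {x}" by (auto simp: free_gen_def)
  then have "free_extend U g (free_gen R x) = (\<Oplus>\<^bsub>U\<^esub>p\<in>{x}. free_gen R x p \<odot>\<^bsub>U\<^esub> g p)"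
    by (intro free_extend_eq[OF free_gen_closed[OF x]]) (use x in auto)
  then show ?thesis using g[OF x] by (simp add: free_gen_def)
qed

end

text \<open>
  By induction on the support: an element is the same element with one coefficient erased, plus a
  multiple of one generator.
\<close>

lemma free_module_induct:
  assumes t: "t \<in> carrier (free_module R X)"
    and zero: "P (\<lambda>_. \<zero>)"
    and step: "\<And>s a x. s \<in> carrier (free_module R X) \<Longrightarrow> P s \<Longrightarrow> a \<in> carrier R \<Longrightarrow> x \<in> X \<Longrightarrow>
      P (s \<oplus>\<^bsub>free_module R X\<^esub> a \<odot>\<^bsub>free_module R X\<^esub> free_gen R x)"
  shows "P t"
proof -
  have "P t" if "finite S" "t \<in> carrier (free_module R X)" "{p. t p \<noteq> \<zero>} = S" for S t
    using that
  proof (induction S arbitrary: t rule: finite_induct)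
    case empty
    then have "t = (\<lambda>_. \<zero>)" by auto
    then show ?case using zero by simp
  next
    case (insert x S)
    have c: "t p \<in> carrier R" for p using insert.prems by (simp add: free_module_carrier)
    have x: "x \<in> X" using insert.prems by (auto simp: free_module_carrier)
    let ?s = "t(x := \<zero>)"
    have supp: "{p. ?s p \<noteq> \<zero>} = S" using insert.prems(2) insert.hyps(2) by auto
    have s: "?s \<in> carrier (free_module R X)"
      using insert.prems(1) supp insert.hyps(1) by (auto simp: free_module_carrier split: if_splits)
    have "t = ?s \<oplus>\<^bsub>free_module R X\<^esub> t x \<odot>\<^bsub>free_module R X\<^esub> free_gen R x"
      using c by (auto simp: free_gen_def fun_eq_iff)
    then show ?case using step[OF s insert.IH[OF s supp] c x] by metis
  qed
  then show ?thesis using t by (auto simp: free_module_carrier)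
qed

end

text \<open>
  Linearity in each variable, phrased through homomorphisms so that partial applications of bilinear
  maps can be composed with linear maps.
\<close>

definition bilinear_map where
  "bilinear_map k V W U b \<longleftrightarrow>
    (\<forall>w\<in>carrier W. (\<lambda>v. b v w) \<in> module_hom k V U) \<and> (\<forall>v\<in>carrier V. b v \<in> module_hom k W U)"

lemma bilinear_left: "bilinear_map k V W U b \<Longrightarrow> w \<in> carrier W \<Longrightarrow> (\<lambda>v. b v w) \<in> module_hom k V U"
  by (simp add: bilinear_map_def)

lemma bilinear_right: "bilinear_map k V W U b \<Longrightarrow> v \<in> carrier V \<Longrightarrow> b v \<in> module_hom k W U"
  by (simp add: bilinear_map_def)

lemma bilinear_closed:
  assumes "bilinear_map k V W U b" "v \<in> carrier V" "w \<in> carrier W" shows "b v w \<in> carrier U"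
  by (rule hom_in[OF bilinear_right[OF assms(1,2)] assms(3)])

lemma bilinear_compose:
  assumes b: "bilinear_map k V W U b" and f: "f \<in> module_hom k V' V" and g: "g \<in> module_hom k W' W"
    and h: "h \<in> module_hom k U U'"
  shows "bilinear_map k V' W' U' (\<lambda>v w. h (b (f v) (g w)))"
  unfolding bilinear_map_def
proof (intro conjI ballI)
  fix w assume "w \<in> carrier W'"
  then show "(\<lambda>v. h (b (f v) (g w))) \<in> module_hom k V' U'"
    by (intro hom_compose[OF hom_compose[OF f bilinear_left[OF b]] h] hom_in[OF g])
next
  fix v assume "v \<in> carrier V'"
  then show "(\<lambda>w. h (b (f v) (g w))) \<in> module_hom k W' U'"
    by (intro hom_compose[OF hom_compose[OF g bilinear_right[OF b]] h] hom_in[OF f])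
qed

text \<open>
  The relators that impose bilinearity; the tensor product is the free module on pairs modulo their
  span.
\<close>

definition tensor_generators ::
  "('k, 'r) ring_scheme \<Rightarrow> ('k, 'v, 'm) module_scheme \<Rightarrow> ('k, 'w, 'n) module_scheme
    \<Rightarrow> ('v \<times> 'w \<Rightarrow> 'k) set"
  where "tensor_generators k V W =
    (let F = free_module k (carrier V \<times> carrier W); \<delta> = (\<lambda>v w. free_gen k (v, w)) in
      {\<delta> (v \<oplus>\<^bsub>V\<^esub> v') w \<ominus>\<^bsub>F\<^esub> (\<delta> v w \<oplus>\<^bsub>F\<^esub> \<delta> v' w) | v v' w.
          v \<in> carrier V \<and> v' \<in> carrier V \<and> w \<in> carrier W}
      \<union> {\<delta> v (w \<oplus>\<^bsub>W\<^esub> w') \<ominus>\<^bsub>F\<^esub> (\<delta> v w \<oplus>\<^bsub>F\<^esub> \<delta> v w') | v w w'.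
          v \<in> carrier V \<and> w \<in> carrier W \<and> w' \<in> carrier W}
      \<union> {\<delta> (a \<odot>\<^bsub>V\<^esub> v) w \<ominus>\<^bsub>F\<^esub> a \<odot>\<^bsub>F\<^esub> \<delta> v w | a v w.
          a \<in> carrier k \<and> v \<in> carrier V \<and> w \<in> carrier W}
      \<union> {\<delta> v (a \<odot>\<^bsub>W\<^esub> w) \<ominus>\<^bsub>F\<^esub> a \<odot>\<^bsub>F\<^esub> \<delta> v w | a v w.
          a \<in> carrier k \<and> v \<in> carrier V \<and> w \<in> carrier W})"

context
  fixes k :: "('k, 'r) ring_scheme" and V :: "('k, 'v, 'm) module_scheme"
    and W :: "('k, 'w, 'n) module_scheme"
  assumes V: "module k V" and W: "module k W"
begin

interpretation V: module k V by (rule V)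
interpretation W: module k W by (rule W)

abbreviation (input) "FVW \<equiv> free_module k (carrier V \<times> carrier W)"

interpretation F: module k FVW by (rule V.free_module_module)

lemma tensor_generators_subset: "tensor_generators k V W \<subseteq> tensor_relations k V W"
  and relations_submodule: "submodule k (tensor_relations k V W) FVW"
  and relations_least: "submodule k N FVW \<Longrightarrow> tensor_generators k V W \<subseteq> N \<Longrightarrow> tensor_relations k V W \<subseteq> N"
proof -
  have T: "tensor_relations k V W = F.span (tensor_generators k V W)"
    by (simp only: tensor_relations_def tensor_generators_def Let_def)
  have gen: "free_gen k (v, w) \<in> carrier FVW" if "v \<in> carrier V" "w \<in> carrier W" for v w
    using that by (intro V.free_gen_closed) simp
  have S: "tensor_generators k V W \<subseteq> carrier FVW"
    unfolding tensor_generators_def Let_def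
    by (auto intro!: F.minus_closed F.add.m_closed F.smult_closed gen simp del: free_module_simps)
  show "tensor_generators k V W \<subseteq> tensor_relations k V W" unfolding T by (rule F.in_own_span[OF S])
  show "submodule k (tensor_relations k V W) FVW" unfolding T by (rule F.span_is_submodule[OF S])
  show "submodule k N FVW \<Longrightarrow> tensor_generators k V W \<subseteq> N \<Longrightarrow> tensor_relations k V W \<subseteq> N"
    unfolding T by (rule F.span_is_subset)
qed

lemma relations_mem:
    "v \<in> carrier V \<Longrightarrow> v' \<in> carrier V \<Longrightarrow> w \<in> carrier W \<Longrightarrow>
      free_gen k (v \<oplus>\<^bsub>V\<^esub> v', w) \<ominus>\<^bsub>FVW\<^esub> (free_gen k (v, w) \<oplus>\<^bsub>FVW\<^esub> free_gen k (v', w))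
        \<in> tensor_relations k V W"
    "v \<in> carrier V \<Longrightarrow> w \<in> carrier W \<Longrightarrow> w' \<in> carrier W \<Longrightarrow>
      free_gen k (v, w \<oplus>\<^bsub>W\<^esub> w') \<ominus>\<^bsub>FVW\<^esub> (free_gen k (v, w) \<oplus>\<^bsub>FVW\<^esub> free_gen k (v, w'))
        \<in> tensor_relations k V W"
    "a \<in> carrier k \<Longrightarrow> v \<in> carrier V \<Longrightarrow> w \<in> carrier W \<Longrightarrow>
      free_gen k (a \<odot>\<^bsub>V\<^esub> v, w) \<ominus>\<^bsub>FVW\<^esub> a \<odot>\<^bsub>FVW\<^esub> free_gen k (v, w) \<in> tensor_relations k V W"
    "a \<in> carrier k \<Longrightarrow> v \<in> carrier V \<Longrightarrow> w \<in> carrier W \<Longrightarrow>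
      free_gen k (v, a \<odot>\<^bsub>W\<^esub> w) \<ominus>\<^bsub>FVW\<^esub> a \<odot>\<^bsub>FVW\<^esub> free_gen k (v, w) \<in> tensor_relations k V W"
  by (rule subsetD[OF tensor_generators_subset]; unfold tensor_generators_def Let_def;
      ((rule UnI1)+, blast | rule UnI1, rule UnI1, rule UnI2, blast
        | rule UnI1, rule UnI2, blast | rule UnI2, blast))+

lemma tensor_module: "module k (tensor k V W)"
  unfolding tensor_def by (rule F.quotient_module[OF relations_submodule])

interpretation T: module k "tensor k V W" by (rule tensor_module)

lemma free_gen_pair: "v \<in> carrier V \<Longrightarrow> w \<in> carrier W \<Longrightarrow> free_gen k (v, w) \<in> carrier FVW"
  by (intro V.free_gen_closed) simp

lemma tensor_coset_hom:
  "(\<lambda>t. tensor_relations k V W +>\<^bsub>FVW\<^esub> t) \<in> module_hom k FVW (tensor k V W)"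
  unfolding tensor_def by (rule F.coset_hom[OF relations_submodule])

lemma pure_closed:
  "v \<in> carrier V \<Longrightarrow> w \<in> carrier W \<Longrightarrow> pure_tensor k V W v w \<in> carrier (tensor k V W)"
  unfolding pure_tensor_def by (rule hom_in[OF tensor_coset_hom free_gen_pair])

lemma pure_bilinear: "bilinear_map k V W (tensor k V W) (pure_tensor k V W)"
proof -
  have eq: "tensor_relations k V W +>\<^bsub>FVW\<^esub> s = tensor_relations k V W +>\<^bsub>FVW\<^esub> t"
    if "s \<ominus>\<^bsub>FVW\<^esub> t \<in> tensor_relations k V W" "s \<in> carrier FVW" "t \<in> carrier FVW" for s t
    using F.coset_eq_iff[OF relations_submodule that(3,2)] that(1) by simp
  note gen = free_gen_pair and hom = tensor_coset_hom
  show ?thesis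
    unfolding bilinear_map_def
  proof (intro conjI ballI module_homI)
    fix v v' w assume *: "v \<in> carrier V" "v' \<in> carrier V" "w \<in> carrier W"
    then show "pure_tensor k V W (v \<oplus>\<^bsub>V\<^esub> v') w =
        pure_tensor k V W v w \<oplus>\<^bsub>tensor k V W\<^esub> pure_tensor k V W v' w"
      unfolding pure_tensor_def module_hom_add[OF hom gen gen, symmetric, OF *(1,3,2,3)]
      by (intro eq relations_mem) (auto intro!: gen F.add.m_closed simp del: free_module_simps)
  next
    fix v w w' assume *: "v \<in> carrier V" "w \<in> carrier W" "w' \<in> carrier W"
    then show "pure_tensor k V W v (w \<oplus>\<^bsub>W\<^esub> w') =
        pure_tensor k V W v w \<oplus>\<^bsub>tensor k V W\<^esub> pure_tensor k V W v w'"
      unfolding pure_tensor_def module_hom_add[OF hom gen gen, symmetric, OF *(1,2,1,3)]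
      by (intro eq relations_mem) (auto intro!: gen F.add.m_closed simp del: free_module_simps)
  next
    fix a v w assume *: "a \<in> carrier k" "v \<in> carrier V" "w \<in> carrier W"
    then show "pure_tensor k V W (a \<odot>\<^bsub>V\<^esub> v) w = a \<odot>\<^bsub>tensor k V W\<^esub> pure_tensor k V W v w"
      unfolding pure_tensor_def module_hom_smult[OF hom *(1) gen[OF *(2,3)], symmetric]
      by (intro eq relations_mem) (auto intro!: gen F.smult_closed simp del: free_module_simps)
    from * show "pure_tensor k V W v (a \<odot>\<^bsub>W\<^esub> w) = a \<odot>\<^bsub>tensor k V W\<^esub> pure_tensor k V W v w"
      unfolding pure_tensor_def module_hom_smult[OF hom *(1) gen[OF *(2,3)], symmetric]
      by (intro eq relations_mem) (auto intro!: gen F.smult_closed simp del: free_module_simps)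
  qed (rule pure_closed; assumption)+
qed

text \<open>
  Every tensor is a sum of pure tensors: scalars can be absorbed into the left factor, and the zero
  tensor is the pure tensor of zeros.
\<close>

lemma tensor_induct:
  assumes x: "x \<in> carrier (tensor k V W)"
    and pure: "\<And>v w. v \<in> carrier V \<Longrightarrow> w \<in> carrier W \<Longrightarrow> P (pure_tensor k V W v w)"
    and add: "\<And>x y. x \<in> carrier (tensor k V W) \<Longrightarrow> y \<in> carrier (tensor k V W) \<Longrightarrow>
      P x \<Longrightarrow> P y \<Longrightarrow> P (x \<oplus>\<^bsub>tensor k V W\<^esub> y)"
  shows "P x"
proof -
  let ?c = "\<lambda>t. tensor_relations k V W +>\<^bsub>FVW\<^esub> t"
  obtain t where t: "t \<in> carrier FVW" "x = ?c t"
    using F.coset_cases[OF relations_submodule x[unfolded tensor_def]] by blast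
  have "P (?c t)"
    using t(1)
  proof (rule V.free_module_induct)
    have "?c \<zero>\<^bsub>FVW\<^esub> = \<zero>\<^bsub>tensor k V W\<^esub>"
      by (rule hom_zero[OF F.module_axioms tensor_module tensor_coset_hom])
    also have "\<dots> = pure_tensor k V W \<zero>\<^bsub>V\<^esub> \<zero>\<^bsub>W\<^esub>"
      by (rule hom_zero[OF W tensor_module bilinear_right[OF pure_bilinear V.M.zero_closed], symmetric])
    finally show "P (?c (\<lambda>_. \<zero>\<^bsub>k\<^esub>))" using pure[of "\<zero>\<^bsub>V\<^esub>" "\<zero>\<^bsub>W\<^esub>"] by simp
  next
    fix s a p assume s: "s \<in> carrier FVW" "P (?c s)" and a: "a \<in> carrier k" and p: "p \<in> carrier V \<times> carrier W"
    obtain v w where vw: "p = (v, w)" "v \<in> carrier V" "w \<in> carrier W" using p by blast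
    have g: "free_gen k p \<in> carrier FVW" by (rule V.free_gen_closed[OF p])
    have "?c (s \<oplus>\<^bsub>FVW\<^esub> a \<odot>\<^bsub>FVW\<^esub> free_gen k p) = ?c s \<oplus>\<^bsub>tensor k V W\<^esub> a \<odot>\<^bsub>tensor k V W\<^esub> ?c (free_gen k p)"
      by (simp only: module_hom_add[OF tensor_coset_hom s(1) F.smult_closed[OF a g]]
          module_hom_smult[OF tensor_coset_hom a g])
    also have "a \<odot>\<^bsub>tensor k V W\<^esub> ?c (free_gen k p) = pure_tensor k V W (a \<odot>\<^bsub>V\<^esub> v) w"
      using module_hom_smult[OF bilinear_left[OF pure_bilinear vw(3)] a vw(2)]
      by (simp add: pure_tensor_def vw(1))
    finally show "P (?c (s \<oplus>\<^bsub>FVW\<^esub> a \<odot>\<^bsub>FVW\<^esub> free_gen k p))"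
      using add[OF hom_in[OF tensor_coset_hom s(1)] pure_closed s(2) pure] a vw by simp
  qed
  then show ?thesis using t(2) by simp
qed

lemma tensor_hom_eqI:
  assumes f: "f \<in> module_hom k (tensor k V W) U" and g: "g \<in> module_hom k (tensor k V W) U"
    and eq: "\<And>v w. v \<in> carrier V \<Longrightarrow> w \<in> carrier W \<Longrightarrow>
      f (pure_tensor k V W v w) = g (pure_tensor k V W v w)"
    and x: "x \<in> carrier (tensor k V W)"
  shows "f x = g x"
  using x
proof (rule tensor_induct)
  fix x y assume "x \<in> carrier (tensor k V W)" "y \<in> carrier (tensor k V W)" "f x = g x" "f y = g y"
  then show "f (x \<oplus>\<^bsub>tensor k V W\<^esub> y) = g (x \<oplus>\<^bsub>tensor k V W\<^esub> y)"
    by (simp only: module_hom_add[OF f] module_hom_add[OF g])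
qed (rule eq)

context
  fixes U :: "('k, 'u, 'l) module_scheme" and b
  assumes U: "module k U" and b: "bilinear_map k V W U b"
begin

interpretation U: module k U by (rule U)

abbreviation (input) "ext_b \<equiv> V.free_extend U (\<lambda>p. b (fst p) (snd p))"

lemma ext_b_hom: "ext_b \<in> module_hom k FVW U"
  by (rule V.free_extend_hom[OF U]) (auto intro: bilinear_closed[OF b])

lemma ext_b_gen: "v \<in> carrier V \<Longrightarrow> w \<in> carrier W \<Longrightarrow> ext_b (free_gen k (v, w)) = b v w"
  using V.free_extend_gen[OF U, of "carrier V \<times> carrier W" "\<lambda>p. b (fst p) (snd p)" "(v, w)"]
    bilinear_closed[OF b] by auto

text \<open>
  Bilinearity of \<open>b\<close> says exactly that its extension to the free module kills the relators; the kernel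
  is a submodule and so contains their span. This makes \<^const>\<open>tensor_lift\<close> well defined.
\<close>

lemma ext_b_relations: "t \<in> tensor_relations k V W \<Longrightarrow> ext_b t = \<zero>\<^bsub>U\<^esub>"
proof -
  interpret e: mod_hom k FVW U ext_b by (rule mod_homI[OF F.module_axioms U ext_b_hom])
  note gen = free_gen_pair
  have minus: "s \<ominus>\<^bsub>FVW\<^esub> t \<in> e.ker"
    if "ext_b s = ext_b t" "s \<in> carrier FVW" "t \<in> carrier FVW" for s t
  proof -
    have "ext_b (s \<ominus>\<^bsub>FVW\<^esub> t) = ext_b t \<ominus>\<^bsub>U\<^esub> ext_b t"
      using hom_minus[OF F.module_axioms U ext_b_hom that(2,3)] that(1) by simp
    also have "\<dots> = \<zero>\<^bsub>U\<^esub>" using hom_in[OF ext_b_hom that(3)] by simp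
    finally show ?thesis unfolding e.ker_def using F.minus_closed[OF that(2,3)] by blast
  qed
  have "tensor_relations k V W \<subseteq> e.ker"
    by (rule relations_least[OF e.ker_is_submodule], unfold tensor_generators_def Let_def, safe; rule minus)
      (simp_all del: free_module_simps add: gen ext_b_gen module_hom_add[OF ext_b_hom]
        module_hom_smult[OF ext_b_hom] module_hom_add[OF bilinear_left[OF b]]
        module_hom_add[OF bilinear_right[OF b]] module_hom_smult[OF bilinear_left[OF b]]
        module_hom_smult[OF bilinear_right[OF b]])
  then show "t \<in> tensor_relations k V W \<Longrightarrow> ext_b t = \<zero>\<^bsub>U\<^esub>" by (auto simp: e.ker_def)
qed

lemma tensor_lift_coset:
  assumes t: "t \<in> carrier FVW"
  shows "tensor_lift k U b (tensor_relations k V W +>\<^bsub>FVW\<^esub> t) = ext_b t"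
proof -
  let ?N = "tensor_relations k V W"
  interpret N: abelian_subgroup ?N FVW by (rule F.submodule_abelian_subgroup[OF relations_submodule])
  have "ext_b s = ext_b t" if s: "s \<in> ?N +>\<^bsub>FVW\<^esub> t" for s
  proof -
    obtain n where n: "n \<in> ?N" "s = n \<oplus>\<^bsub>FVW\<^esub> t" using s by (auto simp: a_r_coset_def')
    then show ?thesis
      using module_hom_add[OF ext_b_hom _ t, of n] ext_b_relations[OF n(1)] N.a_Hcarr[OF n(1)]
        hom_in[OF ext_b_hom t] by simp
  qed
  then have "ext_b ` (?N +>\<^bsub>FVW\<^esub> t) = {ext_b t}" using N.a_rcos_self[OF t] by blast
  then show ?thesis by (simp add: tensor_lift_def V.free_extend_def[abs_def])
qed

lemma tensor_lift_pure:
  assumes "v \<in> carrier V" "w \<in> carrier W"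
  shows "tensor_lift k U b (pure_tensor k V W v w) = b v w"
  unfolding pure_tensor_def using tensor_lift_coset[OF free_gen_pair] ext_b_gen assms by simp

lemma tensor_lift_hom: "tensor_lift k U b \<in> module_hom k (tensor k V W) U"
proof (rule module_homI)
  note cases = F.coset_cases[OF relations_submodule, folded tensor_def]
  note add = module_hom_add[OF tensor_coset_hom, symmetric]
    and smult = module_hom_smult[OF tensor_coset_hom, symmetric]
  show "tensor_lift k U b x \<in> carrier U" if x: "x \<in> carrier (tensor k V W)" for x
  proof -
    obtain t where t: "t \<in> carrier FVW" "x = tensor_relations k V W +>\<^bsub>FVW\<^esub> t" by (rule cases[OF x])
    show ?thesis unfolding t(2) tensor_lift_coset[OF t(1)] by (rule hom_in[OF ext_b_hom t(1)])
  qed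
  show "tensor_lift k U b (x \<oplus>\<^bsub>tensor k V W\<^esub> y) = tensor_lift k U b x \<oplus>\<^bsub>U\<^esub> tensor_lift k U b y"
    if x: "x \<in> carrier (tensor k V W)" and y: "y \<in> carrier (tensor k V W)" for x y
  proof -
    obtain s where s: "s \<in> carrier FVW" "x = tensor_relations k V W +>\<^bsub>FVW\<^esub> s" by (rule cases[OF x])
    obtain t where t: "t \<in> carrier FVW" "y = tensor_relations k V W +>\<^bsub>FVW\<^esub> t" by (rule cases[OF y])
    show ?thesis
      unfolding s(2) t(2) add[OF s(1) t(1)] tensor_lift_coset[OF F.add.m_closed[OF s(1) t(1), simplified monoid.simps]]
        tensor_lift_coset[OF s(1)] tensor_lift_coset[OF t(1)]
      by (rule module_hom_add[OF ext_b_hom s(1) t(1)])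
  qed
  show "tensor_lift k U b (a \<odot>\<^bsub>tensor k V W\<^esub> x) = a \<odot>\<^bsub>U\<^esub> tensor_lift k U b x"
    if a: "a \<in> carrier k" and x: "x \<in> carrier (tensor k V W)" for a x
  proof -
    obtain t where t: "t \<in> carrier FVW" "x = tensor_relations k V W +>\<^bsub>FVW\<^esub> t" by (rule cases[OF x])
    show ?thesis
      unfolding t(2) smult[OF a t(1)] tensor_lift_coset[OF F.smult_closed[OF a t(1)]]
        tensor_lift_coset[OF t(1)]
      by (rule module_hom_smult[OF ext_b_hom a t(1)])
  qed
qed

lemma tensor_lift_closed: "x \<in> carrier (tensor k V W) \<Longrightarrow> tensor_lift k U b x \<in> carrier U"
  by (rule hom_in[OF tensor_lift_hom])

lemma tensor_lift_eqI:
  assumes h: "h \<in> module_hom k (tensor k V W) U"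
    and eq: "\<And>v w. v \<in> carrier V \<Longrightarrow> w \<in> carrier W \<Longrightarrow> h (pure_tensor k V W v w) = b v w"
    and x: "x \<in> carrier (tensor k V W)"
  shows "h x = tensor_lift k U b x"
  by (rule tensor_hom_eqI[OF h tensor_lift_hom _ x]) (simp add: eq tensor_lift_pure)

end

end

lemma bilinear_cong:
  assumes "bilinear_map k V W U b" "module k V" "module k W"
    and eq: "\<And>v w. v \<in> carrier V \<Longrightarrow> w \<in> carrier W \<Longrightarrow> b v w = b' v w"
  shows "bilinear_map k V W U b'"
  unfolding bilinear_map_def
proof (intro conjI ballI)
  fix w assume w: "w \<in> carrier W"
  show "(\<lambda>v. b' v w) \<in> module_hom k V U"
    by (rule hom_cong[OF bilinear_left[OF assms(1) w] eq[OF _ w] assms(2)])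
next
  fix v assume v: "v \<in> carrier V"
  show "b' v \<in> module_hom k W U"
    by (rule hom_cong[OF bilinear_right[OF assms(1) v] eq[OF v] assms(3)])
qed

lemma tensor_lift_cong:
  assumes b: "bilinear_map k V W U b" and V: "module k V" and W: "module k W" and U: "module k U"
    and eq: "\<And>v w. v \<in> carrier V \<Longrightarrow> w \<in> carrier W \<Longrightarrow> b v w = b' v w"
    and x: "x \<in> carrier (tensor k V W)"
  shows "tensor_lift k U b x = tensor_lift k U b' x"
  by (rule tensor_lift_eqI[OF V W U bilinear_cong[OF b V W eq] tensor_lift_hom[OF V W U b] _ x])
    (simp_all add: tensor_lift_pure[OF V W U b] eq)

lemma hom_tensor_lift:
  assumes b: "bilinear_map k V W U b" and V: "module k V" and W: "module k W" and U: "module k U"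
    and U': "module k U'" and h: "h \<in> module_hom k U U'" and x: "x \<in> carrier (tensor k V W)"
  shows "h (tensor_lift k U b x) = tensor_lift k U' (\<lambda>v w. h (b v w)) x"
proof (rule tensor_lift_eqI[OF V W U' bilinear_compose[OF b hom_id hom_id h]
      hom_compose[OF tensor_lift_hom[OF V W U b] h] _ x])
  fix v w assume "v \<in> carrier V" "w \<in> carrier W"
  then show "h (tensor_lift k U b (pure_tensor k V W v w)) = h (b v w)"
    by (simp add: tensor_lift_pure[OF V W U b])
qed

lemma tensor_map_bilinear:
  assumes V: "module k V" and W: "module k W"
    and f: "f \<in> module_hom k V' V" and g: "g \<in> module_hom k W' W"
  shows "bilinear_map k V' W' (tensor k V W) (\<lambda>x y. pure_tensor k V W (f x) (g y))"
  by (rule bilinear_compose[OF pure_bilinear[OF V W] f g hom_id])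

context
  fixes k :: "('k, 'r) ring_scheme" and V :: "('k, 'v, 'm) module_scheme"
    and W :: "('k, 'w, 'n) module_scheme" and V' :: "('k, 'v2, 'm2) module_scheme"
    and W' :: "('k, 'w2, 'n2) module_scheme" and f g
  assumes mods: "module k V" "module k W" "module k V'" "module k W'"
    and f: "f \<in> module_hom k V' V" and g: "g \<in> module_hom k W' W"
begin

lemma tensor_map_hom: "tensor_map k V W f g \<in> module_hom k (tensor k V' W') (tensor k V W)"
  unfolding tensor_map_def
  by (rule tensor_lift_hom[OF mods(3,4) tensor_module[OF mods(1,2)] tensor_map_bilinear[OF mods(1,2) f g]])

lemma tensor_map_pure:
  "v \<in> carrier V' \<Longrightarrow> w \<in> carrier W' \<Longrightarrow>
    tensor_map k V W f g (pure_tensor k V' W' v w) = pure_tensor k V W (f v) (g w)"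
  unfolding tensor_map_def
  by (rule tensor_lift_pure[OF mods(3,4) tensor_module[OF mods(1,2)] tensor_map_bilinear[OF mods(1,2) f g]])

lemma tensor_lift_map:
  assumes b: "bilinear_map k V W U b" and U: "module k U" and x: "x \<in> carrier (tensor k V' W')"
  shows "tensor_lift k U b (tensor_map k V W f g x) = tensor_lift k U (\<lambda>v w. b (f v) (g w)) x"
proof (rule tensor_lift_eqI[OF mods(3,4) U bilinear_compose[OF b f g hom_id]
      hom_compose[OF tensor_map_hom tensor_lift_hom[OF mods(1,2) U b]] _ x])
  fix v w assume vw: "v \<in> carrier V'" "w \<in> carrier W'"
  then show "tensor_lift k U b (tensor_map k V W f g (pure_tensor k V' W' v w)) = b (f v) (g w)"
    by (simp add: tensor_map_pure tensor_lift_pure[OF mods(1,2) U b hom_in[OF f] hom_in[OF g]])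
qed

end

lemma functional_bilinear:
  assumes k: "cring k" and f: "f \<in> module_hom k V (self_module k)" and g: "g \<in> module_hom k W (self_module k)"
  shows "bilinear_map k V W (self_module k) (\<lambda>v w. f v \<otimes>\<^bsub>k\<^esub> g w)"
proof -
  interpret k: cring k by fact
  have fc: "f v \<in> carrier k" if "v \<in> carrier V" for v using hom_in[OF f that] by simp
  have gc: "g w \<in> carrier k" if "w \<in> carrier W" for w using hom_in[OF g that] by simp
  show ?thesis
    unfolding bilinear_map_def
    by (intro conjI ballI module_homI)
      (simp_all add: fc gc module_hom_add[OF f] module_hom_add[OF g] module_hom_smult[OF f]
        module_hom_smult[OF g] k.l_distr k.r_distr k.m_assoc k.m_lcomm)
qed

lemma scalar_bilinear_right:
  assumes V: "module k V" and g: "g \<in> module_hom k W (self_module k)"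
  shows "bilinear_map k V W V (\<lambda>v w. g w \<odot>\<^bsub>V\<^esub> v)"
proof -
  interpret V: module k V by fact
  have gc: "g w \<in> carrier k" if "w \<in> carrier W" for w using hom_in[OF g that] by simp
  show ?thesis
    unfolding bilinear_map_def
  proof (intro conjI ballI)
    fix w assume w: "w \<in> carrier W"
    show "(\<lambda>v. g w \<odot>\<^bsub>V\<^esub> v) \<in> module_hom k V V"
      by (rule module_homI)
        (simp_all add: gc[OF w] V.smult_r_distr V.smult_assoc1[symmetric] V.R.m_comm)
  next
    fix v assume "v \<in> carrier V"
    then show "(\<lambda>w. g w \<odot>\<^bsub>V\<^esub> v) \<in> module_hom k W V" by (rule hom_smult_const[OF V g])
  qed
qed

lemma scalar_bilinear_left:
  assumes W: "module k W" and f: "f \<in> module_hom k V (self_module k)"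
  shows "bilinear_map k V W W (\<lambda>v w. f v \<odot>\<^bsub>W\<^esub> w)"
  using scalar_bilinear_right[OF W f] by (simp add: bilinear_map_def)

text \<open>
  With a frame of \<open>W\<close> a tensor can be written with the frame vectors on the right. Its coefficients, the
  slices, are obtained by applying the coordinate functionals to the right factor. Both sides are
  linear, so it suffices to compare them on pure tensors.
\<close>

lemma slice_right:
  assumes V: "module k V" and W: "module k W" and B: "finite B" "B \<subseteq> carrier W"
    and e: "\<And>b. b \<in> B \<Longrightarrow> e b \<in> module_hom k W (self_module k)"
    and frame: "\<And>w. w \<in> carrier W \<Longrightarrow> w = (\<Oplus>\<^bsub>W\<^esub>b\<in>B. e b w \<odot>\<^bsub>W\<^esub> b)"
    and x: "x \<in> carrier (tensor k V W)"
  shows "x = (\<Oplus>\<^bsub>tensor k V W\<^esub>b\<in>B. pure_tensor k V W (tensor_lift k V (\<lambda>v w. e b w \<odot>\<^bsub>V\<^esub> v) x) b)"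
proof (rule tensor_hom_eqI[OF V W hom_id _ _ x])
  note T = tensor_module[OF V W] and pure = pure_bilinear[OF V W]
  interpret V: module k V by fact
  interpret W: module k W by fact
  interpret T: module k "tensor k V W" by (rule T)
  have b: "b \<in> carrier W" if "b \<in> B" for b using that B by blast
  have bil: "bilinear_map k V W V (\<lambda>v w. e b w \<odot>\<^bsub>V\<^esub> v)" if "b \<in> B" for b
    by (rule scalar_bilinear_right[OF V e[OF that]])
  show "(\<lambda>x. \<Oplus>\<^bsub>tensor k V W\<^esub>b\<in>B. pure_tensor k V W (tensor_lift k V (\<lambda>v w. e b w \<odot>\<^bsub>V\<^esub> v) x) b)
      \<in> module_hom k (tensor k V W) (tensor k V W)"
    by (rule hom_finsum_fun[OF T T B(1)])
      (rule hom_compose[OF tensor_lift_hom[OF V W V bil] bilinear_left[OF pure b]])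
  fix v w assume vw: "v \<in> carrier V" "w \<in> carrier W"
  have ec: "e b w \<in> carrier k" if "b \<in> B" for b using hom_in[OF e[OF that] vw(2)] by simp
  have "pure_tensor k V W v w = pure_tensor k V W v (\<Oplus>\<^bsub>W\<^esub>b\<in>B. e b w \<odot>\<^bsub>W\<^esub> b)"
    using frame[OF vw(2)] by simp
  also have "\<dots> = (\<Oplus>\<^bsub>tensor k V W\<^esub>b\<in>B. pure_tensor k V W v (e b w \<odot>\<^bsub>W\<^esub> b))"
    by (rule hom_finsum[OF W T bilinear_right[OF pure vw(1)] B(1)]) (use ec b in auto)
  also have "\<dots> = (\<Oplus>\<^bsub>tensor k V W\<^esub>b\<in>B.
      pure_tensor k V W (tensor_lift k V (\<lambda>v w. e b w \<odot>\<^bsub>V\<^esub> v) (pure_tensor k V W v w)) b)"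
  proof (rule T.finsum_cong')
    fix b assume bB: "b \<in> B"
    show "pure_tensor k V W v (e b w \<odot>\<^bsub>W\<^esub> b) =
        pure_tensor k V W (tensor_lift k V (\<lambda>v w. e b w \<odot>\<^bsub>V\<^esub> v) (pure_tensor k V W v w)) b"
      unfolding tensor_lift_pure[OF V W V bil[OF bB] vw]
        module_hom_smult[OF bilinear_left[OF pure b[OF bB]] ec[OF bB] vw(1)]
        module_hom_smult[OF bilinear_right[OF pure vw(1)] ec[OF bB] b[OF bB]] ..
  qed (use ec b vw in \<open>auto simp: tensor_lift_pure[OF V W V bil] intro!: pure_closed[OF V W]\<close>)
  finally show "pure_tensor k V W v w = (\<Oplus>\<^bsub>tensor k V W\<^esub>b\<in>B.
      pure_tensor k V W (tensor_lift k V (\<lambda>v w. e b w \<odot>\<^bsub>V\<^esub> v) (pure_tensor k V W v w)) b)" .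
qed

lemma slice_left:
  assumes V: "module k V" and W: "module k W" and B: "finite B" "B \<subseteq> carrier V"
    and e: "\<And>b. b \<in> B \<Longrightarrow> e b \<in> module_hom k V (self_module k)"
    and frame: "\<And>v. v \<in> carrier V \<Longrightarrow> v = (\<Oplus>\<^bsub>V\<^esub>b\<in>B. e b v \<odot>\<^bsub>V\<^esub> b)"
    and x: "x \<in> carrier (tensor k V W)"
  shows "x = (\<Oplus>\<^bsub>tensor k V W\<^esub>b\<in>B. pure_tensor k V W b (tensor_lift k W (\<lambda>v w. e b v \<odot>\<^bsub>W\<^esub> w) x))"
proof (rule tensor_hom_eqI[OF V W hom_id _ _ x])
  note T = tensor_module[OF V W] and pure = pure_bilinear[OF V W]
  interpret V: module k V by fact
  interpret W: module k W by fact
  interpret T: module k "tensor k V W" by (rule T)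
  have b: "b \<in> carrier V" if "b \<in> B" for b using that B by blast
  have bil: "bilinear_map k V W W (\<lambda>v w. e b v \<odot>\<^bsub>W\<^esub> w)" if "b \<in> B" for b
    by (rule scalar_bilinear_left[OF W e[OF that]])
  show "(\<lambda>x. \<Oplus>\<^bsub>tensor k V W\<^esub>b\<in>B. pure_tensor k V W b (tensor_lift k W (\<lambda>v w. e b v \<odot>\<^bsub>W\<^esub> w) x))
      \<in> module_hom k (tensor k V W) (tensor k V W)"
    by (rule hom_finsum_fun[OF T T B(1)])
      (rule hom_compose[OF tensor_lift_hom[OF V W W bil] bilinear_right[OF pure b]])
  fix v w assume vw: "v \<in> carrier V" "w \<in> carrier W"
  have ec: "e b v \<in> carrier k" if "b \<in> B" for b using hom_in[OF e[OF that] vw(1)] by simp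
  have "pure_tensor k V W v w = pure_tensor k V W (\<Oplus>\<^bsub>V\<^esub>b\<in>B. e b v \<odot>\<^bsub>V\<^esub> b) w"
    using frame[OF vw(1)] by simp
  also have "\<dots> = (\<Oplus>\<^bsub>tensor k V W\<^esub>b\<in>B. pure_tensor k V W (e b v \<odot>\<^bsub>V\<^esub> b) w)"
    by (rule hom_finsum[OF V T bilinear_left[OF pure vw(2)] B(1)]) (use ec b in auto)
  also have "\<dots> = (\<Oplus>\<^bsub>tensor k V W\<^esub>b\<in>B.
      pure_tensor k V W b (tensor_lift k W (\<lambda>v w. e b v \<odot>\<^bsub>W\<^esub> w) (pure_tensor k V W v w)))"
  proof (rule T.finsum_cong')
    fix b assume bB: "b \<in> B"
    show "pure_tensor k V W (e b v \<odot>\<^bsub>V\<^esub> b) w =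
        pure_tensor k V W b (tensor_lift k W (\<lambda>v w. e b v \<odot>\<^bsub>W\<^esub> w) (pure_tensor k V W v w))"
      unfolding tensor_lift_pure[OF V W W bil[OF bB] vw]
        module_hom_smult[OF bilinear_right[OF pure b[OF bB]] ec[OF bB] vw(2)]
        module_hom_smult[OF bilinear_left[OF pure vw(2)] ec[OF bB] b[OF bB]] ..
  qed (use ec b vw in \<open>auto simp: tensor_lift_pure[OF V W W bil] intro!: pure_closed[OF V W]\<close>)
  finally show "pure_tensor k V W v w = (\<Oplus>\<^bsub>tensor k V W\<^esub>b\<in>B.
      pure_tensor k V W b (tensor_lift k W (\<lambda>v w. e b v \<odot>\<^bsub>W\<^esub> w) (pure_tensor k V W v w)))" .
qed

text \<open>
  Functionals \<open>f \<otimes> g\<close> separate tensors, where \<open>g\<close> ranges over any separating family \<open>G\<close>: they determine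
  all values of \<open>G\<close> on the slices, hence the slices. The family \<open>G\<close> is left general so that the lemma
  can be iterated for \<open>V \<otimes> (V \<otimes> V)\<close>, with \<open>G\<close> consisting of functionals \<open>g \<otimes> h\<close>.
\<close>

lemma tensor_separation:
  assumes V: "vectorspace k V" and fd: "vectorspace.fin_dim k V" and W: "module k W"
    and G: "G \<subseteq> module_hom k W (self_module k)"
    and sep: "\<And>w w'. w \<in> carrier W \<Longrightarrow> w' \<in> carrier W \<Longrightarrow> (\<And>g. g \<in> G \<Longrightarrow> g w = g w') \<Longrightarrow> w = w'"
    and x: "x \<in> carrier (tensor k V W)" and y: "y \<in> carrier (tensor k V W)"
    and eq: "\<And>f g. f \<in> module_hom k V (self_module k) \<Longrightarrow> g \<in> G \<Longrightarrow>
      tensor_lift k (self_module k) (\<lambda>v w. f v \<otimes>\<^bsub>k\<^esub> g w) x =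
      tensor_lift k (self_module k) (\<lambda>v w. f v \<otimes>\<^bsub>k\<^esub> g w) y"
  shows "x = y"
proof -
  interpret V: vectorspace k V by fact
  interpret W: module k W by fact
  note S = self_module_module[OF module.axioms(1)[OF W]] and Vm = V.module_axioms
  interpret T: module k "tensor k V W" by (rule tensor_module[OF Vm W])
  obtain B e where B: "finite B" "B \<subseteq> carrier V"
    "\<And>b. b \<in> B \<Longrightarrow> e b \<in> module_hom k V (self_module k)"
    "\<And>v. v \<in> carrier V \<Longrightarrow> v = (\<Oplus>\<^bsub>V\<^esub>b\<in>B. e b v \<odot>\<^bsub>V\<^esub> b)"
    by (rule V.frame[OF fd]) (rule that)
  let ?s = "\<lambda>b. tensor_lift k W (\<lambda>v w. e b v \<odot>\<^bsub>W\<^esub> w)"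
  have "?s b x = ?s b y" if b: "b \<in> B" for b
  proof (rule sep)
    note bil = scalar_bilinear_left[OF W B(3)[OF b]]
    show "?s b x \<in> carrier W" "?s b y \<in> carrier W"
      using tensor_lift_closed[OF Vm W W bil] x y by blast+
    fix g assume g: "g \<in> G"
    have gh: "g \<in> module_hom k W (self_module k)" using g G by blast
    have "g (?s b z) = tensor_lift k (self_module k) (\<lambda>v w. e b v \<otimes>\<^bsub>k\<^esub> g w) z"
      if "z \<in> carrier (tensor k V W)" for z
      unfolding hom_tensor_lift[OF bil Vm W W S gh that]
    proof (rule tensor_lift_cong[OF bilinear_compose[OF bil hom_id hom_id gh] Vm W S _ that])
      fix v w assume "v \<in> carrier V" "w \<in> carrier W"
      then show "g (e b v \<odot>\<^bsub>W\<^esub> w) = e b v \<otimes>\<^bsub>k\<^esub> g w"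
        using module_hom_smult[OF gh] hom_in[OF B(3)[OF b]] by simp
    qed
    then show "g (?s b x) = g (?s b y)" using eq[OF B(3)[OF b] g] x y by simp
  qed
  then have "(\<Oplus>\<^bsub>tensor k V W\<^esub>b\<in>B. pure_tensor k V W b (?s b x)) =
      (\<Oplus>\<^bsub>tensor k V W\<^esub>b\<in>B. pure_tensor k V W b (?s b y))"
    using B(1,2) tensor_lift_closed[OF Vm W W scalar_bilinear_left[OF W B(3)] y]
    by (intro T.finsum_cong') (auto intro!: pure_closed[OF Vm W])
  then show ?thesis
    using slice_left[OF Vm W B x] slice_left[OF Vm W B y] by simp
qed

section \<open>Evaluating tensors at pairs of functionals\<close>

lemma hom_pointwise_add:
  assumes W: "module k W" and f: "f \<in> module_hom k V W" and g: "g \<in> module_hom k V W"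
  shows "(\<lambda>v. f v \<oplus>\<^bsub>W\<^esub> g v) \<in> module_hom k V W"
proof -
  interpret W: module k W by fact
  show ?thesis
    by (rule module_homI)
      (simp_all add: hom_in[OF f] hom_in[OF g] module_hom_add[OF f] module_hom_add[OF g]
        module_hom_smult[OF f] module_hom_smult[OF g] W.smult_r_distr W.M.a_ac)
qed

lemma hom_pointwise_smult:
  assumes W: "module k W" and f: "f \<in> module_hom k V W" and a: "a \<in> carrier k"
  shows "(\<lambda>v. a \<odot>\<^bsub>W\<^esub> f v) \<in> module_hom k V W"
proof -
  interpret W: module k W by fact
  have "a \<odot>\<^bsub>W\<^esub> (b \<odot>\<^bsub>W\<^esub> w) = b \<odot>\<^bsub>W\<^esub> (a \<odot>\<^bsub>W\<^esub> w)" if "b \<in> carrier k" "w \<in> carrier W" for b w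
    using that a by (simp add: W.smult_assoc1[symmetric] W.R.m_comm)
  then show ?thesis
    by (intro module_homI)
      (simp_all add: a hom_in[OF f] module_hom_add[OF f] module_hom_smult[OF f] W.smult_r_distr)
qed

text \<open>
  The functional \<open>f \<otimes> g\<close> on a tensor product. The convolution product in the dual algebra of \<open>C\<close> is
  \<open>c \<mapsto> pairing k f g (\<Delta> c)\<close>.
\<close>

abbreviation pairing where
  "pairing k f g \<equiv> tensor_lift k (self_module k) (\<lambda>u v. f u \<otimes>\<^bsub>k\<^esub> g v)"

context
  fixes k :: "('k, 'r) ring_scheme" and V :: "('k, 'v, 'm) module_scheme"
    and W :: "('k, 'w, 'n) module_scheme"
  assumes V: "module k V" and W: "module k W"
begin

interpretation V: module k V by (rule V)

lemmas scalars_module = self_module_module[OF V.R.cring_axioms]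
  and product_bilinear = functional_bilinear[OF V.R.cring_axioms]

lemma pairing_hom:
  assumes "f \<in> module_hom k V (self_module k)" "g \<in> module_hom k W (self_module k)"
  shows "pairing k f g \<in> module_hom k (tensor k V W) (self_module k)"
  by (rule tensor_lift_hom[OF V W scalars_module product_bilinear[OF assms]])

lemma pairing_pure:
  assumes "f \<in> module_hom k V (self_module k)" "g \<in> module_hom k W (self_module k)"
    and "v \<in> carrier V" "w \<in> carrier W"
  shows "pairing k f g (pure_tensor k V W v w) = f v \<otimes>\<^bsub>k\<^esub> g w"
  by (rule tensor_lift_pure[OF V W scalars_module product_bilinear[OF assms(1,2)] assms(3,4)])

lemma pairing_cong:
  assumes f: "f \<in> module_hom k V (self_module k)" and g: "g \<in> module_hom k W (self_module k)"
    and "\<And>v. v \<in> carrier V \<Longrightarrow> f v = f' v" "\<And>w. w \<in> carrier W \<Longrightarrow> g w = g' w"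
    and x: "x \<in> carrier (tensor k V W)"
  shows "pairing k f g x = pairing k f' g' x"
  by (rule tensor_lift_cong[OF product_bilinear[OF f g] V W scalars_module _ x]) (simp add: assms)

lemma pairing_add_left:
  assumes f: "f \<in> module_hom k V (self_module k)" and f': "f' \<in> module_hom k V (self_module k)"
    and g: "g \<in> module_hom k W (self_module k)" and x: "x \<in> carrier (tensor k V W)"
  shows "pairing k (\<lambda>v. f v \<oplus>\<^bsub>k\<^esub> f' v) g x = pairing k f g x \<oplus>\<^bsub>k\<^esub> pairing k f' g x"
proof -
  have ff: "(\<lambda>v. f v \<oplus>\<^bsub>k\<^esub> f' v) \<in> module_hom k V (self_module k)"
    using hom_pointwise_add[OF scalars_module f f'] by simp
  have "(\<lambda>x. pairing k f g x \<oplus>\<^bsub>self_module k\<^esub> pairing k f' g x) x =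
      pairing k (\<lambda>v. f v \<oplus>\<^bsub>k\<^esub> f' v) g x"
    by (rule tensor_lift_eqI[OF V W scalars_module product_bilinear[OF ff g]
          hom_pointwise_add[OF scalars_module pairing_hom[OF f g] pairing_hom[OF f' g]] _ x])
      (use hom_in[OF f] hom_in[OF f'] hom_in[OF g] in
        \<open>simp add: pairing_pure[OF f g] pairing_pure[OF f' g] V.R.l_distr\<close>)
  then show ?thesis by simp
qed

lemma pairing_add_right:
  assumes f: "f \<in> module_hom k V (self_module k)" and g: "g \<in> module_hom k W (self_module k)"
    and g': "g' \<in> module_hom k W (self_module k)" and x: "x \<in> carrier (tensor k V W)"
  shows "pairing k f (\<lambda>w. g w \<oplus>\<^bsub>k\<^esub> g' w) x = pairing k f g x \<oplus>\<^bsub>k\<^esub> pairing k f g' x"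
proof -
  have gg: "(\<lambda>w. g w \<oplus>\<^bsub>k\<^esub> g' w) \<in> module_hom k W (self_module k)"
    using hom_pointwise_add[OF scalars_module g g'] by simp
  have "(\<lambda>x. pairing k f g x \<oplus>\<^bsub>self_module k\<^esub> pairing k f g' x) x =
      pairing k f (\<lambda>w. g w \<oplus>\<^bsub>k\<^esub> g' w) x"
    by (rule tensor_lift_eqI[OF V W scalars_module product_bilinear[OF f gg]
          hom_pointwise_add[OF scalars_module pairing_hom[OF f g] pairing_hom[OF f g']] _ x])
      (use hom_in[OF f] hom_in[OF g] hom_in[OF g'] in
        \<open>simp add: pairing_pure[OF f g] pairing_pure[OF f g'] V.R.r_distr\<close>)
  then show ?thesis by simp
qed

lemma pairing_smult:
  assumes f: "f \<in> module_hom k V (self_module k)" and g: "g \<in> module_hom k W (self_module k)"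
    and a: "a \<in> carrier k" and x: "x \<in> carrier (tensor k V W)"
  shows "pairing k (\<lambda>v. a \<otimes>\<^bsub>k\<^esub> f v) g x = a \<otimes>\<^bsub>k\<^esub> pairing k f g x"
    and "pairing k f (\<lambda>w. a \<otimes>\<^bsub>k\<^esub> g w) x = a \<otimes>\<^bsub>k\<^esub> pairing k f g x"
proof -
  note a_hom = hom_pointwise_smult[OF scalars_module pairing_hom[OF f g] a]
  have af: "(\<lambda>v. a \<otimes>\<^bsub>k\<^esub> f v) \<in> module_hom k V (self_module k)"
    and ag: "(\<lambda>w. a \<otimes>\<^bsub>k\<^esub> g w) \<in> module_hom k W (self_module k)"
    using hom_pointwise_smult[OF scalars_module f a] hom_pointwise_smult[OF scalars_module g a] by simp_all
  have "(\<lambda>x. a \<odot>\<^bsub>self_module k\<^esub> pairing k f g x) x = pairing k (\<lambda>v. a \<otimes>\<^bsub>k\<^esub> f v) g x"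
    by (rule tensor_lift_eqI[OF V W scalars_module product_bilinear[OF af g] a_hom _ x])
      (use hom_in[OF f] hom_in[OF g] a in \<open>simp add: pairing_pure[OF f g] V.R.m_assoc\<close>)
  then show "pairing k (\<lambda>v. a \<otimes>\<^bsub>k\<^esub> f v) g x = a \<otimes>\<^bsub>k\<^esub> pairing k f g x" by simp
  have "(\<lambda>x. a \<odot>\<^bsub>self_module k\<^esub> pairing k f g x) x = pairing k f (\<lambda>w. a \<otimes>\<^bsub>k\<^esub> g w) x"
    by (rule tensor_lift_eqI[OF V W scalars_module product_bilinear[OF f ag] a_hom _ x])
      (use hom_in[OF f] hom_in[OF g] a in \<open>simp add: pairing_pure[OF f g] V.R.m_lcomm\<close>)
  then show "pairing k f (\<lambda>w. a \<otimes>\<^bsub>k\<^esub> g w) x = a \<otimes>\<^bsub>k\<^esub> pairing k f g x" by simp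
qed

end

context
  fixes k :: "('k, 'r) ring_scheme" and U :: "('k, 'u, 'l) module_scheme"
    and V :: "('k, 'v, 'm) module_scheme" and W :: "('k, 'w, 'n) module_scheme"
  assumes U: "module k U" and V: "module k V" and W: "module k W"
begin

abbreviation (input) "UVW \<equiv> tensor k U (tensor k V W)"

lemma UVW_module: "module k UVW" by (rule tensor_module[OF U tensor_module[OF V W]])

interpretation T: module k UVW by (rule UVW_module)

lemma triple_bilinear:
  assumes w: "w \<in> carrier W"
  shows "bilinear_map k U V UVW (\<lambda>u v. pure_tensor k U (tensor k V W) u (pure_tensor k V W v w))"
  by (rule bilinear_compose[OF pure_bilinear[OF U tensor_module[OF V W]] hom_id
        bilinear_left[OF pure_bilinear[OF V W] w] hom_id])

text \<open>
  The associator is a lift of a lift. Linearity in the inner tensor is linearity of a lift; linearity in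
  \<open>w\<close> follows because a lift is determined by its values on pure tensors.
\<close>

lemma assoc_bilinear:
  "bilinear_map k (tensor k U V) W UVW (\<lambda>x w. tensor_lift k UVW
    (\<lambda>u v. pure_tensor k U (tensor k V W) u (pure_tensor k V W v w)) x)"
  unfolding bilinear_map_def
proof (intro conjI ballI)
  fix w assume "w \<in> carrier W"
  then show "(\<lambda>x. tensor_lift k UVW
      (\<lambda>u v. pure_tensor k U (tensor k V W) u (pure_tensor k V W v w)) x) \<in> module_hom k (tensor k U V) UVW"
    using tensor_lift_hom[OF U V UVW_module triple_bilinear] by simp
next
  note VW = tensor_module[OF V W]
  note hom = tensor_lift_hom[OF U V UVW_module triple_bilinear]
    and pure = tensor_lift_pure[OF U V UVW_module triple_bilinear]
  interpret W: module k W by (rule W)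
  interpret VW: module k "tensor k V W" by (rule VW)
  fix x assume x: "x \<in> carrier (tensor k U V)"
  show "(\<lambda>w. tensor_lift k UVW
      (\<lambda>u v. pure_tensor k U (tensor k V W) u (pure_tensor k V W v w)) x) \<in> module_hom k W UVW"
  proof (rule module_homI)
    fix w w' assume w: "w \<in> carrier W" "w' \<in> carrier W"
    show "tensor_lift k UVW (\<lambda>u v. pure_tensor k U (tensor k V W) u (pure_tensor k V W v (w \<oplus>\<^bsub>W\<^esub> w'))) x
      = tensor_lift k UVW (\<lambda>u v. pure_tensor k U (tensor k V W) u (pure_tensor k V W v w)) x
        \<oplus>\<^bsub>UVW\<^esub> tensor_lift k UVW (\<lambda>u v. pure_tensor k U (tensor k V W) u (pure_tensor k V W v w')) x"
      by (rule tensor_lift_eqI[OF U V UVW_module triple_bilinear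
            hom_pointwise_add[OF UVW_module hom[OF w(1)] hom[OF w(2)]] _ x, symmetric])
        (use w in \<open>simp_all add: pure module_hom_add[OF bilinear_right[OF pure_bilinear[OF V W]]]
          module_hom_add[OF bilinear_right[OF pure_bilinear[OF U VW]]] pure_closed[OF V W]\<close>)
  next
    fix a w assume aw: "a \<in> carrier k" "w \<in> carrier W"
    show "tensor_lift k UVW (\<lambda>u v. pure_tensor k U (tensor k V W) u (pure_tensor k V W v (a \<odot>\<^bsub>W\<^esub> w))) x
      = a \<odot>\<^bsub>UVW\<^esub> tensor_lift k UVW (\<lambda>u v. pure_tensor k U (tensor k V W) u (pure_tensor k V W v w)) x"
      by (rule tensor_lift_eqI[OF U V UVW_module triple_bilinear
            hom_pointwise_smult[OF UVW_module hom[OF aw(2)] aw(1)] _ x, symmetric])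
        (use aw in \<open>simp_all add: pure module_hom_smult[OF bilinear_right[OF pure_bilinear[OF V W]]]
          module_hom_smult[OF bilinear_right[OF pure_bilinear[OF U VW]]] pure_closed[OF V W]\<close>)
  qed (use hom_in[OF hom x] in simp)
qed

lemma tensor_assoc_hom:
  "tensor_assoc k U V W \<in> module_hom k (tensor k (tensor k U V) W) UVW"
  unfolding tensor_assoc_def Let_def
  by (rule tensor_lift_hom[OF tensor_module[OF U V] W UVW_module assoc_bilinear])

lemma pairing_tensor_assoc:
  assumes f: "f \<in> module_hom k U (self_module k)" and g: "g \<in> module_hom k V (self_module k)"
    and h: "h \<in> module_hom k W (self_module k)" and z: "z \<in> carrier (tensor k (tensor k U V) W)"
  shows "pairing k f (pairing k g h) (tensor_assoc k U V W z) = pairing k (pairing k f g) h z"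
proof -
  note UV = tensor_module[OF U V] and VW = tensor_module[OF V W]
  note S = self_module_module[OF T.R.cring_axioms] and fb = functional_bilinear[OF T.R.cring_axioms]
  note fg = pairing_hom[OF U V f g] and gh = pairing_hom[OF V W g h]
  note fgh = pairing_hom[OF U VW f gh]
  show ?thesis
  proof (rule tensor_lift_eqI[OF UV W S fb[OF fg h] hom_compose[OF tensor_assoc_hom fgh] _ z])
    fix y w assume y: "y \<in> carrier (tensor k U V)" and w: "w \<in> carrier W"
    have hw: "h w \<in> carrier k" using hom_in[OF h w] by simp
    have "pairing k f (pairing k g h) (tensor_assoc k U V W (pure_tensor k (tensor k U V) W y w)) =
      pairing k f (pairing k g h) (tensor_lift k UVW
        (\<lambda>u v. pure_tensor k U (tensor k V W) u (pure_tensor k V W v w)) y)"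
      unfolding tensor_assoc_def Let_def
      by (subst tensor_lift_pure[OF UV W UVW_module assoc_bilinear y w]) (rule refl)
    also have "\<dots> = tensor_lift k (self_module k) (\<lambda>u v. pairing k f (pairing k g h)
        (pure_tensor k U (tensor k V W) u (pure_tensor k V W v w))) y"
      by (rule hom_tensor_lift[OF triple_bilinear[OF w] U V UVW_module S fgh y])
    also have "\<dots> = h w \<otimes>\<^bsub>k\<^esub> pairing k f g y"
    proof (rule tensor_lift_eqI[OF U V S bilinear_compose[OF triple_bilinear[OF w] hom_id hom_id fgh]
          hom_pointwise_smult[OF S fg hw, simplified] _ y, symmetric])
      fix u v assume "u \<in> carrier U" "v \<in> carrier V"
      then show "h w \<otimes>\<^bsub>k\<^esub> pairing k f g (pure_tensor k U V u v) = pairing k f (pairing k g h)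
          (pure_tensor k U (tensor k V W) u (pure_tensor k V W v w))"
        using hom_in[OF f] hom_in[OF g] hw
        by (simp add: pairing_pure[OF U V f g] pairing_pure[OF U VW f gh] pairing_pure[OF V W g h]
            pure_closed[OF V W] w T.R.m_ac)
    qed
    also have "\<dots> = pairing k f g y \<otimes>\<^bsub>k\<^esub> h w"
      using hw hom_in[OF fg y] by (simp add: T.R.m_comm)
    finally show "pairing k f (pairing k g h)
        (tensor_assoc k U V W (pure_tensor k (tensor k U V) W y w)) = pairing k f g y \<otimes>\<^bsub>k\<^esub> h w" .
  qed
qed

end

section \<open>Dual spaces\<close>

lemma dual_carrier:
  "carrier (dual_algebra k C) = module_hom k C (self_module k) \<inter> extensional (carrier C)"
  by (simp add: dual_algebra_def)

lemma dual_algebra_simps [simp]: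
  "mult (dual_algebra k C) = (\<lambda>f g. \<lambda>c\<in>carrier C. pairing k f g (\<Delta>\<^bsub>C\<^esub> c))"
  "one (dual_algebra k C) = (\<lambda>c\<in>carrier C. \<epsilon>\<^bsub>C\<^esub> c)"
  "zero (dual_algebra k C) = (\<lambda>c\<in>carrier C. \<zero>\<^bsub>k\<^esub>)"
  "add (dual_algebra k C) = (\<lambda>f g. \<lambda>c\<in>carrier C. f c \<oplus>\<^bsub>k\<^esub> g c)"
  "smult (dual_algebra k C) = (\<lambda>a f. \<lambda>c\<in>carrier C. a \<otimes>\<^bsub>k\<^esub> f c)"
  by (simp_all add: dual_algebra_def)

context
  fixes k :: "('k, 'r) ring_scheme" and C :: "('k, 'c, 'm) coalgebra_scheme"
  assumes C: "vectorspace k C"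
begin

interpretation C: vectorspace k C by (rule C)

lemma self_mod: "module k (self_module k)" by (rule self_module_module[OF C.R.cring_axioms])

lemma dual_hom: "f \<in> carrier (dual_algebra k C) \<Longrightarrow> f \<in> module_hom k C (self_module k)"
  by (simp add: dual_carrier)

lemma dual_value: "f \<in> carrier (dual_algebra k C) \<Longrightarrow> c \<in> carrier C \<Longrightarrow> f c \<in> carrier k"
  using hom_in[OF dual_hom] by simp

lemma restrict_in_dual:
  assumes "f \<in> module_hom k C (self_module k)"
  shows "restrict f (carrier C) \<in> carrier (dual_algebra k C)"
proof -
  have "restrict f (carrier C) \<in> module_hom k C (self_module k)"
    by (rule hom_cong[OF assms _ C.module_axioms]) simp
  then show ?thesis by (simp add: dual_carrier)
qed

lemma dual_eqI:
  "f \<in> carrier (dual_algebra k C) \<Longrightarrow> g \<in> carrier (dual_algebra k C) \<Longrightarrow>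
    (\<And>c. c \<in> carrier C \<Longrightarrow> f c = g c) \<Longrightarrow> f = g"
  by (auto simp: dual_carrier intro: extensionalityI)

lemma dual_add_closed:
  assumes "f \<in> carrier (dual_algebra k C)" "g \<in> carrier (dual_algebra k C)"
  shows "f \<oplus>\<^bsub>dual_algebra k C\<^esub> g \<in> carrier (dual_algebra k C)"
  using restrict_in_dual[OF hom_pointwise_add[OF self_mod dual_hom[OF assms(1)] dual_hom[OF assms(2)]]]
  by simp

lemma dual_smult_closed:
  assumes "a \<in> carrier k" "f \<in> carrier (dual_algebra k C)"
  shows "a \<odot>\<^bsub>dual_algebra k C\<^esub> f \<in> carrier (dual_algebra k C)"
  using restrict_in_dual[OF hom_pointwise_smult[OF self_mod dual_hom[OF assms(2)] assms(1)]] by simp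

lemma zero_functional: "(\<lambda>_. \<zero>\<^bsub>k\<^esub>) \<in> module_hom k C (self_module k)"
  by (rule module_homI) simp_all

lemma dual_vectorspace: "vectorspace k (dual_algebra k C)"
proof -
  let ?D = "dual_algebra k C"
  note val = dual_value and add = dual_add_closed and smult = dual_smult_closed
  have zero: "\<zero>\<^bsub>?D\<^esub> \<in> carrier ?D" using restrict_in_dual[OF zero_functional] by simp
  have neg: "\<exists>g\<in>carrier ?D. f \<oplus>\<^bsub>?D\<^esub> g = \<zero>\<^bsub>?D\<^esub>" if f: "f \<in> carrier ?D" for f
  proof
    show "(\<ominus>\<^bsub>k\<^esub> \<one>\<^bsub>k\<^esub>) \<odot>\<^bsub>?D\<^esub> f \<in> carrier ?D" by (rule smult[OF _ f]) simp
    show "f \<oplus>\<^bsub>?D\<^esub> (\<ominus>\<^bsub>k\<^esub> \<one>\<^bsub>k\<^esub>) \<odot>\<^bsub>?D\<^esub> f = \<zero>\<^bsub>?D\<^esub>"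
      using val[OF f] by (auto intro!: restrict_ext simp: C.R.l_minus C.R.r_neg)
  qed
  have ext: "restrict g (carrier C) = f" if "f \<in> carrier ?D" "\<And>c. c \<in> carrier C \<Longrightarrow> g c = f c" for f g
    using that by (intro extensionalityI[of _ "carrier C"]) (auto simp: dual_carrier)
  show ?thesis
  proof (rule vs_criteria; (intro allI impI ballI)?; (elim conjE)?)
    show "field k" by unfold_locales
    show "v \<oplus>\<^bsub>?D\<^esub> \<zero>\<^bsub>?D\<^esub> = v" if "v \<in> carrier ?D" for v
      unfolding dual_algebra_simps by (rule ext[OF that]) (simp add: val[OF that])
    show "\<one>\<^bsub>k\<^esub> \<odot>\<^bsub>?D\<^esub> v = v" if "v \<in> carrier ?D" for v
      unfolding dual_algebra_simps by (rule ext[OF that]) (simp add: val[OF that])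
  qed (use zero neg add smult in \<open>auto simp: val C.R.a_ac C.R.m_assoc C.R.l_distr C.R.r_distr intro!: restrict_ext\<close>)
qed

lemma eval_hom: "c \<in> carrier C \<Longrightarrow> (\<lambda>f. f c) \<in> module_hom k (dual_algebra k C) (self_module k)"
  by (rule module_homI) (simp_all add: dual_value)

interpretation D: vectorspace k "dual_algebra k C" by (rule dual_vectorspace)

text \<open>
  The coordinate functionals of a frame span the dual space; the coefficients of \<open>f\<close> are its values on
  the frame vectors.
\<close>

lemma dual_frame:
  assumes B: "finite B" "B \<subseteq> carrier C"
    and e: "\<And>b. b \<in> B \<Longrightarrow> e b \<in> module_hom k C (self_module k)"
    and frame: "\<And>v. v \<in> carrier C \<Longrightarrow> v = (\<Oplus>\<^bsub>C\<^esub>b\<in>B. e b v \<odot>\<^bsub>C\<^esub> b)"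
    and f: "f \<in> carrier (dual_algebra k C)"
  shows "f = (\<Oplus>\<^bsub>dual_algebra k C\<^esub>b\<in>B. f b \<odot>\<^bsub>dual_algebra k C\<^esub> restrict (e b) (carrier C))"
proof (rule dual_eqI[OF f])
  let ?D = "dual_algebra k C"
  have b: "b \<in> carrier C" if "b \<in> B" for b using that B by blast
  have summand: "f b \<odot>\<^bsub>?D\<^esub> restrict (e b) (carrier C) \<in> carrier ?D" if "b \<in> B" for b
    using D.smult_closed[OF dual_value[OF f b[OF that]] restrict_in_dual[OF e[OF that]]] .
  then show "(\<Oplus>\<^bsub>?D\<^esub>b\<in>B. f b \<odot>\<^bsub>?D\<^esub> restrict (e b) (carrier C)) \<in> carrier ?D"
    by (intro D.finsum_closed) blast
  fix c assume c: "c \<in> carrier C"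
  have ec: "e b c \<in> carrier k" if "b \<in> B" for b using hom_in[OF e[OF that] c] by simp
  have "f c = (\<Oplus>\<^bsub>self_module k\<^esub>b\<in>B. f (e b c \<odot>\<^bsub>C\<^esub> b))"
    using hom_finsum[OF C.module_axioms self_mod dual_hom[OF f] B(1), of "\<lambda>b. e b c \<odot>\<^bsub>C\<^esub> b"]
      frame[OF c] ec b by auto
  also have "\<dots> = (\<Oplus>\<^bsub>self_module k\<^esub>b\<in>B. (f b \<odot>\<^bsub>?D\<^esub> restrict (e b) (carrier C)) c)"
    using ec b c dual_value[OF f] module_hom_smult[OF dual_hom[OF f]] C.R.m_comm
    by (intro abelian_monoid.finsum_cong'[OF abelian_group.axioms(1)[OF module.axioms(2)[OF self_mod]]]) auto
  also have "\<dots> = (\<Oplus>\<^bsub>?D\<^esub>b\<in>B. f b \<odot>\<^bsub>?D\<^esub> restrict (e b) (carrier C)) c"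
    by (rule hom_finsum[OF D.module_axioms self_mod eval_hom[OF c] B(1), symmetric]) (use summand in blast)
  finally show "f c = (\<Oplus>\<^bsub>?D\<^esub>b\<in>B. f b \<odot>\<^bsub>?D\<^esub> restrict (e b) (carrier C)) c" .
qed

context
  assumes fd: "vectorspace.fin_dim k C"
begin

lemma dual_fin_dim: "vectorspace.fin_dim k (dual_algebra k C)"
proof -
  let ?D = "dual_algebra k C"
  obtain B e where B: "finite B" "B \<subseteq> carrier C"
    "\<And>b. b \<in> B \<Longrightarrow> e b \<in> module_hom k C (self_module k)"
    "\<And>v. v \<in> carrier C \<Longrightarrow> v = (\<Oplus>\<^bsub>C\<^esub>b\<in>B. e b v \<odot>\<^bsub>C\<^esub> b)"
    by (rule C.frame[OF fd]) (rule that)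
  let ?E = "(\<lambda>b. restrict (e b) (carrier C)) ` B"
  have E: "?E \<subseteq> carrier ?D" using restrict_in_dual[OF B(3)] by blast
  have "f \<in> D.span ?E" if f: "f \<in> carrier ?D" for f
  proof -
    have "f b \<odot>\<^bsub>?D\<^esub> restrict (e b) (carrier C) \<in> D.span ?E" if b: "b \<in> B" for b
    proof -
      have "restrict (e b) (carrier C) \<in> D.span ?E" using D.in_own_span[OF E] b by blast
      moreover have "f b \<in> carrier k" using dual_value[OF f] b B(2) by blast
      ultimately show ?thesis
        using submodule.smult_closed[OF D.span_is_submodule[OF E]] by blast
    qed
    then have "(\<Oplus>\<^bsub>?D\<^esub>b\<in>B. f b \<odot>\<^bsub>?D\<^esub> restrict (e b) (carrier C)) \<in> D.span ?E"
      by (rule submodule_finsum[OF D.span_is_submodule[OF E] B(1)])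
    then show ?thesis using dual_frame[OF B f] by metis
  qed
  then have "D.span ?E = carrier ?D" using D.span_is_subset2[OF E] by blast
  then show ?thesis unfolding D.fin_dim_def using B(1) E by blast
qed

text \<open>
  A functional \<open>\<phi>\<close> on the dual space is evaluation at \<open>c = \<Sum> \<phi>(e b) b\<close>, as one sees by expanding the
  argument in the coordinate functionals.
\<close>

lemma double_dual:
  assumes \<phi>: "\<phi> \<in> module_hom k (dual_algebra k C) (self_module k)"
  shows "\<exists>c\<in>carrier C. \<forall>f\<in>carrier (dual_algebra k C). \<phi> f = f c"
proof -
  let ?D = "dual_algebra k C"
  obtain B e where B: "finite B" "B \<subseteq> carrier C"
    "\<And>b. b \<in> B \<Longrightarrow> e b \<in> module_hom k C (self_module k)"
    "\<And>v. v \<in> carrier C \<Longrightarrow> v = (\<Oplus>\<^bsub>C\<^esub>b\<in>B. e b v \<odot>\<^bsub>C\<^esub> b)"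
    by (rule C.frame[OF fd]) (rule that)
  have b: "b \<in> carrier C" if "b \<in> B" for b using that B by blast
  let ?e = "\<lambda>b. restrict (e b) (carrier C)"
  have eD: "?e b \<in> carrier ?D" if "b \<in> B" for b using restrict_in_dual[OF B(3)[OF that]] .
  have \<phi>e: "\<phi> (?e b) \<in> carrier k" if "b \<in> B" for b using hom_in[OF \<phi> eD[OF that]] by simp
  let ?c = "\<Oplus>\<^bsub>C\<^esub>b\<in>B. \<phi> (?e b) \<odot>\<^bsub>C\<^esub> b"
  have summand: "(\<lambda>b. \<phi> (?e b) \<odot>\<^bsub>C\<^esub> b) \<in> B \<rightarrow> carrier C" using \<phi>e b by blast
  have c: "?c \<in> carrier C" by (rule C.finsum_closed[OF summand])
  have "\<phi> f = f ?c" if f: "f \<in> carrier ?D" for f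
  proof -
    have fb: "f b \<in> carrier k" if "b \<in> B" for b using dual_value[OF f b[OF that]] .
    have "\<phi> f = \<phi> (\<Oplus>\<^bsub>?D\<^esub>b\<in>B. f b \<odot>\<^bsub>?D\<^esub> ?e b)" using dual_frame[OF B f] by simp
    also have "\<dots> = (\<Oplus>\<^bsub>self_module k\<^esub>b\<in>B. \<phi> (f b \<odot>\<^bsub>?D\<^esub> ?e b))"
      by (rule hom_finsum[OF D.module_axioms self_mod \<phi> B(1)]) (use D.smult_closed[OF fb eD] in blast)
    also have "\<dots> = (\<Oplus>\<^bsub>self_module k\<^esub>b\<in>B. f (\<phi> (?e b) \<odot>\<^bsub>C\<^esub> b))"
    proof (rule abelian_monoid.finsum_cong'[OF abelian_group.axioms(1)[OF module.axioms(2)[OF self_mod]]])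
      show "(\<lambda>b. f (\<phi> (?e b) \<odot>\<^bsub>C\<^esub> b)) \<in> B \<rightarrow> carrier (self_module k)"
        using hom_in[OF dual_hom[OF f]] \<phi>e b by blast
      fix b assume bB: "b \<in> B"
      show "\<phi> (f b \<odot>\<^bsub>?D\<^esub> ?e b) = f (\<phi> (?e b) \<odot>\<^bsub>C\<^esub> b)"
        unfolding module_hom_smult[OF \<phi> fb[OF bB] eD[OF bB]]
          module_hom_smult[OF dual_hom[OF f] \<phi>e[OF bB] b[OF bB]]
        using C.R.m_comm[OF fb[OF bB] \<phi>e[OF bB]] by simp
    qed simp
    also have "\<dots> = f ?c"
      by (rule hom_finsum[OF C.module_axioms self_mod dual_hom[OF f] B(1) summand, symmetric])
    finally show ?thesis .
  qed
  then show ?thesis using c by blast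
qed

lemma dual_separates:
  assumes "c \<in> carrier C" "c' \<in> carrier C" "\<And>f. f \<in> carrier (dual_algebra k C) \<Longrightarrow> f c = f c'"
  shows "c = c'"
  by (rule C.functionals_separate[OF fd assms(1,2)])
    (use assms restrict_in_dual in \<open>metis restrict_apply'\<close>)

lemma dual_separates_subspace:
  assumes "submodule k S C" "c \<in> carrier C" "c \<notin> S"
  obtains f where "f \<in> carrier (dual_algebra k C)" "\<And>s. s \<in> S \<Longrightarrow> f s = \<zero>\<^bsub>k\<^esub>" "f c \<noteq> \<zero>\<^bsub>k\<^esub>"
proof -
  obtain f where f: "f \<in> module_hom k C (self_module k)" "\<And>s. s \<in> S \<Longrightarrow> f s = \<zero>\<^bsub>k\<^esub>" "f c \<noteq> \<zero>\<^bsub>k\<^esub>"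
    by (rule C.separating_functional[OF fd assms]) (rule that)
  have "restrict f (carrier C) s = \<zero>\<^bsub>k\<^esub>" if "s \<in> S" for s
    using f(2)[OF that] that submodule.subset[OF assms(1)] by auto
  then show ?thesis using that[OF restrict_in_dual[OF f(1)]] f(3) assms(2) by simp
qed

text \<open>
  Separation by functionals on the dual space, which are evaluations at points.
\<close>

lemma predual_separates_subspace:
  assumes L: "submodule k L (dual_algebra k C)" and f: "f \<in> carrier (dual_algebra k C)" "f \<notin> L"
  obtains c where "c \<in> carrier C" "\<And>l. l \<in> L \<Longrightarrow> l c = \<zero>\<^bsub>k\<^esub>" "f c \<noteq> \<zero>\<^bsub>k\<^esub>"
proof -
  obtain \<phi> where \<phi>: "\<phi> \<in> module_hom k (dual_algebra k C) (self_module k)"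
    "\<And>l. l \<in> L \<Longrightarrow> \<phi> l = \<zero>\<^bsub>k\<^esub>" "\<phi> f \<noteq> \<zero>\<^bsub>k\<^esub>"
    by (rule D.separating_functional[OF dual_fin_dim L f]) (rule that)
  obtain c where c: "c \<in> carrier C" "\<And>g. g \<in> carrier (dual_algebra k C) \<Longrightarrow> \<phi> g = g c"
    using double_dual[OF \<phi>(1)] by blast
  have "l c = \<zero>\<^bsub>k\<^esub>" if "l \<in> L" for l
    using \<phi>(2)[OF that] c(2)[of l] submodule.subset[OF L] that by auto
  moreover have "f c \<noteq> \<zero>\<^bsub>k\<^esub>" using \<phi>(3) c(2)[OF f(1)] by simp
  ultimately show ?thesis using that c(1) by blast
qed

end

end

section \<open>The dual algebra of a finite-dimensional coalgebra\<close>

lemma pairing_separates: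
  assumes V: "vectorspace k V" "vectorspace.fin_dim k V" and W: "vectorspace k W" "vectorspace.fin_dim k W"
    and x: "x \<in> carrier (tensor k V W)" and y: "y \<in> carrier (tensor k V W)"
    and eq: "\<And>f g. f \<in> module_hom k V (self_module k) \<Longrightarrow> g \<in> module_hom k W (self_module k) \<Longrightarrow>
      pairing k f g x = pairing k f g y"
  shows "x = y"
proof -
  interpret W: vectorspace k W by fact
  show ?thesis
    by (rule tensor_separation[OF V W.module_axioms subset_refl W.functionals_separate[OF W(2)] x y eq])
qed

context
  fixes k :: "('k, 'r) ring_scheme" and C :: "('k, 'c, 'm) coalgebra_scheme"
  assumes C: "vectorspace k C" and comult: "\<Delta>\<^bsub>C\<^esub> \<in> module_hom k C (tensor k C C)"
begin

interpretation C: vectorspace k C by (rule C)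

lemmas C_module = C.module_axioms
lemmas CC_module = tensor_module[OF C.module_axioms C.module_axioms]

lemma convolution_hom:
  assumes "f \<in> module_hom k C (self_module k)" "g \<in> module_hom k C (self_module k)"
  shows "(\<lambda>c. pairing k f g (\<Delta>\<^bsub>C\<^esub> c)) \<in> module_hom k C (self_module k)"
  by (rule hom_compose[OF comult pairing_hom[OF C_module C_module assms]])

text \<open>
  Together with the next lemma this identifies coassociativity of \<open>\<Delta>\<close>, tested against \<open>f \<otimes> (g \<otimes> h)\<close>, with
  associativity of the convolution product.
\<close>

lemma pairing_comult_left:
  assumes f: "f \<in> module_hom k C (self_module k)" and g: "g \<in> module_hom k C (self_module k)"
    and h: "h \<in> module_hom k C (self_module k)" and x: "x \<in> carrier (tensor k C C)"
  shows "pairing k f (pairing k g h)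
      (tensor_assoc k C C C (tensor_map k (tensor k C C) C \<Delta>\<^bsub>C\<^esub> (\<lambda>v. v) x)) =
    pairing k (\<lambda>u. pairing k f g (\<Delta>\<^bsub>C\<^esub> u)) h x"
  unfolding pairing_tensor_assoc[OF C_module C_module C_module f g h hom_in[OF tensor_map_hom[OF CC_module C_module C_module C_module comult hom_id] x]]
  by (rule tensor_lift_map[OF CC_module C_module C_module C_module comult hom_id
        functional_bilinear[OF C.R.cring_axioms pairing_hom[OF C_module C_module f g] h]
        self_module_module[OF C.R.cring_axioms] x])

lemma pairing_comult_right:
  assumes f: "f \<in> module_hom k C (self_module k)" and g: "g \<in> module_hom k C (self_module k)"
    and h: "h \<in> module_hom k C (self_module k)" and x: "x \<in> carrier (tensor k C C)"
  shows "pairing k f (pairing k g h) (tensor_map k C (tensor k C C) (\<lambda>u. u) \<Delta>\<^bsub>C\<^esub> x) =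
    pairing k f (\<lambda>v. pairing k g h (\<Delta>\<^bsub>C\<^esub> v)) x"
  by (rule tensor_lift_map[OF C_module CC_module C_module C_module hom_id comult
        functional_bilinear[OF C.R.cring_axioms f pairing_hom[OF C_module C_module g h]]
        self_module_module[OF C.R.cring_axioms] x])

lemma functional_counit:
  assumes e: "e \<in> module_hom k C (self_module k)" and f: "f \<in> module_hom k C (self_module k)"
    and x: "x \<in> carrier (tensor k C C)"
  shows "f (tensor_lift k C (\<lambda>u v. e u \<odot>\<^bsub>C\<^esub> v) x) = pairing k e f x"
    and "f (tensor_lift k C (\<lambda>u v. e v \<odot>\<^bsub>C\<^esub> u) x) = pairing k f e x"
proof -
  note S = self_module_module[OF C.R.cring_axioms]
  note ec = hom_in[OF e, simplified] and fc = hom_in[OF f, simplified]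
  note l = scalar_bilinear_left[OF C_module e] and r = scalar_bilinear_right[OF C_module e]
  show "f (tensor_lift k C (\<lambda>u v. e u \<odot>\<^bsub>C\<^esub> v) x) = pairing k e f x"
    unfolding hom_tensor_lift[OF l C_module C_module C_module S f x]
    by (rule tensor_lift_cong[OF bilinear_compose[OF l hom_id hom_id f] C_module C_module S _ x])
      (simp add: module_hom_smult[OF f] ec)
  show "f (tensor_lift k C (\<lambda>u v. e v \<odot>\<^bsub>C\<^esub> u) x) = pairing k f e x"
    unfolding hom_tensor_lift[OF r C_module C_module C_module S f x]
    by (rule tensor_lift_cong[OF bilinear_compose[OF r hom_id hom_id f] C_module C_module S _ x])
      (simp add: module_hom_smult[OF f] ec fc C.R.m_comm)
qed

text \<open>
  The coalgebra axioms are equations between tensors or vectors, so they may be tested on functionals,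
  where they become associativity and the unit laws of the convolution product.
\<close>

lemma coalgebraI:
  assumes fd: "vectorspace.fin_dim k C" and counit: "\<epsilon>\<^bsub>C\<^esub> \<in> module_hom k C (self_module k)"
    and assoc: "\<And>f g h c. f \<in> module_hom k C (self_module k) \<Longrightarrow> g \<in> module_hom k C (self_module k) \<Longrightarrow>
      h \<in> module_hom k C (self_module k) \<Longrightarrow> c \<in> carrier C \<Longrightarrow>
      pairing k (\<lambda>u. pairing k f g (\<Delta>\<^bsub>C\<^esub> u)) h (\<Delta>\<^bsub>C\<^esub> c) =
      pairing k f (\<lambda>v. pairing k g h (\<Delta>\<^bsub>C\<^esub> v)) (\<Delta>\<^bsub>C\<^esub> c)"
    and unit: "\<And>f c. f \<in> module_hom k C (self_module k) \<Longrightarrow> c \<in> carrier C \<Longrightarrow>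
      pairing k \<epsilon>\<^bsub>C\<^esub> f (\<Delta>\<^bsub>C\<^esub> c) = f c"
      "\<And>f c. f \<in> module_hom k C (self_module k) \<Longrightarrow> c \<in> carrier C \<Longrightarrow>
      pairing k f \<epsilon>\<^bsub>C\<^esub> (\<Delta>\<^bsub>C\<^esub> c) = f c"
  shows "coalgebra k C"
proof (intro coalgebra.intro coalgebra_axioms.intro)
  fix c assume c: "c \<in> carrier C"
  note \<Delta>c = hom_in[OF comult c]
  note lift_closed = tensor_lift_closed[OF C_module C_module C_module]
  show "tensor_lift k C (\<lambda>u v. \<epsilon>\<^bsub>C\<^esub> u \<odot>\<^bsub>C\<^esub> v) (\<Delta>\<^bsub>C\<^esub> c) = c"
    by (rule C.functionals_separate[OF fd lift_closed[OF scalar_bilinear_left[OF C_module counit] \<Delta>c] c])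
      (simp add: functional_counit(1)[OF counit _ \<Delta>c] unit(1) c)
  show "tensor_lift k C (\<lambda>u v. \<epsilon>\<^bsub>C\<^esub> v \<odot>\<^bsub>C\<^esub> u) (\<Delta>\<^bsub>C\<^esub> c) = c"
    by (rule C.functionals_separate[OF fd lift_closed[OF scalar_bilinear_right[OF C_module counit] \<Delta>c] c])
      (simp add: functional_counit(2)[OF counit _ \<Delta>c] unit(2) c)
  let ?G = "{pairing k g h | g h. g \<in> module_hom k C (self_module k) \<and> h \<in> module_hom k C (self_module k)}"
  show "tensor_assoc k C C C (tensor_map k (tensor k C C) C \<Delta>\<^bsub>C\<^esub> (\<lambda>v. v) (\<Delta>\<^bsub>C\<^esub> c)) =
      tensor_map k C (tensor k C C) (\<lambda>u. u) \<Delta>\<^bsub>C\<^esub> (\<Delta>\<^bsub>C\<^esub> c)"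
  proof (rule tensor_separation[OF C fd CC_module, of ?G])
    show "?G \<subseteq> module_hom k (tensor k C C) (self_module k)" using pairing_hom[OF C_module C_module] by blast
    show "x = y" if "x \<in> carrier (tensor k C C)" "y \<in> carrier (tensor k C C)" "\<And>g. g \<in> ?G \<Longrightarrow> g x = g y"
      for x y
      by (rule pairing_separates[OF C fd C fd that(1,2)]) (rule that(3), blast)
    show "tensor_assoc k C C C (tensor_map k (tensor k C C) C \<Delta>\<^bsub>C\<^esub> (\<lambda>v. v) (\<Delta>\<^bsub>C\<^esub> c))
        \<in> carrier (tensor k C (tensor k C C))"
      by (rule hom_in[OF tensor_assoc_hom[OF C_module C_module C_module] hom_in[OF tensor_map_hom[OF CC_module C_module C_module C_module comult hom_id] \<Delta>c]])
    show "tensor_map k C (tensor k C C) (\<lambda>u. u) \<Delta>\<^bsub>C\<^esub> (\<Delta>\<^bsub>C\<^esub> c) \<in> carrier (tensor k C (tensor k C C))"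
      by (rule hom_in[OF tensor_map_hom[OF C_module CC_module C_module C_module hom_id comult] \<Delta>c])
    fix f gh assume f: "f \<in> module_hom k C (self_module k)" and "gh \<in> ?G"
    then obtain g h where gh: "gh = pairing k g h"
      "g \<in> module_hom k C (self_module k)" "h \<in> module_hom k C (self_module k)" by blast
    show "pairing k f gh (tensor_assoc k C C C (tensor_map k (tensor k C C) C \<Delta>\<^bsub>C\<^esub> (\<lambda>v. v) (\<Delta>\<^bsub>C\<^esub> c))) =
        pairing k f gh (tensor_map k C (tensor k C C) (\<lambda>u. u) \<Delta>\<^bsub>C\<^esub> (\<Delta>\<^bsub>C\<^esub> c))"
      unfolding gh(1) pairing_comult_left[OF f gh(2,3) \<Delta>c] pairing_comult_right[OF f gh(2,3) \<Delta>c]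
      by (rule assoc[OF f gh(2,3) c])
  qed
qed (rule C comult counit)+

end

locale fin_dim_coalgebra = coalgebra +
  assumes fin_dim: "vectorspace.fin_dim k C"
begin

abbreviation A where "A \<equiv> dual_algebra k C"

lemmas C_vs = vectorspace_axioms
lemmas C_mod = module_axioms
lemmas scalars_mod = self_module_module[OF R.cring_axioms]

lemma comult_closed: "c \<in> carrier C \<Longrightarrow> \<Delta>\<^bsub>C\<^esub> c \<in> carrier (tensor k C C)"
  by (rule hom_in[OF comult_linear])

lemma mult_value: "c \<in> carrier C \<Longrightarrow> (f \<otimes>\<^bsub>A\<^esub> g) c = pairing k f g (\<Delta>\<^bsub>C\<^esub> c)"
  by simp

lemma mult_closed:
  assumes "f \<in> carrier A" "g \<in> carrier A" shows "f \<otimes>\<^bsub>A\<^esub> g \<in> carrier A"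
  using restrict_in_dual[OF C_vs convolution_hom[OF C_vs comult_linear dual_hom[OF C_vs assms(1)] dual_hom[OF C_vs assms(2)]]]
  by simp

lemma one_closed: "\<one>\<^bsub>A\<^esub> \<in> carrier A"
  using restrict_in_dual[OF C_vs counit_linear] by simp

lemma mult_assoc:
  assumes f: "f \<in> carrier A" and g: "g \<in> carrier A" and h: "h \<in> carrier A"
  shows "f \<otimes>\<^bsub>A\<^esub> g \<otimes>\<^bsub>A\<^esub> h = f \<otimes>\<^bsub>A\<^esub> (g \<otimes>\<^bsub>A\<^esub> h)"
proof (rule dual_eqI[OF C_vs])
  note hom = dual_hom[OF C_vs]
  fix c assume c: "c \<in> carrier C"
  note \<Delta>c = comult_closed[OF c]
  have "(f \<otimes>\<^bsub>A\<^esub> g \<otimes>\<^bsub>A\<^esub> h) c = pairing k (\<lambda>u. pairing k f g (\<Delta>\<^bsub>C\<^esub> u)) h (\<Delta>\<^bsub>C\<^esub> c)"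
    unfolding mult_value[OF c]
    by (rule pairing_cong[OF C_mod C_mod hom[OF mult_closed[OF f g]] hom[OF h] _ _ \<Delta>c]) simp_all
  also have "\<dots> = pairing k f (\<lambda>v. pairing k g h (\<Delta>\<^bsub>C\<^esub> v)) (\<Delta>\<^bsub>C\<^esub> c)"
    using pairing_comult_left[OF C_vs comult_linear hom[OF f] hom[OF g] hom[OF h] \<Delta>c]
      pairing_comult_right[OF C_vs comult_linear hom[OF f] hom[OF g] hom[OF h] \<Delta>c] coassoc[OF c] by simp
  also have "\<dots> = (f \<otimes>\<^bsub>A\<^esub> (g \<otimes>\<^bsub>A\<^esub> h)) c"
    unfolding mult_value[OF c]
    by (rule pairing_cong[OF C_mod C_mod hom[OF f] hom[OF mult_closed[OF g h]] _ _ \<Delta>c, symmetric]) simp_all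
  finally show "(f \<otimes>\<^bsub>A\<^esub> g \<otimes>\<^bsub>A\<^esub> h) c = (f \<otimes>\<^bsub>A\<^esub> (g \<otimes>\<^bsub>A\<^esub> h)) c" .
qed (intro mult_closed f g h)+

lemma mult_one:
  assumes f: "f \<in> carrier A"
  shows "\<one>\<^bsub>A\<^esub> \<otimes>\<^bsub>A\<^esub> f = f" "f \<otimes>\<^bsub>A\<^esub> \<one>\<^bsub>A\<^esub> = f"
proof -
  note hom = dual_hom[OF C_vs]
  have eq: "(\<one>\<^bsub>A\<^esub> \<otimes>\<^bsub>A\<^esub> f) c = f c" "(f \<otimes>\<^bsub>A\<^esub> \<one>\<^bsub>A\<^esub>) c = f c" if c: "c \<in> carrier C" for c
  proof -
    note \<Delta>c = comult_closed[OF c]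
    have "(\<one>\<^bsub>A\<^esub> \<otimes>\<^bsub>A\<^esub> f) c = pairing k \<epsilon>\<^bsub>C\<^esub> f (\<Delta>\<^bsub>C\<^esub> c)"
      unfolding mult_value[OF c]
      by (rule pairing_cong[OF C_mod C_mod hom[OF one_closed] hom[OF f] _ _ \<Delta>c]) simp_all
    then show "(\<one>\<^bsub>A\<^esub> \<otimes>\<^bsub>A\<^esub> f) c = f c"
      using functional_counit(1)[OF C_vs comult_linear counit_linear hom[OF f] \<Delta>c] counit_left[OF c] by simp
    have "(f \<otimes>\<^bsub>A\<^esub> \<one>\<^bsub>A\<^esub>) c = pairing k f \<epsilon>\<^bsub>C\<^esub> (\<Delta>\<^bsub>C\<^esub> c)"
      unfolding mult_value[OF c]
      by (rule pairing_cong[OF C_mod C_mod hom[OF f] hom[OF one_closed] _ _ \<Delta>c]) simp_all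
    then show "(f \<otimes>\<^bsub>A\<^esub> \<one>\<^bsub>A\<^esub>) c = f c"
      using functional_counit(2)[OF C_vs comult_linear counit_linear hom[OF f] \<Delta>c] counit_right[OF c] by simp
  qed
  show "\<one>\<^bsub>A\<^esub> \<otimes>\<^bsub>A\<^esub> f = f" by (rule dual_eqI[OF C_vs mult_closed[OF one_closed f] f eq(1)])
  show "f \<otimes>\<^bsub>A\<^esub> \<one>\<^bsub>A\<^esub> = f" by (rule dual_eqI[OF C_vs mult_closed[OF f one_closed] f eq(2)])
qed

lemma mult_bilinear:
  assumes f: "f \<in> carrier A" and g: "g \<in> carrier A" and h: "h \<in> carrier A" and a: "a \<in> carrier k"
  shows "(f \<oplus>\<^bsub>A\<^esub> g) \<otimes>\<^bsub>A\<^esub> h = f \<otimes>\<^bsub>A\<^esub> h \<oplus>\<^bsub>A\<^esub> g \<otimes>\<^bsub>A\<^esub> h"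
    and "h \<otimes>\<^bsub>A\<^esub> (f \<oplus>\<^bsub>A\<^esub> g) = h \<otimes>\<^bsub>A\<^esub> f \<oplus>\<^bsub>A\<^esub> h \<otimes>\<^bsub>A\<^esub> g"
    and "(a \<odot>\<^bsub>A\<^esub> f) \<otimes>\<^bsub>A\<^esub> g = a \<odot>\<^bsub>A\<^esub> (f \<otimes>\<^bsub>A\<^esub> g)"
    and "f \<otimes>\<^bsub>A\<^esub> (a \<odot>\<^bsub>A\<^esub> g) = a \<odot>\<^bsub>A\<^esub> (f \<otimes>\<^bsub>A\<^esub> g)"
proof -
  note hom = dual_hom[OF C_vs]
  note closed = mult_closed dual_add_closed[OF C_vs] dual_smult_closed[OF C_vs]
  note cong = pairing_cong[OF C_mod C_mod]
  show "(f \<oplus>\<^bsub>A\<^esub> g) \<otimes>\<^bsub>A\<^esub> h = f \<otimes>\<^bsub>A\<^esub> h \<oplus>\<^bsub>A\<^esub> g \<otimes>\<^bsub>A\<^esub> h"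
  proof (rule dual_eqI[OF C_vs])
    fix c assume c: "c \<in> carrier C"
    note \<Delta>c = comult_closed[OF c]
    have "((f \<oplus>\<^bsub>A\<^esub> g) \<otimes>\<^bsub>A\<^esub> h) c = pairing k (\<lambda>c. f c \<oplus>\<^bsub>k\<^esub> g c) h (\<Delta>\<^bsub>C\<^esub> c)"
      unfolding mult_value[OF c] by (rule cong[OF hom hom _ _ \<Delta>c]) (intro closed f g h | simp)+
    then show "((f \<oplus>\<^bsub>A\<^esub> g) \<otimes>\<^bsub>A\<^esub> h) c = (f \<otimes>\<^bsub>A\<^esub> h \<oplus>\<^bsub>A\<^esub> g \<otimes>\<^bsub>A\<^esub> h) c"
      using pairing_add_left[OF C_mod C_mod hom[OF f] hom[OF g] hom[OF h] \<Delta>c] c by simp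
  qed (intro closed f g h)+
  show "h \<otimes>\<^bsub>A\<^esub> (f \<oplus>\<^bsub>A\<^esub> g) = h \<otimes>\<^bsub>A\<^esub> f \<oplus>\<^bsub>A\<^esub> h \<otimes>\<^bsub>A\<^esub> g"
  proof (rule dual_eqI[OF C_vs])
    fix c assume c: "c \<in> carrier C"
    note \<Delta>c = comult_closed[OF c]
    have "(h \<otimes>\<^bsub>A\<^esub> (f \<oplus>\<^bsub>A\<^esub> g)) c = pairing k h (\<lambda>c. f c \<oplus>\<^bsub>k\<^esub> g c) (\<Delta>\<^bsub>C\<^esub> c)"
      unfolding mult_value[OF c] by (rule cong[OF hom hom _ _ \<Delta>c]) (intro closed f g h | simp)+
    then show "(h \<otimes>\<^bsub>A\<^esub> (f \<oplus>\<^bsub>A\<^esub> g)) c = (h \<otimes>\<^bsub>A\<^esub> f \<oplus>\<^bsub>A\<^esub> h \<otimes>\<^bsub>A\<^esub> g) c"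
      using pairing_add_right[OF C_mod C_mod hom[OF h] hom[OF f] hom[OF g] \<Delta>c] c by simp
  qed (intro closed f g h)+
  show "(a \<odot>\<^bsub>A\<^esub> f) \<otimes>\<^bsub>A\<^esub> g = a \<odot>\<^bsub>A\<^esub> (f \<otimes>\<^bsub>A\<^esub> g)"
  proof (rule dual_eqI[OF C_vs])
    fix c assume c: "c \<in> carrier C"
    note \<Delta>c = comult_closed[OF c]
    have "((a \<odot>\<^bsub>A\<^esub> f) \<otimes>\<^bsub>A\<^esub> g) c = pairing k (\<lambda>c. a \<otimes>\<^bsub>k\<^esub> f c) g (\<Delta>\<^bsub>C\<^esub> c)"
      unfolding mult_value[OF c] by (rule cong[OF hom hom _ _ \<Delta>c]) (intro closed f g a | simp)+
    then show "((a \<odot>\<^bsub>A\<^esub> f) \<otimes>\<^bsub>A\<^esub> g) c = (a \<odot>\<^bsub>A\<^esub> (f \<otimes>\<^bsub>A\<^esub> g)) c"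
      using pairing_smult(1)[OF C_mod C_mod hom[OF f] hom[OF g] a \<Delta>c] c by simp
  qed (intro closed f g a)+
  show "f \<otimes>\<^bsub>A\<^esub> (a \<odot>\<^bsub>A\<^esub> g) = a \<odot>\<^bsub>A\<^esub> (f \<otimes>\<^bsub>A\<^esub> g)"
  proof (rule dual_eqI[OF C_vs])
    fix c assume c: "c \<in> carrier C"
    note \<Delta>c = comult_closed[OF c]
    have "(f \<otimes>\<^bsub>A\<^esub> (a \<odot>\<^bsub>A\<^esub> g)) c = pairing k f (\<lambda>c. a \<otimes>\<^bsub>k\<^esub> g c) (\<Delta>\<^bsub>C\<^esub> c)"
      unfolding mult_value[OF c] by (rule cong[OF hom hom _ _ \<Delta>c]) (intro closed f g a | simp)+
    then show "(f \<otimes>\<^bsub>A\<^esub> (a \<odot>\<^bsub>A\<^esub> g)) c = (a \<odot>\<^bsub>A\<^esub> (f \<otimes>\<^bsub>A\<^esub> g)) c"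
      using pairing_smult(2)[OF C_mod C_mod hom[OF f] hom[OF g] a \<Delta>c] c by simp
  qed (intro closed f g a)+
qed

lemma dual_is_algebra: "fin_dim_algebra k A"
proof -
  interpret D: vectorspace k A by (rule dual_vectorspace[OF C_vs])
  have one: "\<one>\<^bsub>k\<^esub> \<in> carrier k" by simp
  have "ring A"
  proof (rule ringI)
    show "abelian_group A" by (rule D.abelian_group_axioms)
    show "monoid A" by (rule monoidI) (fact mult_closed one_closed mult_assoc mult_one)+
    show "(x \<oplus>\<^bsub>A\<^esub> y) \<otimes>\<^bsub>A\<^esub> z = x \<otimes>\<^bsub>A\<^esub> z \<oplus>\<^bsub>A\<^esub> y \<otimes>\<^bsub>A\<^esub> z"
      if "x \<in> carrier A" "y \<in> carrier A" "z \<in> carrier A" for x y z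
      by (rule mult_bilinear(1)[OF that one])
    show "z \<otimes>\<^bsub>A\<^esub> (x \<oplus>\<^bsub>A\<^esub> y) = z \<otimes>\<^bsub>A\<^esub> x \<oplus>\<^bsub>A\<^esub> z \<otimes>\<^bsub>A\<^esub> y"
      if "x \<in> carrier A" "y \<in> carrier A" "z \<in> carrier A" for x y z
      by (rule mult_bilinear(2)[OF that one])
  qed
  moreover have "vectorspace k A" "vectorspace.fin_dim k A"
    by (rule D.vectorspace_axioms, rule dual_fin_dim[OF C_vs fin_dim])
  ultimately show ?thesis
    using mult_bilinear(3)[of _ _ "\<one>\<^bsub>A\<^esub>"] mult_bilinear(4)[of _ _ "\<one>\<^bsub>A\<^esub>"] one_closed
    by (simp add: fin_dim_algebra_def fin_dim_algebra_axioms_def assoc_algebra_def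
        assoc_algebra_axioms_def del: dual_algebra_simps)
qed

text \<open>
  The action of the dual algebra on \<open>C\<close> is adjoint to right multiplication.
\<close>

lemma functional_action:
  assumes f: "f \<in> carrier A" and g: "g \<in> carrier A" and c: "c \<in> carrier C"
  shows "g (dual_action k C f c) = (g \<otimes>\<^bsub>A\<^esub> f) c"
  unfolding dual_action_def mult_value[OF c]
  by (rule functional_counit(2)[OF C_vs comult_linear dual_hom[OF C_vs f] dual_hom[OF C_vs g] comult_closed[OF c]])

lemma action_closed:
  assumes f: "f \<in> carrier A" and c: "c \<in> carrier C"
  shows "dual_action k C f c \<in> carrier C"
  unfolding dual_action_def
  by (rule tensor_lift_closed[OF C_mod C_mod C_mod scalar_bilinear_right[OF C_mod dual_hom[OF C_vs f]] comult_closed[OF c]])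

text \<open>
  If \<open>\<Delta> c\<close> lies in \<open>I \<otimes> C\<close>, then so do its contractions \<open>f \<cdot> c\<close> in \<open>I\<close>. Conversely the slices of \<open>\<Delta> c\<close> with
  respect to a frame are of the form \<open>f \<cdot> c\<close>.
\<close>

lemma right_coideal_iff: "right_coideal k C I \<longleftrightarrow> dual_submodule k C I"
proof -
  have "(\<Delta>\<^bsub>C\<^esub> ` I \<subseteq> tensor_map k C C (\<lambda>u. u) (\<lambda>v. v) ` carrier (tensor k (C\<lparr>carrier := I\<rparr>) C)) \<longleftrightarrow>
      (\<forall>f\<in>carrier A. \<forall>c\<in>I. dual_action k C f c \<in> I)" if I: "submodule k I C"
  proof -
    let ?I = "C\<lparr>carrier := I\<rparr>"
    interpret I: submodule k I C by (rule I)
    have I_mod: "module k ?I" by (rule submodule_is_module[OF I])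
    have incl: "(\<lambda>u. u) \<in> module_hom k ?I C"
      using I.subset by (intro module_homI) auto
    note map = tensor_map_hom[OF C_mod C_mod I_mod C_mod incl hom_id]
    show ?thesis
    proof (intro iffI ballI subsetI; (elim imageE)?)
      fix f c assume \<Delta>I: "\<Delta>\<^bsub>C\<^esub> ` I \<subseteq> tensor_map k C C (\<lambda>u. u) (\<lambda>v. v) ` carrier (tensor k ?I C)"
        and f: "f \<in> carrier A" and c: "c \<in> I"
      obtain y where y: "y \<in> carrier (tensor k ?I C)" "\<Delta>\<^bsub>C\<^esub> c = tensor_map k C C (\<lambda>u. u) (\<lambda>v. v) y"
        using \<Delta>I c by blast
      note bil = scalar_bilinear_right[OF C_mod dual_hom[OF C_vs f]]
        and bilI = scalar_bilinear_right[OF I_mod dual_hom[OF C_vs f]]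
      have "dual_action k C f c = tensor_lift k C (\<lambda>u v. f v \<odot>\<^bsub>C\<^esub> u) y"
        unfolding dual_action_def y(2)
        by (rule tensor_lift_map[OF C_mod C_mod I_mod C_mod incl hom_id bil C_mod y(1)])
      also have "\<dots> = tensor_lift k ?I (\<lambda>u v. f v \<odot>\<^bsub>?I\<^esub> u) y"
        using hom_tensor_lift[OF bilI I_mod C_mod I_mod C_mod incl y(1)] by simp
      also have "\<dots> \<in> I"
        using tensor_lift_closed[OF I_mod C_mod I_mod bilI y(1)] by simp
      finally show "dual_action k C f c \<in> I" .
    next
      fix x c assume act: "\<forall>f\<in>carrier A. \<forall>c\<in>I. dual_action k C f c \<in> I"
        and x: "x = \<Delta>\<^bsub>C\<^esub> c" and c: "c \<in> I"
      have cC: "c \<in> carrier C" using c I.subset by blast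
      note \<Delta>c = comult_closed[OF cC]
      obtain B e where B: "finite B" "B \<subseteq> carrier C"
        "\<And>b. b \<in> B \<Longrightarrow> e b \<in> module_hom k C (self_module k)"
        "\<And>v. v \<in> carrier C \<Longrightarrow> v = (\<Oplus>\<^bsub>C\<^esub>b\<in>B. e b v \<odot>\<^bsub>C\<^esub> b)"
        by (rule frame[OF fin_dim]) (rule that)
      have b: "b \<in> carrier C" if "b \<in> B" for b using that B by blast
      let ?s = "\<lambda>b. tensor_lift k C (\<lambda>u v. e b v \<odot>\<^bsub>C\<^esub> u) (\<Delta>\<^bsub>C\<^esub> c)"
      have s: "?s b \<in> I" if "b \<in> B" for b
      proof -
        have "?s b = dual_action k C (restrict (e b) (carrier C)) c"
          unfolding dual_action_def
          by (rule tensor_lift_cong[OF scalar_bilinear_right[OF C_mod B(3)[OF that]] C_mod C_mod C_mod _ \<Delta>c]) simp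
        then show ?thesis using act c restrict_in_dual[OF C_vs B(3)[OF that]] by simp
      qed
      interpret IT: module k "tensor k ?I C" by (rule tensor_module[OF I_mod C_mod])
      let ?y = "\<Oplus>\<^bsub>tensor k ?I C\<^esub>b\<in>B. pure_tensor k ?I C (?s b) b"
      have pure: "(\<lambda>b. pure_tensor k ?I C (?s b) b) \<in> B \<rightarrow> carrier (tensor k ?I C)"
        using s b by (auto intro!: pure_closed[OF I_mod C_mod])
      have "\<Delta>\<^bsub>C\<^esub> c = (\<Oplus>\<^bsub>tensor k C C\<^esub>b\<in>B. pure_tensor k C C (?s b) b)"
        by (rule slice_right[OF C_mod C_mod B \<Delta>c])
      also have "\<dots> = (\<Oplus>\<^bsub>tensor k C C\<^esub>b\<in>B.
          tensor_map k C C (\<lambda>u. u) (\<lambda>v. v) (pure_tensor k ?I C (?s b) b))"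
      proof (rule abelian_monoid.finsum_cong'[OF abelian_group.axioms(1)[OF module.axioms(2)[OF tensor_module[OF C_mod C_mod]]]])
        show "(\<lambda>b. tensor_map k C C (\<lambda>u. u) (\<lambda>v. v) (pure_tensor k ?I C (?s b) b))
            \<in> B \<rightarrow> carrier (tensor k C C)"
          using hom_in[OF map] pure by blast
        fix b' assume b': "b' \<in> B"
        show "pure_tensor k C C (?s b') b' =
            tensor_map k C C (\<lambda>u. u) (\<lambda>v. v) (pure_tensor k ?I C (?s b') b')"
          using tensor_map_pure[OF C_mod C_mod I_mod C_mod incl hom_id] s[OF b'] b[OF b'] by simp
      qed simp
      also have "\<dots> = tensor_map k C C (\<lambda>u. u) (\<lambda>v. v) ?y"
        by (rule hom_finsum[OF IT.module_axioms tensor_module[OF C_mod C_mod] map B(1) pure, symmetric])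
      finally show "x \<in> tensor_map k C C (\<lambda>u. u) (\<lambda>v. v) ` carrier (tensor k ?I C)"
        using x IT.finsum_closed[OF pure] by blast
    qed
  qed
  then show ?thesis unfolding right_coideal_def dual_submodule_def by blast
qed

end

section \<open>Right coideals, right ideals and the coradical\<close>

text \<open>
  From here on the algebra structure of the dual is used abstractly, and its operations should not be
  unfolded by default.
\<close>

declare dual_algebra_simps [simp del]

lemma (in fin_dim_algebra) right_ideal_submodule:
  assumes R: "right_ideal R A" shows "submodule k R A"
proof (rule submodule.intro)
  have sub: "additive_subgroup R A" using R by (simp add: right_ideal_def)
  interpret sub: additive_subgroup R A by (rule sub)
  show "module k A" by (rule module_axioms)
  show "R \<subseteq> carrier A" using sub.a_Hcarr by blast
  show "v \<oplus>\<^bsub>A\<^esub> w \<in> R" if "v \<in> R" "w \<in> R" for v w using that by (rule sub.a_closed)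
  show "\<zero>\<^bsub>A\<^esub> \<in> R" by (rule sub.zero_closed)
  show "c \<odot>\<^bsub>A\<^esub> v \<in> R" if "c \<in> carrier k" "v \<in> R" for c v
  proof -
    have "v \<otimes>\<^bsub>A\<^esub> (c \<odot>\<^bsub>A\<^esub> \<one>\<^bsub>A\<^esub>) = c \<odot>\<^bsub>A\<^esub> v"
      using that sub.a_Hcarr by (simp add: smult_mult_right)
    then show ?thesis using R that unfolding right_ideal_def by (metis A.one_closed smult_closed)
  qed
qed

lemma (in fin_dim_algebra) right_ideal_unit:
  assumes "right_ideal R A" "u \<in> R" "u \<in> Units A" shows "R = carrier A"
  using fin_dim_algebra.left_ideal_unit[OF opposite_algebra, of R u] assms by (simp add: left_ideal_opposite)

lemma (in fin_dim_algebra) nonunits_right_ideal: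
  assumes "uniformizer A x" "\<one>\<^bsub>A\<^esub> \<noteq> \<zero>\<^bsub>A\<^esub>" shows "right_ideal (carrier A - Units A) A"
  using fin_dim_algebra.nonunits_left_ideal[OF opposite_algebra] assms
  by (simp add: left_ideal_opposite uniformizer_opposite)

context fin_dim_coalgebra
begin

interpretation D: fin_dim_algebra k A by (rule dual_is_algebra)

definition annihilator :: "'c set \<Rightarrow> ('c \<Rightarrow> 'a) set"
  where "annihilator S = {f \<in> carrier A. \<forall>c\<in>S. f c = \<zero>\<^bsub>k\<^esub>}"

definition zeros :: "('c \<Rightarrow> 'a) set \<Rightarrow> 'c set"
  where "zeros L = {c \<in> carrier C. \<forall>f\<in>L. f c = \<zero>\<^bsub>k\<^esub>}"

lemma annihilator_antimono: "S \<subseteq> T \<Longrightarrow> annihilator T \<subseteq> annihilator S"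
  and zeros_antimono: "L \<subseteq> L' \<Longrightarrow> zeros L' \<subseteq> zeros L"
  by (auto simp: annihilator_def zeros_def)

lemma zeros_submodule:
  assumes "L \<subseteq> carrier A" shows "submodule k (zeros L) C"
proof (rule submodule.intro)
  have hom: "f \<in> module_hom k C (self_module k)" if "f \<in> L" for f
    using dual_hom[OF C_vs] assms that by blast
  show "\<zero>\<^bsub>C\<^esub> \<in> zeros L" using hom_zero[OF C_mod scalars_mod hom] by (auto simp: zeros_def)
  have zerosD: "c \<in> carrier C" "f \<in> L \<Longrightarrow> f c = \<zero>\<^bsub>k\<^esub>" if "c \<in> zeros L" for c f
    using that unfolding zeros_def by blast+
  show "c \<oplus>\<^bsub>C\<^esub> d \<in> zeros L" if c: "c \<in> zeros L" and d: "d \<in> zeros L" for c d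
  proof -
    have "f (c \<oplus>\<^bsub>C\<^esub> d) = \<zero>\<^bsub>k\<^esub>" if f: "f \<in> L" for f
      unfolding module_hom_add[OF hom[OF f] zerosD(1)[OF c] zerosD(1)[OF d]]
        zerosD(2)[OF c f] zerosD(2)[OF d f] by simp
    then show ?thesis using zerosD(1) c d unfolding zeros_def by blast
  qed
  show "a \<odot>\<^bsub>C\<^esub> c \<in> zeros L" if a: "a \<in> carrier k" and c: "c \<in> zeros L" for a c
  proof -
    have "f (a \<odot>\<^bsub>C\<^esub> c) = \<zero>\<^bsub>k\<^esub>" if f: "f \<in> L" for f
      unfolding module_hom_smult[OF hom[OF f] a zerosD(1)[OF c]] zerosD(2)[OF c f] using a by simp
    then show ?thesis using zerosD(1) a c unfolding zeros_def by blast
  qed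
qed (auto simp: zeros_def intro: C_mod)

lemma annihilator_submodule:
  assumes "S \<subseteq> carrier C" shows "submodule k (annihilator S) A"
proof (rule submodule.intro)
  show "\<zero>\<^bsub>A\<^esub> \<in> annihilator S"
    using assms D.M.zero_closed by (auto simp: annihilator_def dual_algebra_simps)
  show "f \<oplus>\<^bsub>A\<^esub> g \<in> annihilator S" if "f \<in> annihilator S" "g \<in> annihilator S" for f g
    using that assms D.M.a_closed[of f g] by (auto simp: annihilator_def dual_algebra_simps)
  show "a \<odot>\<^bsub>A\<^esub> f \<in> annihilator S" if "a \<in> carrier k" "f \<in> annihilator S" for a f
    using that assms D.smult_closed[of a f] by (auto simp: annihilator_def dual_algebra_simps)
qed (auto simp: annihilator_def intro: D.module_axioms)

lemma zeros_annihilator: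
  assumes S: "submodule k S C" shows "zeros (annihilator S) = S"
proof
  show "S \<subseteq> zeros (annihilator S)"
    using submodule.subset[OF S] by (auto simp: zeros_def annihilator_def)
  show "zeros (annihilator S) \<subseteq> S"
  proof
    fix c assume c: "c \<in> zeros (annihilator S)"
    show "c \<in> S"
    proof (rule ccontr)
      assume "c \<notin> S"
      moreover have "c \<in> carrier C" using c by (simp add: zeros_def)
      ultimately obtain f where "f \<in> carrier A" "\<And>s. s \<in> S \<Longrightarrow> f s = \<zero>\<^bsub>k\<^esub>" "f c \<noteq> \<zero>\<^bsub>k\<^esub>"
        using dual_separates_subspace[OF C_vs fin_dim S] by blast
      then show False using c by (auto simp: zeros_def annihilator_def)
    qed
  qed
qed

lemma annihilator_zeros:
  assumes L: "submodule k L A" shows "annihilator (zeros L) = L"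
proof
  show "L \<subseteq> annihilator (zeros L)"
    using submodule.subset[OF L] by (auto simp: zeros_def annihilator_def)
  show "annihilator (zeros L) \<subseteq> L"
  proof
    fix f assume f: "f \<in> annihilator (zeros L)"
    show "f \<in> L"
    proof (rule ccontr)
      assume "f \<notin> L"
      moreover have "f \<in> carrier A" using f by (simp add: annihilator_def)
      ultimately obtain c where "c \<in> carrier C" "\<And>l. l \<in> L \<Longrightarrow> l c = \<zero>\<^bsub>k\<^esub>" "f c \<noteq> \<zero>\<^bsub>k\<^esub>"
        using predual_separates_subspace[OF C_vs fin_dim L] by blast
      then show False using f by (auto simp: zeros_def annihilator_def)
    qed
  qed
qed

lemma annihilator_right_ideal:
  assumes S: "dual_submodule k C S" shows "right_ideal (annihilator S) A"
  unfolding right_ideal_def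
proof (intro conjI ballI)
  have sub: "S \<subseteq> carrier C" using S submodule.subset by (auto simp: dual_submodule_def)
  show "additive_subgroup (annihilator S) A"
    by (rule D.submodule_additive_subgroup[OF annihilator_submodule[OF sub]])
  fix g f assume g: "g \<in> carrier A" and f: "f \<in> annihilator S"
  have fA: "f \<in> carrier A" using f by (simp add: annihilator_def)
  have "(f \<otimes>\<^bsub>A\<^esub> g) c = \<zero>\<^bsub>k\<^esub>" if c: "c \<in> S" for c
  proof -
    have "dual_action k C g c \<in> S" using S g c by (simp add: dual_submodule_def)
    then show ?thesis
      using functional_action[OF g fA, of c] f c sub by (auto simp: annihilator_def)
  qed
  then show "f \<otimes>\<^bsub>A\<^esub> g \<in> annihilator S" using mult_closed[OF fA g] by (simp add: annihilator_def)
qed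

lemma zeros_dual_submodule:
  assumes R: "right_ideal R A" shows "dual_submodule k C (zeros R)"
  unfolding dual_submodule_def
proof (intro conjI ballI)
  have sub: "R \<subseteq> carrier A" by (rule submodule.subset[OF D.right_ideal_submodule[OF R]])
  show "submodule k (zeros R) C" by (rule zeros_submodule[OF sub])
  fix g c assume g: "g \<in> carrier A" and c: "c \<in> zeros R"
  have cC: "c \<in> carrier C" using c by (simp add: zeros_def)
  have "f (dual_action k C g c) = \<zero>\<^bsub>k\<^esub>" if f: "f \<in> R" for f
  proof -
    have "f \<otimes>\<^bsub>A\<^esub> g \<in> R" using R f g by (simp add: right_ideal_def)
    then show ?thesis using functional_action[OF g _ cC, of f] f sub c by (auto simp: zeros_def)
  qed
  then show "dual_action k C g c \<in> zeros R" using action_closed[OF g cC] by (simp add: zeros_def)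
qed

text \<open>
  Annihilators and zero sets are mutually inverse and reverse inclusions.
\<close>

lemma chain_coalgebra_iff:
  "chain_coalgebra k C \<longleftrightarrow> (\<forall>I J. right_ideal I A \<longrightarrow> right_ideal J A \<longrightarrow> I \<subseteq> J \<or> J \<subseteq> I)"
proof
  assume ch: "chain_coalgebra k C"
  show "\<forall>I J. right_ideal I A \<longrightarrow> right_ideal J A \<longrightarrow> I \<subseteq> J \<or> J \<subseteq> I"
  proof (intro allI impI)
    fix I J assume IJ: "right_ideal I A" "right_ideal J A"
    then have "zeros I \<subseteq> zeros J \<or> zeros J \<subseteq> zeros I"
      using ch zeros_dual_submodule by (simp add: chain_coalgebra_def right_coideal_iff)
    then show "I \<subseteq> J \<or> J \<subseteq> I"
      using annihilator_antimono annihilator_zeros[OF D.right_ideal_submodule] IJ by metis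
  qed
next
  assume ch: "\<forall>I J. right_ideal I A \<longrightarrow> right_ideal J A \<longrightarrow> I \<subseteq> J \<or> J \<subseteq> I"
  have "S \<subseteq> T \<or> T \<subseteq> S" if "dual_submodule k C S" "dual_submodule k C T" for S T
  proof -
    have "annihilator S \<subseteq> annihilator T \<or> annihilator T \<subseteq> annihilator S"
      using ch annihilator_right_ideal that by blast
    moreover have "zeros (annihilator S) = S" "zeros (annihilator T) = T"
      using that zeros_annihilator by (auto simp: dual_submodule_def)
    ultimately show ?thesis using zeros_antimono by metis
  qed
  then show "chain_coalgebra k C"
    using coalgebra_axioms by (simp add: chain_coalgebra_def right_coideal_iff)
qed

context
  fixes x
  assumes x: "uniformizer A x" and nontriv: "\<one>\<^bsub>A\<^esub> \<noteq> \<zero>\<^bsub>A\<^esub>"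
begin

abbreviation "M \<equiv> carrier A - Units A"

lemma M_submodule: "submodule k M A"
  by (rule D.right_ideal_submodule[OF D.nonunits_right_ideal[OF x nontriv]])

text \<open>
  The annihilator of a nonzero subspace is a proper right ideal and hence consists of nonunits.
\<close>

lemma proper_annihilator:
  assumes S: "dual_submodule k C S" and "S \<noteq> {\<zero>\<^bsub>C\<^esub>}"
  shows "annihilator S \<subseteq> M"
proof -
  have sub: "submodule k S C" using S by (simp add: dual_submodule_def)
  have "annihilator S \<noteq> carrier A"
  proof
    assume all: "annihilator S = carrier A"
    have "s = \<zero>\<^bsub>C\<^esub>" if s: "s \<in> S" for s
    proof (rule dual_separates[OF C_vs fin_dim])
      show "s \<in> carrier C" using s submodule.subset[OF sub] by blast
      fix f assume f: "f \<in> carrier A"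
      then have "f \<in> annihilator S" using all by simp
      then have "f s = \<zero>\<^bsub>k\<^esub>" using s by (simp add: annihilator_def)
      then show "f s = f \<zero>\<^bsub>C\<^esub>" using hom_zero[OF C_mod scalars_mod dual_hom[OF C_vs f]] by simp
    qed simp
    then show False using \<open>S \<noteq> {\<zero>\<^bsub>C\<^esub>}\<close> submodule.zero_closed[OF sub] by blast
  qed
  then have "u \<notin> Units A" if "u \<in> annihilator S" for u
    using D.right_ideal_unit[OF annihilator_right_ideal[OF S] that] by blast
  moreover have "annihilator S \<subseteq> carrier A" unfolding annihilator_def by blast
  ultimately show ?thesis by blast
qed

text \<open>
  Since \<open>M\<close> is the largest proper right ideal, its zero set is the smallest nonzero submodule, and thus
  the only simple one.
\<close>

lemma simple_dual_submodule_iff: "simple_dual_submodule k C S \<longleftrightarrow> S = zeros M"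
proof -
  have Z: "dual_submodule k C (zeros M)" by (rule zeros_dual_submodule[OF D.nonunits_right_ideal[OF x nontriv]])
  have least: "zeros M \<subseteq> S" if S: "dual_submodule k C S" "S \<noteq> {\<zero>\<^bsub>C\<^esub>}" for S
  proof -
    have "zeros (annihilator S) = S" using zeros_annihilator S(1) unfolding dual_submodule_def by blast
    then show ?thesis using zeros_antimono[OF proper_annihilator[OF S]] by simp
  qed
  have nonzero: "zeros M \<noteq> {\<zero>\<^bsub>C\<^esub>}"
  proof
    assume "zeros M = {\<zero>\<^bsub>C\<^esub>}"
    then have "M = annihilator {\<zero>\<^bsub>C\<^esub>}" using annihilator_zeros[OF M_submodule] by simp
    moreover have "\<one>\<^bsub>A\<^esub> \<in> annihilator {\<zero>\<^bsub>C\<^esub>}"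
      using one_closed hom_zero[OF C_mod scalars_mod dual_hom[OF C_vs one_closed]] by (simp add: annihilator_def)
    ultimately show False using D.A.Units_one_closed by blast
  qed
  show ?thesis
  proof
    assume "simple_dual_submodule k C S"
    then show "S = zeros M"
      using least[of S] Z nonzero unfolding simple_dual_submodule_def by blast
  next
    assume "S = zeros M"
    then show "simple_dual_submodule k C S"
      using Z nonzero least unfolding simple_dual_submodule_def by blast
  qed
qed

lemma coradical_eq: "coradical k C = zeros M"
proof -
  have sub: "submodule k (zeros M) C" by (rule zeros_submodule) blast
  have "\<Union> {S. simple_dual_submodule k C S} = zeros M" by (simp add: simple_dual_submodule_iff)
  then show ?thesis
    using span_is_subset[OF subset_refl sub] in_own_span[OF submodule.subset[OF sub]]
    by (simp add: coradical_def)
qed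

lemma mult_M_vanishes:
  assumes m: "m \<in> M" and f: "f \<in> carrier A" and c: "c \<in> zeros M"
  shows "(f \<otimes>\<^bsub>A\<^esub> m) c = \<zero>\<^bsub>k\<^esub>" "(m \<otimes>\<^bsub>A\<^esub> f) c = \<zero>\<^bsub>k\<^esub>"
  using D.nonunit_mult[OF m f] c unfolding zeros_def by blast+

abbreviation "C\<^sub>0 \<equiv> zeros M"
abbreviation "V\<^sub>0 \<equiv> C\<lparr>carrier := C\<^sub>0\<rparr>"

lemma C0_submodule: "submodule k C\<^sub>0 C" by (rule zeros_submodule) blast
lemma V0_module: "module k V\<^sub>0" by (rule submodule_is_module[OF C0_submodule])
lemma C0_incl: "(\<lambda>u. u) \<in> module_hom k V\<^sub>0 C"
  using submodule.subset[OF C0_submodule] by (intro module_homI) auto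

text \<open>
  Functionals that agree on \<open>C\<^sub>0\<close> differ by elements of \<open>M\<close>, and products with a factor in the two-sided
  ideal \<open>M\<close> vanish on \<open>C\<^sub>0\<close>. This is what makes \<open>C\<^sub>0\<close> a subcoalgebra.
\<close>

lemma convolution_depends_on_restriction:
  assumes f: "f \<in> carrier A" "f' \<in> carrier A" and g: "g \<in> carrier A" "g' \<in> carrier A"
    and ff: "\<And>c. c \<in> C\<^sub>0 \<Longrightarrow> f c = f' c" and gg: "\<And>c. c \<in> C\<^sub>0 \<Longrightarrow> g c = g' c" and c: "c \<in> C\<^sub>0"
  shows "(f \<otimes>\<^bsub>A\<^esub> g) c = (f' \<otimes>\<^bsub>A\<^esub> g') c"
proof -
  have cC: "c \<in> carrier C" using c by (simp add: zeros_def)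
  have diff: "h \<ominus>\<^bsub>A\<^esub> h' \<in> M" if h: "h \<in> carrier A" "h' \<in> carrier A" "\<And>c. c \<in> C\<^sub>0 \<Longrightarrow> h c = h' c" for h h'
  proof -
    have "(h \<ominus>\<^bsub>A\<^esub> h') c = \<zero>\<^bsub>k\<^esub>" if c: "c \<in> C\<^sub>0" for c
    proof -
      have cC: "c \<in> carrier C" using c by (simp add: zeros_def)
      have "(h \<ominus>\<^bsub>A\<^esub> h') c = h c \<ominus>\<^bsub>self_module k\<^esub> h' c"
        by (rule hom_minus[OF D.module_axioms scalars_mod eval_hom[OF C_vs cC] h(1,2)])
      also have "\<dots> = h' c \<ominus>\<^bsub>self_module k\<^esub> h' c" using h(3)[OF c] by simp
      also have "\<dots> = \<zero>\<^bsub>k\<^esub>"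
        using abelian_group.minus_other_side[OF module.axioms(2)[OF scalars_mod], of "h' c" "h' c"]
          dual_value[OF C_vs h(2) cC] by simp
      finally show ?thesis .
    qed
    then have "h \<ominus>\<^bsub>A\<^esub> h' \<in> annihilator C\<^sub>0" using h(1,2) by (simp add: annihilator_def)
    then show ?thesis using annihilator_zeros[OF M_submodule] by simp
  qed
  have split: "h = h' \<oplus>\<^bsub>A\<^esub> (h \<ominus>\<^bsub>A\<^esub> h')" if "h \<in> carrier A" "h' \<in> carrier A" for h h'
  proof -
    have "h' \<oplus>\<^bsub>A\<^esub> (h \<ominus>\<^bsub>A\<^esub> h') = h \<oplus>\<^bsub>A\<^esub> (h' \<ominus>\<^bsub>A\<^esub> h')" using that by (simp add: a_minus_def D.M.a_ac)
    then show ?thesis using that by (simp add: a_minus_def D.M.r_neg)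
  qed
  let ?m = "f \<ominus>\<^bsub>A\<^esub> f'" and ?n = "g \<ominus>\<^bsub>A\<^esub> g'"
  have mn: "?m \<in> carrier A" "?n \<in> carrier A" using f g by simp_all
  have add: "(h \<oplus>\<^bsub>A\<^esub> h') c = h c \<oplus>\<^bsub>k\<^esub> h' c" for h h' using cC by (simp add: dual_algebra_simps)
  have val: "h c \<in> carrier k" if "h \<in> carrier A" for h by (rule dual_value[OF C_vs that cC])
  have "f \<otimes>\<^bsub>A\<^esub> g = (f' \<oplus>\<^bsub>A\<^esub> ?m) \<otimes>\<^bsub>A\<^esub> g" using split[OF f] by simp
  also have "\<dots> = f' \<otimes>\<^bsub>A\<^esub> g \<oplus>\<^bsub>A\<^esub> ?m \<otimes>\<^bsub>A\<^esub> g" using f g mn by (simp add: D.A.l_distr)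
  finally have 1: "(f \<otimes>\<^bsub>A\<^esub> g) c = (f' \<otimes>\<^bsub>A\<^esub> g) c"
    using mult_M_vanishes(2)[OF diff[OF f ff] g(1) c] val[OF mult_closed[OF f(2) g(1)]] add by simp
  have "f' \<otimes>\<^bsub>A\<^esub> g = f' \<otimes>\<^bsub>A\<^esub> (g' \<oplus>\<^bsub>A\<^esub> ?n)" using split[OF g] by simp
  also have "\<dots> = f' \<otimes>\<^bsub>A\<^esub> g' \<oplus>\<^bsub>A\<^esub> f' \<otimes>\<^bsub>A\<^esub> ?n" using f g mn by (simp add: D.A.r_distr)
  finally have 2: "(f' \<otimes>\<^bsub>A\<^esub> g) c = (f' \<otimes>\<^bsub>A\<^esub> g') c"
    using mult_M_vanishes(1)[OF diff[OF g gg] f(2) c] val[OF mult_closed[OF f(2) g(2)]] add by simp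
  show ?thesis using 1 2 by simp
qed

text \<open>
  If \<open>p\<close> is a projection of \<open>C\<close> onto \<open>C\<^sub>0\<close>, then \<open>(p \<otimes> p)(\<Delta> c)\<close> is a preimage of \<open>\<Delta> c\<close> in \<open>C\<^sub>0 \<otimes> C\<^sub>0\<close>:
  pairing it with \<open>f \<otimes> g\<close> gives the product of \<open>f \<circ> p\<close> and \<open>g \<circ> p\<close> at \<open>c\<close>, which only depends on the
  restrictions of \<open>f\<close> and \<open>g\<close> to \<open>C\<^sub>0\<close>. It is the only preimage, because \<open>p \<otimes> p\<close> is a left inverse of the inclusion
  of \<open>C\<^sub>0 \<otimes> C\<^sub>0\<close>. So the comultiplication of the subcoalgebra is well defined.
\<close>

lemma sub_comult:
  assumes c: "c \<in> C\<^sub>0"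
  shows "\<Delta>\<^bsub>sub_coalgebra k C C\<^sub>0\<^esub> c \<in> carrier (tensor k V\<^sub>0 V\<^sub>0)"
    and "tensor_map k C C (\<lambda>u. u) (\<lambda>v. v) (\<Delta>\<^bsub>sub_coalgebra k C C\<^sub>0\<^esub> c) = \<Delta>\<^bsub>C\<^esub> c"
proof -
  have cC: "c \<in> carrier C" using c by (simp add: zeros_def)
  note \<Delta>c = comult_closed[OF cC]
  let ?\<iota> = "tensor_map k C C (\<lambda>u. u) (\<lambda>v. v)"
  obtain p where p: "p \<in> module_hom k C C" "\<And>v. v \<in> carrier C \<Longrightarrow> p v \<in> C\<^sub>0" "\<And>s. s \<in> C\<^sub>0 \<Longrightarrow> p s = s"
    by (rule submodule_projection[OF fin_dim C0_submodule]) (rule that)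
  have p0: "p \<in> module_hom k C V\<^sub>0"
    using p(2) module_hom_add[OF p(1)] module_hom_smult[OF p(1)] by (intro module_homI) simp_all
  note \<iota> = tensor_map_hom[OF C_mod C_mod V0_module V0_module C0_incl C0_incl]
    and \<pi> = tensor_map_hom[OF V0_module V0_module C_mod C_mod p0 p0]
  let ?t = "tensor_map k V\<^sub>0 V\<^sub>0 p p (\<Delta>\<^bsub>C\<^esub> c)"
  have t: "?t \<in> carrier (tensor k V\<^sub>0 V\<^sub>0)" by (rule hom_in[OF \<pi> \<Delta>c])
  have \<iota>t: "?\<iota> ?t = \<Delta>\<^bsub>C\<^esub> c"
  proof (rule pairing_separates[OF C_vs fin_dim C_vs fin_dim hom_in[OF \<iota> t] \<Delta>c])
    fix f g assume f: "f \<in> module_hom k C (self_module k)" and g: "g \<in> module_hom k C (self_module k)"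
    note fb = functional_bilinear[OF R.cring_axioms]
    note f0 = hom_compose[OF C0_incl f] and g0 = hom_compose[OF C0_incl g]
    note fp = hom_compose[OF p(1) f] and gp = hom_compose[OF p(1) g]
    let ?r = "\<lambda>f. restrict f (carrier C)"
    have "pairing k f g (?\<iota> ?t) = pairing k f g ?t"
      by (rule tensor_lift_map[OF C_mod C_mod V0_module V0_module C0_incl C0_incl fb[OF f g] scalars_mod t])
    also have "\<dots> = pairing k (\<lambda>v. f (p v)) (\<lambda>v. g (p v)) (\<Delta>\<^bsub>C\<^esub> c)"
      by (rule tensor_lift_map[OF V0_module V0_module C_mod C_mod p0 p0 fb[OF f0 g0] scalars_mod \<Delta>c])
    also have "\<dots> = (?r (\<lambda>v. f (p v)) \<otimes>\<^bsub>A\<^esub> ?r (\<lambda>v. g (p v))) c"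
      using pairing_cong[OF C_mod C_mod fp gp _ _ \<Delta>c, of "?r (\<lambda>v. f (p v))" "?r (\<lambda>v. g (p v))"] cC
      by (simp add: dual_algebra_simps)
    also have "\<dots> = (?r f \<otimes>\<^bsub>A\<^esub> ?r g) c"
      by (rule convolution_depends_on_restriction)
        (use c in \<open>simp_all add: restrict_in_dual[OF C_vs] fp gp f g p(3) zeros_def[of M, THEN eq_refl, THEN subsetD]\<close>)
    also have "\<dots> = pairing k f g (\<Delta>\<^bsub>C\<^esub> c)"
      using pairing_cong[OF C_mod C_mod f g _ _ \<Delta>c, of "?r f" "?r g"] cC by (simp add: dual_algebra_simps)
    finally show "pairing k f g (?\<iota> ?t) = pairing k f g (\<Delta>\<^bsub>C\<^esub> c)" .
  qed
  have retract: "tensor_map k V\<^sub>0 V\<^sub>0 p p (?\<iota> s) = s" if s: "s \<in> carrier (tensor k V\<^sub>0 V\<^sub>0)" for s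
    by (rule tensor_hom_eqI[OF V0_module V0_module hom_compose[OF \<iota> \<pi>] hom_id _ s])
      (use submodule.subset[OF C0_submodule] in
        \<open>auto simp: tensor_map_pure[OF C_mod C_mod V0_module V0_module C0_incl C0_incl]
          tensor_map_pure[OF V0_module V0_module C_mod C_mod p0 p0] p(3) subset_iff\<close>)
  have "\<exists>!t. t \<in> carrier (tensor k V\<^sub>0 V\<^sub>0) \<and> ?\<iota> t = \<Delta>\<^bsub>C\<^esub> c"
    using t \<iota>t retract by metis
  from theI'[OF this] show "\<Delta>\<^bsub>sub_coalgebra k C C\<^sub>0\<^esub> c \<in> carrier (tensor k V\<^sub>0 V\<^sub>0)"
    "?\<iota> (\<Delta>\<^bsub>sub_coalgebra k C C\<^sub>0\<^esub> c) = \<Delta>\<^bsub>C\<^esub> c"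
    by (simp_all add: sub_coalgebra_def)
qed

abbreviation "B\<^sub>0 \<equiv> dual_algebra k (sub_coalgebra k C C\<^sub>0)"

lemma B0_carrier: "carrier B\<^sub>0 = module_hom k V\<^sub>0 (self_module k) \<inter> extensional C\<^sub>0"
  by (simp add: dual_carrier sub_coalgebra_def module_hom_def)

lemma restrict_closed:
  assumes "f \<in> carrier A" shows "restrict f C\<^sub>0 \<in> carrier B\<^sub>0"
proof -
  have "restrict f C\<^sub>0 \<in> module_hom k V\<^sub>0 (self_module k)"
    by (rule hom_cong[OF hom_compose[OF C0_incl dual_hom[OF C_vs assms]] _ V0_module]) simp
  then show ?thesis by (simp add: B0_carrier)
qed

lemma restrict_ring_hom: "(\<lambda>f. restrict f C\<^sub>0) \<in> ring_hom A B\<^sub>0"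
proof (rule ring_hom_memI)
  have carr: "carrier (sub_coalgebra k C C\<^sub>0) = C\<^sub>0" "\<epsilon>\<^bsub>sub_coalgebra k C C\<^sub>0\<^esub> = \<epsilon>\<^bsub>C\<^esub>"
    by (simp_all add: sub_coalgebra_def)
  have sub: "c \<in> carrier C" if "c \<in> C\<^sub>0" for c using that by (simp add: zeros_def)
  show "restrict \<one>\<^bsub>A\<^esub> C\<^sub>0 = \<one>\<^bsub>B\<^sub>0\<^esub>" by (auto simp: dual_algebra_simps carr sub)
  fix f g assume f: "f \<in> carrier A" and g: "g \<in> carrier A"
  show "restrict f C\<^sub>0 \<in> carrier B\<^sub>0" by (rule restrict_closed[OF f])
  show "restrict (f \<oplus>\<^bsub>A\<^esub> g) C\<^sub>0 = restrict f C\<^sub>0 \<oplus>\<^bsub>B\<^sub>0\<^esub> restrict g C\<^sub>0"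
    by (auto simp: dual_algebra_simps carr sub)
  show "restrict (f \<otimes>\<^bsub>A\<^esub> g) C\<^sub>0 = restrict f C\<^sub>0 \<otimes>\<^bsub>B\<^sub>0\<^esub> restrict g C\<^sub>0"
  proof -
    have "pairing k f g (\<Delta>\<^bsub>C\<^esub> c) =
        pairing k (restrict f C\<^sub>0) (restrict g C\<^sub>0) (\<Delta>\<^bsub>sub_coalgebra k C C\<^sub>0\<^esub> c)" if c: "c \<in> C\<^sub>0" for c
    proof -
      note fh = dual_hom[OF C_vs f] and gh = dual_hom[OF C_vs g] and t = sub_comult[OF c]
      have "pairing k f g (\<Delta>\<^bsub>C\<^esub> c) = pairing k f g (\<Delta>\<^bsub>sub_coalgebra k C C\<^sub>0\<^esub> c)"
        unfolding t(2)[symmetric]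
        by (rule tensor_lift_map[OF C_mod C_mod V0_module V0_module C0_incl C0_incl
              functional_bilinear[OF R.cring_axioms fh gh] scalars_mod t(1)])
      also have "\<dots> = pairing k (restrict f C\<^sub>0) (restrict g C\<^sub>0) (\<Delta>\<^bsub>sub_coalgebra k C C\<^sub>0\<^esub> c)"
        by (rule pairing_cong[OF V0_module V0_module hom_compose[OF C0_incl fh] hom_compose[OF C0_incl gh] _ _ t(1)])
          simp_all
      finally show ?thesis .
    qed
    then show ?thesis by (auto simp: dual_algebra_simps carr sub)
  qed
qed

lemma restrict_module_hom: "(\<lambda>f. restrict f C\<^sub>0) \<in> module_hom k A B\<^sub>0"
proof (rule module_homI)
  have carr: "carrier (sub_coalgebra k C C\<^sub>0) = C\<^sub>0" by (simp add: sub_coalgebra_def)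
  have sub: "c \<in> carrier C" if "c \<in> C\<^sub>0" for c using that by (simp add: zeros_def)
  show "restrict f C\<^sub>0 \<in> carrier B\<^sub>0" if "f \<in> carrier A" for f by (rule restrict_closed[OF that])
  show "restrict (f \<oplus>\<^bsub>A\<^esub> g) C\<^sub>0 = restrict f C\<^sub>0 \<oplus>\<^bsub>B\<^sub>0\<^esub> restrict g C\<^sub>0" for f g
    by (auto simp: dual_algebra_simps carr sub)
  show "restrict (a \<odot>\<^bsub>A\<^esub> f) C\<^sub>0 = a \<odot>\<^bsub>B\<^sub>0\<^esub> restrict f C\<^sub>0" for a f
    by (auto simp: dual_algebra_simps carr sub)
qed

text \<open>
  Precomposition with a projection onto \<open>C\<^sub>0\<close> extends a functional from \<open>C\<^sub>0\<close> to \<open>C\<close>.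
\<close>

lemma restrict_surj: "(\<lambda>f. restrict f C\<^sub>0) ` carrier A = carrier B\<^sub>0"
proof
  show "(\<lambda>f. restrict f C\<^sub>0) ` carrier A \<subseteq> carrier B\<^sub>0" using restrict_closed by blast
  show "carrier B\<^sub>0 \<subseteq> (\<lambda>f. restrict f C\<^sub>0) ` carrier A"
  proof
    fix \<phi> assume \<phi>: "\<phi> \<in> carrier B\<^sub>0"
    obtain p where p: "p \<in> module_hom k C C" "\<And>v. v \<in> carrier C \<Longrightarrow> p v \<in> C\<^sub>0" "\<And>s. s \<in> C\<^sub>0 \<Longrightarrow> p s = s"
      by (rule submodule_projection[OF fin_dim C0_submodule]) (rule that)
    have p0: "p \<in> module_hom k C V\<^sub>0"
      using p(2) module_hom_add[OF p(1)] module_hom_smult[OF p(1)] by (intro module_homI) simp_all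
    have "\<phi> \<in> module_hom k V\<^sub>0 (self_module k)" using \<phi> by (simp add: B0_carrier)
    then have f: "restrict (\<lambda>c. \<phi> (p c)) (carrier C) \<in> carrier A"
      by (intro restrict_in_dual[OF C_vs] hom_compose[OF p0])
    have "restrict (restrict (\<lambda>c. \<phi> (p c)) (carrier C)) C\<^sub>0 = \<phi>"
      using \<phi> p(3) submodule.subset[OF C0_submodule]
      by (intro extensionalityI[of _ C\<^sub>0]) (auto simp: B0_carrier)
    then show "\<phi> \<in> (\<lambda>f. restrict f C\<^sub>0) ` carrier A" using f by (metis image_eqI)
  qed
qed

lemma restrict_kernel: "{f \<in> carrier A. restrict f C\<^sub>0 = \<zero>\<^bsub>B\<^sub>0\<^esub>} = M"
proof -
  have "restrict f C\<^sub>0 = \<zero>\<^bsub>B\<^sub>0\<^esub> \<longleftrightarrow> (\<forall>c\<in>C\<^sub>0. f c = \<zero>\<^bsub>k\<^esub>)" for f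
    by (auto simp: dual_algebra_simps sub_coalgebra_def fun_eq_iff restrict_def)
  then have "{f \<in> carrier A. restrict f C\<^sub>0 = \<zero>\<^bsub>B\<^sub>0\<^esub>} = annihilator C\<^sub>0" by (simp add: annihilator_def)
  then show ?thesis using annihilator_zeros[OF M_submodule] by simp
qed

end

end

section \<open>Isomorphisms and residue algebras\<close>

lemma tensor_transfer:
  assumes "carrier V' = carrier V" "add V' = add V" "smult V' = smult V"
    and "carrier W' = carrier W" "add W' = add W" "smult W' = smult W"
  shows "tensor k V' W' = tensor k V W"
  using assms by (simp add: tensor_def tensor_relations_def)

lemma algebra_isoI:
  assumes "h \<in> ring_hom A B" "h \<in> module_hom k A B" "bij_betw h (carrier A) (carrier B)"
  shows "h \<in> algebra_iso k A B"
  using assms by (simp add: algebra_iso_def ring_iso_def)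

lemma algebra_isoD:
  assumes "h \<in> algebra_iso k A B"
  shows "h \<in> ring_hom A B" "h \<in> module_hom k A B" "bij_betw h (carrier A) (carrier B)"
  using assms by (simp_all add: algebra_iso_def ring_iso_def)

lemma hom_inverse:
  assumes V: "module k V" and h: "h \<in> module_hom k V W" and bij: "bij_betw h (carrier V) (carrier W)"
  shows "inv_into (carrier V) h \<in> module_hom k W V"
proof (rule module_homI)
  interpret V: module k V by fact
  let ?g = "inv_into (carrier V) h"
  have g: "?g w \<in> carrier V" "h (?g w) = w" if "w \<in> carrier W" for w
    using that bij by (auto simp: bij_betw_def inv_into_into f_inv_into_f)
  have gh: "?g (h v) = v" if "v \<in> carrier V" for v
    using bij that by (simp add: bij_betw_def inv_into_f_f)
  show "?g w \<in> carrier V" if "w \<in> carrier W" for w using g that by blast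
  show "?g (w \<oplus>\<^bsub>W\<^esub> w') = ?g w \<oplus>\<^bsub>V\<^esub> ?g w'" if "w \<in> carrier W" "w' \<in> carrier W" for w w'
    using gh[OF V.M.a_closed[OF g(1)[OF that(1)] g(1)[OF that(2)]]]
      module_hom_add[OF h g(1)[OF that(1)] g(1)[OF that(2)]] g(2) that by simp
  show "?g (a \<odot>\<^bsub>W\<^esub> w) = a \<odot>\<^bsub>V\<^esub> ?g w" if "a \<in> carrier k" "w \<in> carrier W" for a w
    using gh[OF V.smult_closed[OF that(1) g(1)[OF that(2)]]]
      module_hom_smult[OF h that(1) g(1)[OF that(2)]] g(2) that by simp
qed

lemma algebra_iso_inverse:
  assumes V: "module k A" and A: "ring A" and h: "h \<in> algebra_iso k A B"
  shows "inv_into (carrier A) h \<in> algebra_iso k B A"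
proof (rule algebra_isoI)
  note hh = algebra_isoD[OF h]
  show "inv_into (carrier A) h \<in> module_hom k B A" by (rule hom_inverse[OF V hh(2,3)])
  show "bij_betw (inv_into (carrier A) h) (carrier B) (carrier A)" by (rule bij_betw_inv_into[OF hh(3)])
  show "inv_into (carrier A) h \<in> ring_hom B A"
    using ring_iso_set_sym[OF A, of h B] h by (simp add: algebra_iso_def ring_iso_def)
qed

lemma algebra_iso_compose:
  assumes f: "f \<in> algebra_iso k A B" and g: "g \<in> algebra_iso k B C"
  shows "g \<circ> f \<in> algebra_iso k A C"
proof -
  have "g \<circ> f \<in> ring_iso A C"
    by (rule ring_iso_set_trans[of f A B]) (use f g in \<open>simp_all add: algebra_iso_def\<close>)
  moreover have "g \<circ> f \<in> module_hom k A C"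
    unfolding comp_def by (rule hom_compose[OF algebra_isoD(2)[OF f] algebra_isoD(2)[OF g]])
  ultimately show ?thesis by (simp add: algebra_iso_def)
qed

text \<open>
  The first isomorphism theorem. The operations of \<open>B\<close> enter only through \<open>h\<close>; the ring and module laws
  in \<open>B\<close> are consequences of surjectivity.
\<close>

lemma quotient_algebra_iso:
  assumes A: "module k A" "ring A" and N: "submodule k N A" "ideal N A"
    and h: "h \<in> ring_hom A B" "h \<in> module_hom k A B" and surj: "h ` carrier A = carrier B"
    and ker: "{a \<in> carrier A. h a = \<zero>\<^bsub>B\<^esub>} = N"
  shows "algebra_isomorphic k (quotient_algebra A N) B"
proof -
  interpret M: module k A by fact
  interpret A: ring A by fact
  interpret N: ideal N A by fact
  let ?Q = "quotient_algebra A N" and ?\<psi> = "\<lambda>X. the_elem (h ` X)"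
  have kerD: "h n = \<zero>\<^bsub>B\<^esub>" if "n \<in> N" for n
    using that unfolding ker[symmetric] by (rule CollectE) simp
  have zero: "h \<zero>\<^bsub>A\<^esub> = \<zero>\<^bsub>B\<^esub>" by (rule kerD[OF N.zero_closed])
  have val: "?\<psi> (N +>\<^bsub>A\<^esub> a) = h a" if a: "a \<in> carrier A" for a
  proof -
    have "h b = h a" if b: "b \<in> N +>\<^bsub>A\<^esub> a" for b
    proof -
      obtain n where n: "n \<in> N" "b = n \<oplus>\<^bsub>A\<^esub> a" using b by (auto simp: a_r_coset_def')
      have "h b = h n \<oplus>\<^bsub>B\<^esub> h a" using module_hom_add[OF h(2) N.Icarr[OF n(1)] a] n(2) by simp
      also have "\<dots> = h \<zero>\<^bsub>A\<^esub> \<oplus>\<^bsub>B\<^esub> h a" using kerD[OF n(1)] zero by simp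
      also have "\<dots> = h a" using module_hom_add[OF h(2) M.M.zero_closed a] a by simp
      finally show ?thesis .
    qed
    then have "h ` (N +>\<^bsub>A\<^esub> a) = {h a}" using N.a_rcos_self[OF a] by blast
    then show ?thesis by simp
  qed
  note cases = M.coset_cases[OF N(1)] and coset_in = M.coset_in[OF N(1)] and coset_hom = M.coset_hom[OF N(1)]
  have "?\<psi> \<in> module_hom k ?Q B"
  proof (rule module_homI)
    show "?\<psi> X \<in> carrier B" if "X \<in> carrier ?Q" for X
      by (rule cases[OF that]) (use hom_in[OF h(2)] in \<open>simp add: val\<close>)
    show "?\<psi> (X \<oplus>\<^bsub>?Q\<^esub> Y) = ?\<psi> X \<oplus>\<^bsub>B\<^esub> ?\<psi> Y" if X: "X \<in> carrier ?Q" and Y: "Y \<in> carrier ?Q" for X Y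
    proof -
      obtain a where a: "a \<in> carrier A" "X = N +>\<^bsub>A\<^esub> a" by (rule cases[OF X])
      obtain b where b: "b \<in> carrier A" "Y = N +>\<^bsub>A\<^esub> b" by (rule cases[OF Y])
      show ?thesis
        unfolding a(2) b(2) module_hom_add[OF coset_hom a(1) b(1), symmetric]
        using a(1) b(1) by (simp add: val module_hom_add[OF h(2)])
    qed
    show "?\<psi> (r \<odot>\<^bsub>?Q\<^esub> X) = r \<odot>\<^bsub>B\<^esub> ?\<psi> X" if r: "r \<in> carrier k" and X: "X \<in> carrier ?Q" for r X
    proof -
      obtain a where a: "a \<in> carrier A" "X = N +>\<^bsub>A\<^esub> a" by (rule cases[OF X])
      show ?thesis
        unfolding a(2) module_hom_smult[OF coset_hom r a(1), symmetric]
        using a(1) r by (simp add: val module_hom_smult[OF h(2)])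
    qed
  qed
  moreover have "?\<psi> \<in> ring_hom ?Q B"
  proof (rule ring_hom_memI)
    show "?\<psi> X \<in> carrier B" if "X \<in> carrier ?Q" for X using hom_in[OF calculation that] .
    show "?\<psi> (X \<oplus>\<^bsub>?Q\<^esub> Y) = ?\<psi> X \<oplus>\<^bsub>B\<^esub> ?\<psi> Y" if "X \<in> carrier ?Q" "Y \<in> carrier ?Q" for X Y
      using module_hom_add[OF calculation that] .
    show "?\<psi> (X \<otimes>\<^bsub>?Q\<^esub> Y) = ?\<psi> X \<otimes>\<^bsub>B\<^esub> ?\<psi> Y" if X: "X \<in> carrier ?Q" and Y: "Y \<in> carrier ?Q" for X Y
    proof -
      obtain a where a: "a \<in> carrier A" "X = N +>\<^bsub>A\<^esub> a" by (rule cases[OF X])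
      obtain b where b: "b \<in> carrier A" "Y = N +>\<^bsub>A\<^esub> b" by (rule cases[OF Y])
      show ?thesis
        using a(1) b(1) by (simp add: a(2) b(2) N.rcoset_mult_add val ring_hom_mult[OF h(1)])
    qed
    show "?\<psi> \<one>\<^bsub>?Q\<^esub> = \<one>\<^bsub>B\<^esub>" by (simp add: val ring_hom_one[OF h(1)])
  qed
  moreover have "bij_betw ?\<psi> (carrier ?Q) (carrier B)"
  proof (rule bij_betwI')
    fix X Y assume X: "X \<in> carrier ?Q" and Y: "Y \<in> carrier ?Q"
    obtain a where a: "a \<in> carrier A" "X = N +>\<^bsub>A\<^esub> a" by (rule cases[OF X])
    obtain b where b: "b \<in> carrier A" "Y = N +>\<^bsub>A\<^esub> b" by (rule cases[OF Y])
    have "b \<ominus>\<^bsub>A\<^esub> a \<in> N" if "h a = h b"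
    proof -
      have "h (b \<ominus>\<^bsub>A\<^esub> a) = h b \<oplus>\<^bsub>B\<^esub> h (\<ominus>\<^bsub>A\<^esub> a)"
        using module_hom_add[OF h(2) b(1) M.M.a_inv_closed[OF a(1)]] by (simp add: a_minus_def)
      also have "\<dots> = h (a \<oplus>\<^bsub>A\<^esub> \<ominus>\<^bsub>A\<^esub> a)"
        using module_hom_add[OF h(2) a(1) M.M.a_inv_closed[OF a(1)]] that by simp
      also have "\<dots> = \<zero>\<^bsub>B\<^esub>" using a(1) zero by (simp add: M.M.r_neg)
      finally show ?thesis unfolding ker[symmetric] using a(1) b(1) by simp
    qed
    moreover have "h a = h b" if "?\<psi> X = ?\<psi> Y" using that val[OF a(1)] val[OF b(1)] a(2) b(2) by simp
    ultimately show "(?\<psi> X = ?\<psi> Y) = (X = Y)"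
      using M.coset_eq_iff[OF N(1) a(1) b(1)] a(2) b(2) by blast
  next
    show "?\<psi> X \<in> carrier B" if "X \<in> carrier ?Q" for X
      by (rule cases[OF that]) (use hom_in[OF h(2)] in \<open>simp add: val\<close>)
    show "\<exists>X\<in>carrier ?Q. y = ?\<psi> X" if "y \<in> carrier B" for y
    proof -
      have "y \<in> h ` carrier A" using that surj by simp
      then obtain a where "y = h a" "a \<in> carrier A" by (rule imageE)
      then show ?thesis using coset_in[of a] val[of a] by (intro bexI[of _ "N +>\<^bsub>A\<^esub> a"]) simp_all
    qed
  qed
  ultimately have "?\<psi> \<in> algebra_iso k ?Q B" by (intro algebra_isoI)
  then show ?thesis unfolding algebra_isomorphic_def by blast
qed

context fin_dim_algebra
begin

lemma nonunits_ideal: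
  assumes x: "uniformizer A x" and nontriv: "\<one>\<^bsub>A\<^esub> \<noteq> \<zero>\<^bsub>A\<^esub>"
  shows "ideal (carrier A - Units A) A"
proof (rule idealI)
  show "ring A" by (rule A.ring_axioms)
  show "subgroup (carrier A - Units A) (add_monoid A)"
    using nonunits_left_ideal[OF x nontriv] by (simp add: left_ideal_def additive_subgroup_def)
qed (use nonunit_mult in blast)+

lemma quotient_ring:
  assumes "ideal N A" shows "ring (quotient_algebra A N)"
proof -
  interpret N: ideal N A by fact
  interpret R: ring "A Quot N" by (rule N.quotient_is_ring)
  have neg: "\<exists>Y\<in>a_rcosets\<^bsub>A\<^esub> N. Y <+>\<^bsub>A\<^esub> X = N" if "X \<in> a_rcosets\<^bsub>A\<^esub> N" for X
    using R.l_neg[of X] R.a_inv_closed[of X] that by (auto simp: FactRing_def)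
  show ?thesis
    by (rule ringI; (rule abelian_groupI monoidI)?)
      (use R.m_assoc R.l_distr R.r_distr R.a_assoc R.a_comm R.l_zero R.l_one R.r_one R.a_closed R.m_closed
        R.zero_closed R.one_closed neg in \<open>simp_all add: FactRing_def\<close>)
qed

lemma residue_algebra_iso:
  assumes x: "uniformizer A x" and nontriv: "\<one>\<^bsub>A\<^esub> \<noteq> \<zero>\<^bsub>A\<^esub>"
    and h: "h \<in> ring_hom A B" "h \<in> module_hom k A B" "h ` carrier A = carrier B"
    and ker: "{a \<in> carrier A. h a = \<zero>\<^bsub>B\<^esub>} = carrier A - Units A"
  shows "algebra_isomorphic k (quotient_algebra A (Jac A)) B"
proof -
  have sub: "submodule k (carrier A - Units A) A"
    using x principal_submodules(1)[OF uniformizer_closed[OF x nontriv]] by (simp add: uniformizer_def)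
  show ?thesis
    unfolding Jac_nonunits[OF x nontriv]
    by (rule quotient_algebra_iso[OF module_axioms A.ring_axioms sub nonunits_ideal[OF x nontriv] h ker])
qed

lemma trivial_carrier: "\<one>\<^bsub>A\<^esub> = \<zero>\<^bsub>A\<^esub> \<Longrightarrow> carrier A = {\<zero>\<^bsub>A\<^esub>}"
  using A.one_zeroD by simp

end

context fin_dim_coalgebra
begin

interpretation D: fin_dim_algebra k A by (rule dual_is_algebra)

text \<open>
  In a zero ring every functional is zero, and functionals separate points.
\<close>

lemma trivial_dual:
  assumes triv: "\<one>\<^bsub>A\<^esub> = \<zero>\<^bsub>A\<^esub>"
  shows "carrier C = {\<zero>\<^bsub>C\<^esub>}"
proof -
  have "c = \<zero>\<^bsub>C\<^esub>" if c: "c \<in> carrier C" for c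
  proof (rule dual_separates[OF C_vs fin_dim c M.zero_closed])
    fix f assume "f \<in> carrier A"
    then have "f = \<zero>\<^bsub>A\<^esub>" using D.trivial_carrier[OF triv] by blast
    then show "f c = f \<zero>\<^bsub>C\<^esub>" using c by (simp add: dual_algebra_simps)
  qed
  then show ?thesis by blast
qed

text \<open>
  The zero coalgebra has coradical zero, whose dual algebra has \<open>1 = 0\<close>, unlike a division algebra.
\<close>

lemma dual_nontrivial:
  assumes D: "division_algebra k E"
    and iso: "algebra_isomorphic k E (dual_algebra k (sub_coalgebra k C (coradical k C)))"
  shows "\<one>\<^bsub>A\<^esub> \<noteq> \<zero>\<^bsub>A\<^esub>"
proof
  interpret E: division_algebra k E by (rule D)
  let ?S = "coradical k C"
  let ?B = "dual_algebra k (sub_coalgebra k C ?S)"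
  assume "\<one>\<^bsub>A\<^esub> = \<zero>\<^bsub>A\<^esub>"
  then have triv: "carrier C = {\<zero>\<^bsub>C\<^esub>}" by (rule trivial_dual)
  have "\<Union> {S. simple_dual_submodule k C S} \<subseteq> carrier C"
    using submodule.subset by (fastforce simp: simple_dual_submodule_def dual_submodule_def)
  then have "?S \<subseteq> carrier C" unfolding coradical_def by (rule span_is_subset2)
  then have S: "c = \<zero>\<^bsub>C\<^esub>" if "c \<in> ?S" for c using that triv by blast
  have "\<epsilon>\<^bsub>C\<^esub> \<zero>\<^bsub>C\<^esub> = \<zero>\<^bsub>k\<^esub>" using hom_zero[OF C_mod scalars_mod counit_linear] by simp
  then have one: "\<one>\<^bsub>?B\<^esub> = (\<lambda>c\<in>?S. \<zero>\<^bsub>k\<^esub>)"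
    by (auto simp: dual_algebra_simps sub_coalgebra_def dest!: S intro!: restrict_ext)
  obtain h where h: "h \<in> algebra_iso k E ?B" using iso by (auto simp: algebra_isomorphic_def)
  note hh = algebra_isoD[OF h]
  have "h \<zero>\<^bsub>E\<^esub> = h (\<zero>\<^bsub>k\<^esub> \<odot>\<^bsub>E\<^esub> \<one>\<^bsub>E\<^esub>)" by simp
  also have "\<dots> = \<zero>\<^bsub>k\<^esub> \<odot>\<^bsub>?B\<^esub> h \<one>\<^bsub>E\<^esub>" by (rule module_hom_smult[OF hh(2)]) simp_all
  also have "\<dots> = h \<one>\<^bsub>E\<^esub>"
    unfolding ring_hom_one[OF hh(1)] one by (auto simp: dual_algebra_simps sub_coalgebra_def)
  finally have "h \<zero>\<^bsub>E\<^esub> = h \<one>\<^bsub>E\<^esub>" .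
  then have "\<zero>\<^bsub>E\<^esub> = \<one>\<^bsub>E\<^esub>"
    using hh(3) E.M.zero_closed E.A.one_closed by (auto simp: bij_betw_def dest: inj_onD)
  then show False using E.one_neq_zero by simp
qed

theorem dual_chain_ring:
  assumes D: "division_algebra k E" and chain: "chain_coalgebra k C"
    and iso: "algebra_isomorphic k E (dual_algebra k (sub_coalgebra k C (coradical k C)))"
  shows "chain_ring_with_residue_field k E A"
proof -
  interpret E: division_algebra k E by (rule D)
  note nontriv = dual_nontrivial[OF D iso]
  obtain x where x: "uniformizer A x"
    using D.right_chain_uniformizer[OF _ nontriv] chain by (auto simp: chain_coalgebra_iff)
  have "algebra_isomorphic k (quotient_algebra A (Jac A))
      (dual_algebra k (sub_coalgebra k C (zeros (carrier A - Units A))))"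
    by (rule D.residue_algebra_iso[OF x nontriv restrict_ring_hom[OF x nontriv]
          restrict_module_hom[OF x nontriv] restrict_surj[OF x nontriv] restrict_kernel[OF x nontriv]])
  then obtain f where f: "f \<in> algebra_iso k (quotient_algebra A (Jac A))
      (dual_algebra k (sub_coalgebra k C (coradical k C)))"
    unfolding coradical_eq[OF x nontriv] algebra_isomorphic_def by blast
  obtain g where g: "g \<in> algebra_iso k E (dual_algebra k (sub_coalgebra k C (coradical k C)))"
    using iso by (auto simp: algebra_isomorphic_def)
  have "algebra_isomorphic k (quotient_algebra A (Jac A)) E"
    using algebra_iso_compose[OF f algebra_iso_inverse[OF E.module_axioms E.A.ring_axioms g]]
    by (auto simp: algebra_isomorphic_def)
  moreover have "fin_dim_chain_ring k A"
    unfolding fin_dim_chain_ring_def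
    using D.assoc_algebra_axioms D.fin_dim D.left_ideals_chain[OF x nontriv] by blast
  ultimately show ?thesis
    unfolding chain_ring_with_residue_field_def using D.left_ideals_eq_powers[OF x nontriv] by blast
qed

end

text \<open>
  The transpose of a coalgebra isomorphism. Compatibility with the comultiplications is turned into
  multiplicativity by pairing with functionals.
\<close>

lemma coalgebra_iso_dual:
  assumes C: "fin_dim_coalgebra k C" and C': "fin_dim_coalgebra k C'"
    and h: "h \<in> coalgebra_iso k C C'"
  shows "(\<lambda>f. restrict (\<lambda>c. f (h c)) (carrier C)) \<in> algebra_iso k (dual_algebra k C') (dual_algebra k C)"
proof -
  interpret C: fin_dim_coalgebra k C by (rule C)
  interpret C': fin_dim_coalgebra k C' by (rule C')
  let ?\<theta> = "\<lambda>f. restrict (\<lambda>c. f (h c)) (carrier C)"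
  have hom: "h \<in> module_hom k C C'" and bij: "bij_betw h (carrier C) (carrier C')"
    and comult: "\<And>c. c \<in> carrier C \<Longrightarrow> \<Delta>\<^bsub>C'\<^esub> (h c) = tensor_map k C' C' h h (\<Delta>\<^bsub>C\<^esub> c)"
    and counit: "\<And>c. c \<in> carrier C \<Longrightarrow> \<epsilon>\<^bsub>C'\<^esub> (h c) = \<epsilon>\<^bsub>C\<^esub> c"
    using h by (auto simp: coalgebra_iso_def)
  note hc = hom_in[OF hom]
  note hom' = dual_hom[OF C'.C_vs]
  have closed: "?\<theta> f \<in> carrier C.A" if "f \<in> carrier C'.A" for f
    by (rule restrict_in_dual[OF C.C_vs hom_compose[OF hom hom'[OF that]]])
  have add: "?\<theta> (f \<oplus>\<^bsub>C'.A\<^esub> g) = ?\<theta> f \<oplus>\<^bsub>C.A\<^esub> ?\<theta> g"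
    if "f \<in> carrier C'.A" "g \<in> carrier C'.A" for f g
    using hc by (auto simp: dual_algebra_simps intro!: restrict_ext)
  show ?thesis
  proof (rule algebra_isoI)
    show "?\<theta> \<in> module_hom k C'.A C.A"
    proof (rule module_homI)
      show "?\<theta> (a \<odot>\<^bsub>C'.A\<^esub> f) = a \<odot>\<^bsub>C.A\<^esub> ?\<theta> f" for a f
        using hc by (auto simp: dual_algebra_simps intro!: restrict_ext)
    qed (fact closed add)+
    show "?\<theta> \<in> ring_hom C'.A C.A"
    proof (rule ring_hom_memI)
      show "?\<theta> f \<in> carrier C.A" if "f \<in> carrier C'.A" for f by (rule closed[OF that])
      show "?\<theta> (f \<oplus>\<^bsub>C'.A\<^esub> g) = ?\<theta> f \<oplus>\<^bsub>C.A\<^esub> ?\<theta> g"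
        if "f \<in> carrier C'.A" "g \<in> carrier C'.A" for f g by (rule add[OF that])
      fix f g assume f: "f \<in> carrier C'.A" and g: "g \<in> carrier C'.A"
      have "pairing k f g (\<Delta>\<^bsub>C'\<^esub> (h c)) = pairing k (?\<theta> f) (?\<theta> g) (\<Delta>\<^bsub>C\<^esub> c)" if c: "c \<in> carrier C" for c
      proof -
        note fh = hom_compose[OF hom hom'[OF f]] and gh = hom_compose[OF hom hom'[OF g]]
        have "pairing k f g (\<Delta>\<^bsub>C'\<^esub> (h c)) = pairing k (\<lambda>c. f (h c)) (\<lambda>c. g (h c)) (\<Delta>\<^bsub>C\<^esub> c)"
          unfolding comult[OF c]
          by (rule tensor_lift_map[OF C'.C_mod C'.C_mod C.C_mod C.C_mod hom hom
                functional_bilinear[OF C.R.cring_axioms hom'[OF f] hom'[OF g]] C.scalars_mod C.comult_closed[OF c]])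
        also have "\<dots> = pairing k (?\<theta> f) (?\<theta> g) (\<Delta>\<^bsub>C\<^esub> c)"
          by (rule pairing_cong[OF C.C_mod C.C_mod fh gh _ _ C.comult_closed[OF c]]) simp_all
        finally show ?thesis .
      qed
      then show "?\<theta> (f \<otimes>\<^bsub>C'.A\<^esub> g) = ?\<theta> f \<otimes>\<^bsub>C.A\<^esub> ?\<theta> g"
        using hc by (auto simp: dual_algebra_simps intro!: restrict_ext)
    next
      show "?\<theta> \<one>\<^bsub>C'.A\<^esub> = \<one>\<^bsub>C.A\<^esub>"
        using hc counit by (auto simp: dual_algebra_simps intro!: restrict_ext)
    qed
    show "bij_betw ?\<theta> (carrier C'.A) (carrier C.A)"
    proof (rule bij_betwI')
      fix f g assume f: "f \<in> carrier C'.A" and g: "g \<in> carrier C'.A"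
      have "f c' = g c'" if eq: "?\<theta> f = ?\<theta> g" and c': "c' \<in> carrier C'" for c'
      proof -
        obtain c where c: "c \<in> carrier C" "c' = h c" using c' bij by (auto simp: bij_betw_def)
        show ?thesis using fun_cong[OF eq, of c] c by simp
      qed
      then show "(?\<theta> f = ?\<theta> g) = (f = g)" using dual_eqI[OF C'.C_vs f g] by blast
    next
      fix f assume f: "f \<in> carrier C.A"
      let ?g = "restrict (\<lambda>c. f (inv_into (carrier C) h c)) (carrier C')"
      have g: "?g \<in> carrier C'.A"
        by (rule restrict_in_dual[OF C'.C_vs hom_compose[OF hom_inverse[OF C.C_mod hom bij] dual_hom[OF C.C_vs f]]])
      have "f = ?\<theta> ?g"
        by (rule dual_eqI[OF C.C_vs f closed[OF g]])
          (use hc bij in \<open>simp add: bij_betw_def inv_into_f_f\<close>)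
      then show "\<exists>g\<in>carrier C'.A. f = ?\<theta> g" using g by blast
    qed (rule closed)
  qed
qed

text \<open>
  An isomorphism of dual algebras is a transpose: for \<open>c \<in> C\<close> the functional \<open>f \<mapsto> (\<psi>\<^sup>-\<^sup>1 f)(c)\<close> on the dual
  of \<open>C'\<close> is evaluation at a unique point, which is taken as the image of \<open>c\<close>. All properties of
  this map are tested on functionals.
\<close>

lemma dual_iso_coalgebra:
  assumes C: "fin_dim_coalgebra k C" and C': "fin_dim_coalgebra k C'"
    and \<psi>: "\<psi> \<in> algebra_iso k (dual_algebra k C) (dual_algebra k C')"
  shows "coalgebra_isomorphic k C C'"
proof -
  interpret C: fin_dim_coalgebra k C by (rule C)
  interpret C': fin_dim_coalgebra k C' by (rule C')
  interpret A: fin_dim_algebra k C.A by (rule C.dual_is_algebra)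
  interpret A': fin_dim_algebra k C'.A by (rule C'.dual_is_algebra)
  define \<chi> where "\<chi> = inv_into (carrier C.A) \<psi>"
  have \<chi>: "\<chi> \<in> algebra_iso k C'.A C.A"
    unfolding \<chi>_def by (rule algebra_iso_inverse[OF A.module_axioms A.A.ring_axioms \<psi>])
  note \<psi>\<psi> = algebra_isoD[OF \<psi>] and \<chi>\<chi> = algebra_isoD[OF \<chi>]
  have \<psi>\<chi>: "\<psi> (\<chi> f) = f" if "f \<in> carrier C'.A" for f
    using \<psi>\<psi>(3) that by (simp add: \<chi>_def bij_betw_def f_inv_into_f)
  have \<chi>\<psi>: "\<chi> (\<psi> f) = f" if "f \<in> carrier C.A" for f
    using \<psi>\<psi>(3) that by (simp add: \<chi>_def bij_betw_def inv_into_f_f)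
  note \<chi>c = hom_in[OF \<chi>\<chi>(2)] and \<psi>c = hom_in[OF \<psi>\<psi>(2)]
  have "\<exists>c'\<in>carrier C'. \<forall>f\<in>carrier C'.A. \<chi> f c = f c'" if c: "c \<in> carrier C" for c
    by (rule double_dual[OF C'.C_vs C'.fin_dim hom_compose[OF \<chi>\<chi>(2) eval_hom[OF C.C_vs c]]])
  then obtain h where h: "\<And>c. c \<in> carrier C \<Longrightarrow> h c \<in> carrier C'"
    "\<And>c f. c \<in> carrier C \<Longrightarrow> f \<in> carrier C'.A \<Longrightarrow> f (h c) = \<chi> f c" by metis
  note sep = dual_separates[OF C'.C_vs C'.fin_dim] and hom' = dual_hom[OF C'.C_vs]
  have hom: "h \<in> module_hom k C C'"
  proof (rule module_homI)
    fix c d assume c: "c \<in> carrier C" and d: "d \<in> carrier C"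
    show "h (c \<oplus>\<^bsub>C\<^esub> d) = h c \<oplus>\<^bsub>C'\<^esub> h d"
      by (rule sep) (simp_all add: h c d module_hom_add[OF hom'] module_hom_add[OF dual_hom[OF C.C_vs \<chi>c]])
  next
    fix a c assume a: "a \<in> carrier k" and c: "c \<in> carrier C"
    show "h (a \<odot>\<^bsub>C\<^esub> c) = a \<odot>\<^bsub>C'\<^esub> h c"
      by (rule sep) (simp_all add: h a c module_hom_smult[OF hom'] module_hom_smult[OF dual_hom[OF C.C_vs \<chi>c]])
  qed (rule h(1))
  have "bij_betw h (carrier C) (carrier C')"
  proof (rule bij_betwI')
    fix c d assume c: "c \<in> carrier C" and d: "d \<in> carrier C"
    have "c = d" if eq: "h c = h d"
    proof (rule dual_separates[OF C.C_vs C.fin_dim c d])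
      fix f assume f: "f \<in> carrier C.A"
      show "f c = f d" using h(2)[OF c \<psi>c[OF f]] h(2)[OF d \<psi>c[OF f]] eq \<chi>\<psi>[OF f] by simp
    qed
    then show "(h c = h d) = (c = d)" by blast
  next
    fix c' assume c': "c' \<in> carrier C'"
    obtain c where c: "c \<in> carrier C" "\<And>f. f \<in> carrier C.A \<Longrightarrow> \<psi> f c' = f c"
      using double_dual[OF C.C_vs C.fin_dim hom_compose[OF \<psi>\<psi>(2) eval_hom[OF C'.C_vs c']]] by blast
    have "c' = h c"
    proof (rule sep[OF c' h(1)[OF c(1)]])
      fix f assume f: "f \<in> carrier C'.A"
      show "f c' = f (h c)" using h(2)[OF c(1) f] c(2)[OF \<chi>c[OF f]] \<psi>\<chi>[OF f] by simp
    qed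
    then show "\<exists>c\<in>carrier C. c' = h c" using c(1) by blast
  qed (rule h(1))
  moreover have "\<Delta>\<^bsub>C'\<^esub> (h c) = tensor_map k C' C' h h (\<Delta>\<^bsub>C\<^esub> c)" if c: "c \<in> carrier C" for c
  proof (rule pairing_separates[OF C'.C_vs C'.fin_dim C'.C_vs C'.fin_dim C'.comult_closed[OF h(1)[OF c]]
        hom_in[OF tensor_map_hom[OF C'.C_mod C'.C_mod C.C_mod C.C_mod hom hom] C.comult_closed[OF c]]])
    fix f g assume f: "f \<in> module_hom k C' (self_module k)" and g: "g \<in> module_hom k C' (self_module k)"
    let ?f = "restrict f (carrier C')" and ?g = "restrict g (carrier C')"
    note fA = restrict_in_dual[OF C'.C_vs f] and gA = restrict_in_dual[OF C'.C_vs g]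
    note \<Delta>c = C.comult_closed[OF c]
    have val: "f (h d) = \<chi> ?f d" "g (h d) = \<chi> ?g d" if "d \<in> carrier C" for d
      using h(2)[OF that fA] h(2)[OF that gA] h(1)[OF that] by simp_all
    have "pairing k f g (\<Delta>\<^bsub>C'\<^esub> (h c)) = (?f \<otimes>\<^bsub>C'.A\<^esub> ?g) (h c)"
      unfolding C'.mult_value[OF h(1)[OF c]]
      by (rule pairing_cong[OF C'.C_mod C'.C_mod f g _ _ C'.comult_closed[OF h(1)[OF c]]]) simp_all
    also have "\<dots> = \<chi> (?f \<otimes>\<^bsub>C'.A\<^esub> ?g) c" by (rule h(2)[OF c C'.mult_closed[OF fA gA]])
    also have "\<dots> = pairing k (\<chi> ?f) (\<chi> ?g) (\<Delta>\<^bsub>C\<^esub> c)"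
      by (simp only: ring_hom_mult[OF \<chi>\<chi>(1) fA gA] C.mult_value[OF c])
    also have "\<dots> = pairing k (\<lambda>d. f (h d)) (\<lambda>d. g (h d)) (\<Delta>\<^bsub>C\<^esub> c)"
      by (rule pairing_cong[OF C.C_mod C.C_mod dual_hom[OF C.C_vs \<chi>c[OF fA]] dual_hom[OF C.C_vs \<chi>c[OF gA]] _ _ \<Delta>c])
        (simp_all add: val)
    also have "\<dots> = pairing k f g (tensor_map k C' C' h h (\<Delta>\<^bsub>C\<^esub> c))"
      by (rule tensor_lift_map[OF C'.C_mod C'.C_mod C.C_mod C.C_mod hom hom
            functional_bilinear[OF C.R.cring_axioms f g] C.scalars_mod \<Delta>c, symmetric])
    finally show "pairing k f g (\<Delta>\<^bsub>C'\<^esub> (h c)) = pairing k f g (tensor_map k C' C' h h (\<Delta>\<^bsub>C\<^esub> c))" .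
  qed
  moreover have "\<epsilon>\<^bsub>C'\<^esub> (h c) = \<epsilon>\<^bsub>C\<^esub> c" if c: "c \<in> carrier C" for c
    using h(2)[OF c C'.one_closed] ring_hom_one[OF \<chi>\<chi>(1)] c h(1)[OF c] by (simp add: dual_algebra_simps)
  ultimately show ?thesis
    using hom unfolding coalgebra_isomorphic_def coalgebra_iso_def by blast
qed

theorem coalgebra_isomorphic_iff_dual:
  assumes C: "fin_dim_coalgebra k C" and C': "fin_dim_coalgebra k C'"
  shows "coalgebra_isomorphic k C C' \<longleftrightarrow> algebra_isomorphic k (dual_algebra k C) (dual_algebra k C')"
proof
  interpret C': fin_dim_coalgebra k C' by (rule C')
  interpret A': fin_dim_algebra k C'.A by (rule C'.dual_is_algebra)
  assume "coalgebra_isomorphic k C C'"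
  then obtain h where "h \<in> coalgebra_iso k C C'" by (auto simp: coalgebra_isomorphic_def)
  from algebra_iso_inverse[OF A'.module_axioms A'.A.ring_axioms coalgebra_iso_dual[OF C C' this]]
  show "algebra_isomorphic k (dual_algebra k C) (dual_algebra k C')" by (auto simp: algebra_isomorphic_def)
next
  assume "algebra_isomorphic k (dual_algebra k C) (dual_algebra k C')"
  then show "coalgebra_isomorphic k C C'"
    using dual_iso_coalgebra[OF C C'] by (auto simp: algebra_isomorphic_def)
qed

section \<open>The dual coalgebra of a finite-dimensional algebra\<close>

text \<open>
  The dual space is available as part of the dual algebra of a coalgebra. To have it for the vector
  space underlying an algebra \<open>A\<close>, the latter is equipped with an arbitrary comultiplication and counit.
\<close>

definition coalgebra_of_module :: "('k, 'a, 'm) module_scheme \<Rightarrow> ('k, 'a) coalgebra"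
  where "coalgebra_of_module A =
    \<lparr>carrier = carrier A, mult = mult A, one = \<one>\<^bsub>A\<^esub>, zero = \<zero>\<^bsub>A\<^esub>, add = add A, smult = smult A,
     comult = (\<lambda>_. undefined), counit = (\<lambda>_. undefined)\<rparr>"

abbreviation dual_space :: "('k, 'r) ring_scheme \<Rightarrow> ('k, 'a, 'm) module_scheme \<Rightarrow> ('k, 'a \<Rightarrow> 'k) module"
  where "dual_space k A \<equiv> dual_algebra k (coalgebra_of_module A)"

text \<open>
  The transpose of the multiplication, \<open>\<phi> \<mapsto> ((a, b) \<mapsto> \<phi> (a b))\<close>, read as an element of
  \<open>A\<^sup>* \<otimes> A\<^sup>*\<close>, and the transpose of the unit.
\<close>

definition dual_coalgebra ::
  "('k, 'r) ring_scheme \<Rightarrow> ('k, 'a, 'm) module_scheme \<Rightarrow> ('k, 'a \<Rightarrow> 'k) coalgebra"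
  where "dual_coalgebra k A =
    \<lparr>carrier = carrier (dual_space k A), mult = mult (dual_space k A), one = \<one>\<^bsub>dual_space k A\<^esub>,
     zero = \<zero>\<^bsub>dual_space k A\<^esub>, add = add (dual_space k A), smult = smult (dual_space k A),
     comult = (\<lambda>\<phi>. THE t. t \<in> carrier (tensor k (dual_space k A) (dual_space k A)) \<and>
       (\<forall>a\<in>carrier A. \<forall>b\<in>carrier A. pairing k (\<lambda>f. f a) (\<lambda>f. f b) t = \<phi> (a \<otimes>\<^bsub>A\<^esub> b))),
     counit = (\<lambda>\<phi>. \<phi> \<one>\<^bsub>A\<^esub>)\<rparr>"

lemma coalgebra_of_module_simps [simp]:
  "carrier (coalgebra_of_module A) = carrier A" "add (coalgebra_of_module A) = add A"
  "zero (coalgebra_of_module A) = \<zero>\<^bsub>A\<^esub>" "smult (coalgebra_of_module A) = smult A"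
  by (simp_all add: coalgebra_of_module_def)

lemma dual_coalgebra_simps [simp]:
  "carrier (dual_coalgebra k A) = carrier (dual_space k A)"
  "add (dual_coalgebra k A) = add (dual_space k A)"
  "zero (dual_coalgebra k A) = \<zero>\<^bsub>dual_space k A\<^esub>"
  "smult (dual_coalgebra k A) = smult (dual_space k A)"
  "\<epsilon>\<^bsub>dual_coalgebra k A\<^esub> \<phi> = \<phi> \<one>\<^bsub>A\<^esub>"
  by (simp_all add: dual_coalgebra_def)

context fin_dim_algebra
begin

abbreviation "C \<equiv> dual_coalgebra k A"
abbreviation "V \<equiv> dual_space k A"

lemma base_vs: "vectorspace k (coalgebra_of_module A)"
  and base_fd: "vectorspace.fin_dim k (coalgebra_of_module A)"
  using vectorspace_transfer[OF vectorspace_axioms, of "coalgebra_of_module A"] fin_dim by simp_all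

lemma module_hom_base: "module_hom k (coalgebra_of_module A) (self_module k) = module_hom k A (self_module k)"
  by (simp add: module_hom_def)

lemmas V_vs = dual_vectorspace[OF base_vs]
lemmas V_fd = dual_fin_dim[OF base_vs base_fd]
lemmas V_mod = vectorspace.axioms(1)[OF V_vs]
lemmas scalars_mod = self_module_module[OF R.cring_axioms]

lemma V_hom: "\<phi> \<in> carrier V \<Longrightarrow> \<phi> \<in> module_hom k A (self_module k)"
  using dual_hom[OF base_vs] by (simp add: module_hom_base)

lemma V_restrict: "f \<in> module_hom k A (self_module k) \<Longrightarrow> restrict f (carrier A) \<in> carrier V"
  using restrict_in_dual[OF base_vs, of f] by (simp add: module_hom_base)

lemma evaluation_hom: "a \<in> carrier A \<Longrightarrow> (\<lambda>\<phi>. \<phi> a) \<in> module_hom k V (self_module k)"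
  using eval_hom[OF base_vs] by simp

lemma functional_is_evaluation:
  assumes "f \<in> module_hom k V (self_module k)"
  obtains a where "a \<in> carrier A" "\<And>\<phi>. \<phi> \<in> carrier V \<Longrightarrow> f \<phi> = \<phi> a"
  using double_dual[OF base_vs base_fd assms] by auto

text \<open>
  For a frame of \<open>A\<close> the tensor \<open>\<Sum> e b \<otimes> \<phi>(b \<cdot> -)\<close> has the required values, since
  \<open>\<Sum> e b a \<phi>(b c) = \<phi>(a c)\<close>.
\<close>

lemma comult_exists:
  assumes \<phi>: "\<phi> \<in> carrier V"
  shows "\<exists>t\<in>carrier (tensor k V V).
    \<forall>a\<in>carrier A. \<forall>b\<in>carrier A. pairing k (\<lambda>f. f a) (\<lambda>f. f b) t = \<phi> (a \<otimes>\<^bsub>A\<^esub> b)"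
proof -
  obtain B e where B: "finite B" "B \<subseteq> carrier A"
    "\<And>b. b \<in> B \<Longrightarrow> e b \<in> module_hom k A (self_module k)"
    "\<And>v. v \<in> carrier A \<Longrightarrow> v = (\<Oplus>\<^bsub>A\<^esub>b\<in>B. e b v \<odot>\<^bsub>A\<^esub> b)"
    by (rule frame[OF fin_dim]) (rule that)
  have b: "b \<in> carrier A" if "b \<in> B" for b using that B by blast
  let ?e = "\<lambda>b. restrict (e b) (carrier A)" and ?\<phi> = "\<lambda>b. restrict (\<lambda>a. \<phi> (b \<otimes>\<^bsub>A\<^esub> a)) (carrier A)"
  let ?T = "tensor k V V"
  interpret T: module k ?T by (rule tensor_module[OF V_mod V_mod])
  have e: "?e b \<in> carrier V" if "b \<in> B" for b by (rule V_restrict[OF B(3)[OF that]])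
  have \<phi>b: "?\<phi> b \<in> carrier V" if "b \<in> B" for b
    by (rule V_restrict[OF hom_compose[OF mult_left_hom[OF b[OF that]] V_hom[OF \<phi>]]])
  let ?t = "\<Oplus>\<^bsub>?T\<^esub>b\<in>B. pure_tensor k V V (?e b) (?\<phi> b)"
  have pure: "(\<lambda>b. pure_tensor k V V (?e b) (?\<phi> b)) \<in> B \<rightarrow> carrier ?T"
    using e \<phi>b by (auto intro!: pure_closed[OF V_mod V_mod])
  have "pairing k (\<lambda>f. f a) (\<lambda>f. f c) ?t = \<phi> (a \<otimes>\<^bsub>A\<^esub> c)" if a: "a \<in> carrier A" and c: "c \<in> carrier A" for a c
  proof -
    note ea = evaluation_hom[OF a] and ec = evaluation_hom[OF c]
    have eb: "e b a \<in> carrier k" if "b \<in> B" for b using hom_in[OF B(3)[OF that] a] by simp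
    have \<phi>c: "(\<lambda>x. \<phi> (x \<otimes>\<^bsub>A\<^esub> c)) \<in> module_hom k A (self_module k)"
      by (rule hom_compose[OF mult_right_hom[OF c] V_hom[OF \<phi>]])
    have summand: "(\<lambda>b. e b a \<odot>\<^bsub>A\<^esub> b) \<in> B \<rightarrow> carrier A" using eb b by auto
    have "pairing k (\<lambda>f. f a) (\<lambda>f. f c) ?t =
        (\<Oplus>\<^bsub>self_module k\<^esub>b\<in>B. pairing k (\<lambda>f. f a) (\<lambda>f. f c) (pure_tensor k V V (?e b) (?\<phi> b)))"
      by (rule hom_finsum[OF T.module_axioms scalars_mod pairing_hom[OF V_mod V_mod ea ec] B(1) pure])
    also have "\<dots> = (\<Oplus>\<^bsub>self_module k\<^esub>b\<in>B. \<phi> ((e b a \<odot>\<^bsub>A\<^esub> b) \<otimes>\<^bsub>A\<^esub> c))"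
    proof (rule abelian_monoid.finsum_cong'[OF abelian_group.axioms(1)[OF module.axioms(2)[OF scalars_mod]]])
      show "(\<lambda>b. \<phi> ((e b a \<odot>\<^bsub>A\<^esub> b) \<otimes>\<^bsub>A\<^esub> c)) \<in> B \<rightarrow> carrier (self_module k)"
        using summand hom_in[OF \<phi>c] by blast
      fix b' assume b': "b' \<in> B"
      show "pairing k (\<lambda>f. f a) (\<lambda>f. f c) (pure_tensor k V V (?e b') (?\<phi> b')) = \<phi> ((e b' a \<odot>\<^bsub>A\<^esub> b') \<otimes>\<^bsub>A\<^esub> c)"
        unfolding pairing_pure[OF V_mod V_mod ea ec e[OF b'] \<phi>b[OF b']]
          module_hom_smult[OF \<phi>c eb[OF b'] b[OF b']]
        using a c by simp
    qed simp
    also have "\<dots> = \<phi> ((\<Oplus>\<^bsub>A\<^esub>b\<in>B. e b a \<odot>\<^bsub>A\<^esub> b) \<otimes>\<^bsub>A\<^esub> c)"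
      by (rule hom_finsum[OF module_axioms scalars_mod \<phi>c B(1) summand, symmetric])
    finally show ?thesis using B(4)[OF a] by simp
  qed
  then show ?thesis using T.finsum_closed[OF pure] by blast
qed

lemma comult_unique:
  assumes s: "s \<in> carrier (tensor k V V)" and t: "t \<in> carrier (tensor k V V)"
    and eq: "\<And>a b. a \<in> carrier A \<Longrightarrow> b \<in> carrier A \<Longrightarrow>
      pairing k (\<lambda>f. f a) (\<lambda>f. f b) s = pairing k (\<lambda>f. f a) (\<lambda>f. f b) t"
  shows "s = t"
proof (rule pairing_separates[OF V_vs V_fd V_vs V_fd s t])
  fix f g assume f: "f \<in> module_hom k V (self_module k)" and g: "g \<in> module_hom k V (self_module k)"
  obtain a where a: "a \<in> carrier A" "\<And>\<phi>. \<phi> \<in> carrier V \<Longrightarrow> f \<phi> = \<phi> a" by (rule functional_is_evaluation[OF f]) (rule that)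
  obtain b where b: "b \<in> carrier A" "\<And>\<phi>. \<phi> \<in> carrier V \<Longrightarrow> g \<phi> = \<phi> b" by (rule functional_is_evaluation[OF g]) (rule that)
  have "pairing k f g x = pairing k (\<lambda>f. f a) (\<lambda>f. f b) x" if "x \<in> carrier (tensor k V V)" for x
    by (rule pairing_cong[OF V_mod V_mod f g a(2) b(2) that])
  then show "pairing k f g s = pairing k f g t" using eq[OF a(1) b(1)] s t by simp
qed

lemma comult_V:
  assumes \<phi>: "\<phi> \<in> carrier V"
  shows "\<Delta>\<^bsub>C\<^esub> \<phi> \<in> carrier (tensor k V V)"
    and "a \<in> carrier A \<Longrightarrow> b \<in> carrier A \<Longrightarrow> pairing k (\<lambda>f. f a) (\<lambda>f. f b) (\<Delta>\<^bsub>C\<^esub> \<phi>) = \<phi> (a \<otimes>\<^bsub>A\<^esub> b)"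
proof -
  have "\<exists>!t. t \<in> carrier (tensor k V V) \<and>
    (\<forall>a\<in>carrier A. \<forall>b\<in>carrier A. pairing k (\<lambda>f. f a) (\<lambda>f. f b) t = \<phi> (a \<otimes>\<^bsub>A\<^esub> b))"
  proof (rule ex_ex1I)
    show "\<exists>t. t \<in> carrier (tensor k V V) \<and>
      (\<forall>a\<in>carrier A. \<forall>b\<in>carrier A. pairing k (\<lambda>f. f a) (\<lambda>f. f b) t = \<phi> (a \<otimes>\<^bsub>A\<^esub> b))"
      using comult_exists[OF \<phi>] by blast
  qed (rule comult_unique, auto)
  from theI'[OF this]
  show "\<Delta>\<^bsub>C\<^esub> \<phi> \<in> carrier (tensor k V V)"
    "a \<in> carrier A \<Longrightarrow> b \<in> carrier A \<Longrightarrow> pairing k (\<lambda>f. f a) (\<lambda>f. f b) (\<Delta>\<^bsub>C\<^esub> \<phi>) = \<phi> (a \<otimes>\<^bsub>A\<^esub> b)"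
    by (simp_all add: dual_coalgebra_def)
qed

lemma tensor_C: "tensor k C C = tensor k V V"
  by (rule tensor_transfer) simp_all

lemma module_hom_C: "module_hom k C U = module_hom k V U"
  by (simp add: module_hom_def)

lemma comult_linear: "\<Delta>\<^bsub>C\<^esub> \<in> module_hom k V (tensor k V V)"
proof (rule module_homI)
  interpret V: module k V by (rule V_mod)
  interpret T: module k "tensor k V V" by (rule tensor_module[OF V_mod V_mod])
  note p = pairing_hom[OF V_mod V_mod evaluation_hom evaluation_hom]
  fix \<phi> assume \<phi>: "\<phi> \<in> carrier V"
  show "\<Delta>\<^bsub>C\<^esub> \<phi> \<in> carrier (tensor k V V)" by (rule comult_V(1)[OF \<phi>])
  fix \<psi> assume \<psi>: "\<psi> \<in> carrier V"
  show "\<Delta>\<^bsub>C\<^esub> (\<phi> \<oplus>\<^bsub>V\<^esub> \<psi>) = \<Delta>\<^bsub>C\<^esub> \<phi> \<oplus>\<^bsub>tensor k V V\<^esub> \<Delta>\<^bsub>C\<^esub> \<psi>"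
  proof (rule comult_unique[OF comult_V(1)[OF V.M.a_closed[OF \<phi> \<psi>]]
        T.M.a_closed[OF comult_V(1)[OF \<phi>] comult_V(1)[OF \<psi>]]])
    fix a b assume ab: "a \<in> carrier A" "b \<in> carrier A"
    show "pairing k (\<lambda>f. f a) (\<lambda>f. f b) (\<Delta>\<^bsub>C\<^esub> (\<phi> \<oplus>\<^bsub>V\<^esub> \<psi>)) =
        pairing k (\<lambda>f. f a) (\<lambda>f. f b) (\<Delta>\<^bsub>C\<^esub> \<phi> \<oplus>\<^bsub>tensor k V V\<^esub> \<Delta>\<^bsub>C\<^esub> \<psi>)"
      unfolding module_hom_add[OF p[OF ab] comult_V(1)[OF \<phi>] comult_V(1)[OF \<psi>]]
        comult_V(2)[OF V.M.a_closed[OF \<phi> \<psi>] ab] comult_V(2)[OF \<phi> ab] comult_V(2)[OF \<psi> ab]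
      using ab by (simp add: dual_algebra_simps)
  qed
next
  interpret V: module k V by (rule V_mod)
  interpret T: module k "tensor k V V" by (rule tensor_module[OF V_mod V_mod])
  note p = pairing_hom[OF V_mod V_mod evaluation_hom evaluation_hom]
  fix r \<phi> assume r: "r \<in> carrier k" and \<phi>: "\<phi> \<in> carrier V"
  show "\<Delta>\<^bsub>C\<^esub> (r \<odot>\<^bsub>V\<^esub> \<phi>) = r \<odot>\<^bsub>tensor k V V\<^esub> \<Delta>\<^bsub>C\<^esub> \<phi>"
  proof (rule comult_unique[OF comult_V(1)[OF V.smult_closed[OF r \<phi>]]
        T.smult_closed[OF r comult_V(1)[OF \<phi>]]])
    fix a b assume ab: "a \<in> carrier A" "b \<in> carrier A"
    show "pairing k (\<lambda>f. f a) (\<lambda>f. f b) (\<Delta>\<^bsub>C\<^esub> (r \<odot>\<^bsub>V\<^esub> \<phi>)) =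
        pairing k (\<lambda>f. f a) (\<lambda>f. f b) (r \<odot>\<^bsub>tensor k V V\<^esub> \<Delta>\<^bsub>C\<^esub> \<phi>)"
      unfolding module_hom_smult[OF p[OF ab] r comult_V(1)[OF \<phi>]]
        comult_V(2)[OF V.smult_closed[OF r \<phi>] ab] comult_V(2)[OF \<phi> ab]
      using ab by (simp add: dual_algebra_simps)
  qed
qed

lemma pairing_comult:
  assumes f: "f \<in> module_hom k V (self_module k)" "\<And>\<phi>. \<phi> \<in> carrier V \<Longrightarrow> f \<phi> = \<phi> a" "a \<in> carrier A"
    and g: "g \<in> module_hom k V (self_module k)" "\<And>\<phi>. \<phi> \<in> carrier V \<Longrightarrow> g \<phi> = \<phi> b" "b \<in> carrier A"
    and \<phi>: "\<phi> \<in> carrier V"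
  shows "pairing k f g (\<Delta>\<^bsub>C\<^esub> \<phi>) = \<phi> (a \<otimes>\<^bsub>A\<^esub> b)"
  using pairing_cong[OF V_mod V_mod f(1) g(1) f(2) g(2) comult_V(1)[OF \<phi>]] comult_V(2)[OF \<phi> f(3) g(3)]
  by simp

text \<open>
  Functionals on the dual space are evaluations, so the axioms of \<open>coalgebraI\<close> are the associativity and
  unit laws of \<open>A\<close>.
\<close>

theorem dual_coalgebra: "fin_dim_coalgebra k C"
proof -
  have vs: "vectorspace k C" and fd: "vectorspace.fin_dim k C"
    using vectorspace_transfer[OF V_vs, of C] V_fd by simp_all
  have lin: "\<Delta>\<^bsub>C\<^esub> \<in> module_hom k C (tensor k C C)"
    using comult_linear by (simp add: tensor_C module_hom_C)
  have counit: "\<epsilon>\<^bsub>C\<^esub> \<in> module_hom k V (self_module k)"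
    using evaluation_hom[OF A.one_closed] by (simp add: dual_coalgebra_def)
  note conv = convolution_hom[OF vs lin, unfolded module_hom_C]
  have "coalgebra k C"
  proof (rule coalgebraI[OF vs lin fd], unfold module_hom_C dual_coalgebra_simps(1))
    show "\<epsilon>\<^bsub>C\<^esub> \<in> module_hom k V (self_module k)" by (rule counit)
    fix f \<phi> assume f: "f \<in> module_hom k V (self_module k)" and \<phi>: "\<phi> \<in> carrier V"
    obtain a where a: "a \<in> carrier A" "\<And>\<phi>. \<phi> \<in> carrier V \<Longrightarrow> f \<phi> = \<phi> a"
      by (rule functional_is_evaluation[OF f]) (rule that)
    show "pairing k \<epsilon>\<^bsub>C\<^esub> f (\<Delta>\<^bsub>C\<^esub> \<phi>) = f \<phi>"
      using pairing_comult[OF counit dual_coalgebra_simps(5) A.one_closed f a(2,1) \<phi>] a \<phi> by simp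
    show "pairing k f \<epsilon>\<^bsub>C\<^esub> (\<Delta>\<^bsub>C\<^esub> \<phi>) = f \<phi>"
      using pairing_comult[OF f a(2,1) counit dual_coalgebra_simps(5) A.one_closed \<phi>] a \<phi> by simp
  next
    fix f g h \<phi> assume f: "f \<in> module_hom k V (self_module k)" and g: "g \<in> module_hom k V (self_module k)"
      and h: "h \<in> module_hom k V (self_module k)" and \<phi>: "\<phi> \<in> carrier V"
    obtain a where a: "a \<in> carrier A" "\<And>\<phi>. \<phi> \<in> carrier V \<Longrightarrow> f \<phi> = \<phi> a"
      by (rule functional_is_evaluation[OF f]) (rule that)
    obtain b where b: "b \<in> carrier A" "\<And>\<phi>. \<phi> \<in> carrier V \<Longrightarrow> g \<phi> = \<phi> b"
      by (rule functional_is_evaluation[OF g]) (rule that)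
    obtain c where c: "c \<in> carrier A" "\<And>\<phi>. \<phi> \<in> carrier V \<Longrightarrow> h \<phi> = \<phi> c"
      by (rule functional_is_evaluation[OF h]) (rule that)
    note fg = pairing_comult[OF f a(2,1) g b(2,1)] and gh = pairing_comult[OF g b(2,1) h c(2,1)]
    have "pairing k (\<lambda>u. pairing k f g (\<Delta>\<^bsub>C\<^esub> u)) h (\<Delta>\<^bsub>C\<^esub> \<phi>) = \<phi> (a \<otimes>\<^bsub>A\<^esub> b \<otimes>\<^bsub>A\<^esub> c)"
      by (rule pairing_comult[OF conv[OF f g] fg _ h c(2,1) \<phi>]) (simp_all add: a(1) b(1))
    also have "\<dots> = \<phi> (a \<otimes>\<^bsub>A\<^esub> (b \<otimes>\<^bsub>A\<^esub> c))" by (simp add: A.m_assoc a(1) b(1) c(1))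
    also have "\<dots> = pairing k f (\<lambda>v. pairing k g h (\<Delta>\<^bsub>C\<^esub> v)) (\<Delta>\<^bsub>C\<^esub> \<phi>)"
      by (rule pairing_comult[OF f a(2,1) conv[OF g h] gh _ \<phi>, symmetric]) (simp_all add: b(1) c(1))
    finally show "pairing k (\<lambda>u. pairing k f g (\<Delta>\<^bsub>C\<^esub> u)) h (\<Delta>\<^bsub>C\<^esub> \<phi>) =
        pairing k f (\<lambda>v. pairing k g h (\<Delta>\<^bsub>C\<^esub> v)) (\<Delta>\<^bsub>C\<^esub> \<phi>)" .
  qed
  then show ?thesis using fd by (simp add: fin_dim_coalgebra_def fin_dim_coalgebra_axioms_def)
qed

text \<open>
  Evaluation is multiplicative by the choice of the comultiplication, and bijective by double duality.
\<close>

theorem evaluation_iso: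
  "(\<lambda>a. \<lambda>\<phi>\<in>carrier V. \<phi> a) \<in> algebra_iso k A (dual_algebra k C)"
proof (rule algebra_isoI)
  interpret C: fin_dim_coalgebra k C by (rule dual_coalgebra)
  let ?ev = "\<lambda>a. \<lambda>\<phi>\<in>carrier V. \<phi> a"
  have closed: "?ev a \<in> carrier (dual_algebra k C)" if "a \<in> carrier A" for a
    using restrict_in_dual[OF C.C_vs, of "\<lambda>\<phi>. \<phi> a"] evaluation_hom[OF that] by (simp add: module_hom_C)
  note hom = dual_hom[OF C.C_vs closed, unfolded module_hom_C]
  have add: "?ev (a \<oplus>\<^bsub>A\<^esub> b) = ?ev a \<oplus>\<^bsub>dual_algebra k C\<^esub> ?ev b" if "a \<in> carrier A" "b \<in> carrier A" for a b
    using that module_hom_add[OF V_hom] by (auto simp: dual_algebra_simps intro!: restrict_ext)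
  show "?ev \<in> module_hom k A (dual_algebra k C)"
  proof (rule module_homI)
    show "?ev (r \<odot>\<^bsub>A\<^esub> a) = r \<odot>\<^bsub>dual_algebra k C\<^esub> ?ev a" if "r \<in> carrier k" "a \<in> carrier A" for r a
      using that module_hom_smult[OF V_hom] by (auto simp: dual_algebra_simps intro!: restrict_ext)
  qed (fact closed add)+
  show "?ev \<in> ring_hom A (dual_algebra k C)"
  proof (rule ring_hom_memI)
    show "?ev (a \<otimes>\<^bsub>A\<^esub> b) = ?ev a \<otimes>\<^bsub>dual_algebra k C\<^esub> ?ev b" if ab: "a \<in> carrier A" "b \<in> carrier A" for a b
    proof -
      have "pairing k (?ev a) (?ev b) (\<Delta>\<^bsub>C\<^esub> \<phi>) = \<phi> (a \<otimes>\<^bsub>A\<^esub> b)" if \<phi>: "\<phi> \<in> carrier V" for \<phi>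
        by (rule pairing_comult[OF hom[OF ab(1)] _ ab(1) hom[OF ab(2)] _ ab(2) \<phi>]) simp_all
      then show ?thesis by (auto simp: dual_algebra_simps intro!: restrict_ext)
    qed
    show "?ev \<one>\<^bsub>A\<^esub> = \<one>\<^bsub>dual_algebra k C\<^esub>" by (auto simp: dual_algebra_simps intro!: restrict_ext)
  qed (fact closed add)+
  show "bij_betw ?ev (carrier A) (carrier (dual_algebra k C))"
  proof (rule bij_betwI')
    fix a b assume a: "a \<in> carrier A" and b: "b \<in> carrier A"
    have "a = b" if eq: "?ev a = ?ev b"
    proof (rule dual_separates[OF base_vs base_fd])
      fix \<phi> assume "\<phi> \<in> carrier V"
      then show "\<phi> a = \<phi> b" using fun_cong[OF eq, of \<phi>] by simp
    qed (use a b in simp_all)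
    then show "(?ev a = ?ev b) = (a = b)" by blast
  next
    fix F assume F: "F \<in> carrier (dual_algebra k C)"
    then have "F \<in> module_hom k V (self_module k)" by (simp add: dual_carrier module_hom_C)
    then obtain a where a: "a \<in> carrier A" "\<And>\<phi>. \<phi> \<in> carrier V \<Longrightarrow> F \<phi> = \<phi> a"
      by (rule functional_is_evaluation) (rule that)
    have "F = ?ev a" by (rule dual_eqI[OF C.C_vs F closed[OF a(1)]]) (simp add: a(2))
    then show "\<exists>a\<in>carrier A. F = ?ev a" using a(1) by blast
  qed (rule closed)
qed

end

section \<open>The correspondence\<close>

lemma ring_iso_Units:
  assumes A: "ring A" and B: "ring B" and h: "h \<in> ring_iso A B" and a: "a \<in> carrier A"
  shows "h a \<in> Units B \<longleftrightarrow> a \<in> Units A"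
proof
  interpret A: ring A by fact
  interpret B: ring B by fact
  have hh: "h \<in> ring_hom A B" and bij: "bij_betw h (carrier A) (carrier B)"
    using h by (simp_all add: ring_iso_def)
  note closed = ring_hom_closed[OF hh] and mult = ring_hom_mult[OF hh] and one = ring_hom_one[OF hh]
  show "h a \<in> Units B" if u: "a \<in> Units A"
  proof -
    let ?b = "inv\<^bsub>A\<^esub> a"
    have b: "?b \<in> carrier A" using u by simp
    have "h ?b \<otimes>\<^bsub>B\<^esub> h a = \<one>\<^bsub>B\<^esub>" "h a \<otimes>\<^bsub>B\<^esub> h ?b = \<one>\<^bsub>B\<^esub>"
      using mult[OF b a] mult[OF a b] A.Units_l_inv[OF u] A.Units_r_inv[OF u] one by simp_all
    then show ?thesis using closed[OF a] closed[OF b] unfolding Units_def by blast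
  qed
  show "a \<in> Units A" if u: "h a \<in> Units B"
  proof -
    have inj: "x = y" if "h x = h y" "x \<in> carrier A" "y \<in> carrier A" for x y
      using bij that by (auto simp: bij_betw_def dest: inj_onD)
    have "inv\<^bsub>B\<^esub> (h a) \<in> h ` carrier A" using u bij by (simp add: bij_betw_def)
    then obtain b where b: "inv\<^bsub>B\<^esub> (h a) = h b" "b \<in> carrier A" by (rule imageE)
    have "h (b \<otimes>\<^bsub>A\<^esub> a) = h \<one>\<^bsub>A\<^esub>" "h (a \<otimes>\<^bsub>A\<^esub> b) = h \<one>\<^bsub>A\<^esub>"
      using mult[OF b(2) a] mult[OF a b(2)] B.Units_l_inv[OF u] B.Units_r_inv[OF u] one b(1) by simp_all
    then have "b \<otimes>\<^bsub>A\<^esub> a = \<one>\<^bsub>A\<^esub>" "a \<otimes>\<^bsub>A\<^esub> b = \<one>\<^bsub>A\<^esub>" using inj a b(2) by simp_all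
    then show ?thesis using a b(2) unfolding Units_def by blast
  qed
qed

lemma left_ideal_preimage:
  assumes A: "ring A" and B: "ring B" and h: "h \<in> ring_hom A B" and I: "left_ideal I B"
  shows "left_ideal {a \<in> carrier A. h a \<in> I} A"
proof -
  interpret h: ring_hom_ring A B h using A B h by (simp add: ring_hom_ringI2)
  interpret I: additive_subgroup I B using I by (simp add: left_ideal_def)
  have "subgroup {a \<in> carrier A. h a \<in> I} (add_monoid A)"
  proof -
    have "{a \<in> carrier A. h a \<in> I} \<noteq> {}" using I.zero_closed h.R.zero_closed h.hom_zero by force
    moreover have "\<ominus>\<^bsub>A\<^esub> a \<in> {a \<in> carrier A. h a \<in> I}" if "a \<in> {a \<in> carrier A. h a \<in> I}" for a
      using that I.a_inv_closed by simp
    ultimately show ?thesis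
      using I.a_closed by (intro h.R.add.subgroupI) (auto simp: a_inv_def)
  qed
  then show ?thesis using I by (auto simp: left_ideal_def additive_subgroup_def)
qed

lemma left_chain_iso:
  assumes A: "ring A" and B: "ring B" and h: "h \<in> ring_iso A B"
    and chain: "\<And>I J. left_ideal I A \<Longrightarrow> left_ideal J A \<Longrightarrow> I \<subseteq> J \<or> J \<subseteq> I"
    and I: "left_ideal I B" and J: "left_ideal J B"
  shows "I \<subseteq> J \<or> J \<subseteq> I"
proof -
  have hh: "h \<in> ring_hom A B" and surj: "h ` carrier A = carrier B"
    using h by (simp_all add: ring_iso_def bij_betw_def)
  have image: "h ` {a \<in> carrier A. h a \<in> K} = K" if "left_ideal K B" for K
  proof -
    have "K \<subseteq> carrier B"
      using that by (auto simp: left_ideal_def additive_subgroup_def dest: subgroup.mem_carrier)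
    show ?thesis
    proof
      show "K \<subseteq> h ` {a \<in> carrier A. h a \<in> K}"
      proof
        fix y assume y: "y \<in> K"
        then have "y \<in> h ` carrier A" using \<open>K \<subseteq> carrier B\<close> surj by blast
        then obtain a where "y = h a" "a \<in> carrier A" by (rule imageE)
        then show "y \<in> h ` {a \<in> carrier A. h a \<in> K}" using y by simp
      qed
    qed auto
  qed
  from chain[OF left_ideal_preimage[OF A B hh I] left_ideal_preimage[OF A B hh J]]
  show ?thesis
    using image_mono[of _ _ h] image[OF I] image[OF J] by (metis (no_types, lifting))
qed

text \<open>
  The chain condition on left ideals is carried over to the dual algebra of the dual coalgebra, where the
  uniformizer turns it into the chain condition on right ideals. Evaluation followed by restriction to the
  coradical is a surjection whose kernel is the Jacobson radical of \<open>A\<close>, so the dual of the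
  coradical is the residue field.
\<close>

theorem (in fin_dim_algebra) dual_coalgebra_chain:
  assumes chain: "\<And>I J. left_ideal I A \<Longrightarrow> left_ideal J A \<Longrightarrow> I \<subseteq> J \<or> J \<subseteq> I"
    and nontriv: "\<one>\<^bsub>A\<^esub> \<noteq> \<zero>\<^bsub>A\<^esub>"
    and iso: "algebra_isomorphic k (quotient_algebra A (Jac A)) E"
  shows "fin_dim_chain_coalgebra_of_type k E C"
proof -
  interpret C: fin_dim_coalgebra k C by (rule dual_coalgebra)
  interpret B: fin_dim_algebra k C.A by (rule C.dual_is_algebra)
  let ?ev = "\<lambda>a. \<lambda>\<phi>\<in>carrier V. \<phi> a"
  note ev = algebra_isoD[OF evaluation_iso]
  have ring_iso: "?ev \<in> ring_iso A C.A" using evaluation_iso by (simp add: algebra_iso_def)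
  have zero: "?ev \<zero>\<^bsub>A\<^esub> = \<zero>\<^bsub>C.A\<^esub>" by (rule hom_zero[OF module_axioms B.module_axioms ev(2)])
  have nontriv': "\<one>\<^bsub>C.A\<^esub> \<noteq> \<zero>\<^bsub>C.A\<^esub>"
  proof
    assume "\<one>\<^bsub>C.A\<^esub> = \<zero>\<^bsub>C.A\<^esub>"
    then have "?ev \<one>\<^bsub>A\<^esub> = ?ev \<zero>\<^bsub>A\<^esub>" using ring_hom_one[OF ev(1)] zero by simp
    then show False
      using inj_onD[OF bij_betw_imp_inj_on[OF ev(3)] _ A.one_closed M.zero_closed] nontriv by blast
  qed
  obtain x where x: "uniformizer A x" using left_chain_uniformizer[OF chain nontriv] by blast
  obtain y where y: "uniformizer C.A y"
    using B.left_chain_uniformizer[OF left_chain_iso[OF A.ring_axioms B.A.ring_axioms ring_iso chain] nontriv']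
    by blast
  have "chain_coalgebra k C"
    unfolding C.chain_coalgebra_iff using B.right_ideals_chain[OF y nontriv'] by blast
  moreover have "algebra_isomorphic k E (dual_algebra k (sub_coalgebra k C (coradical k C)))"
  proof -
    let ?M = "carrier C.A - Units C.A"
    let ?B = "dual_algebra k (sub_coalgebra k C (C.zeros ?M))"
    let ?h = "\<lambda>a. restrict (?ev a) (C.zeros ?M)"
    note res = C.restrict_ring_hom[OF y nontriv'] C.restrict_module_hom[OF y nontriv']
      C.restrict_surj[OF y nontriv'] C.restrict_kernel[OF y nontriv']
    have "?h \<in> ring_hom A ?B" using ring_hom_trans[OF ev(1) res(1)] by (simp add: comp_def)
    moreover have "?h \<in> module_hom k A ?B" by (rule hom_compose[OF ev(2) res(2)])
    moreover have "?h ` carrier A = carrier ?B"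
    proof -
      have ev_surj: "?ev ` carrier A = carrier C.A" using ev(3) unfolding bij_betw_def by (rule conjunct2)
      have "?h ` carrier A = (\<lambda>f. restrict f (C.zeros ?M)) ` (?ev ` carrier A)"
        by (rule image_image[symmetric])
      then show ?thesis unfolding ev_surj res(3) .
    qed
    moreover have "{a \<in> carrier A. ?h a = \<zero>\<^bsub>?B\<^esub>} = carrier A - Units A"
    proof -
      have "?h a = \<zero>\<^bsub>?B\<^esub> \<longleftrightarrow> a \<notin> Units A" if a: "a \<in> carrier A" for a
      proof -
        have eva: "?ev a \<in> carrier C.A" by (rule hom_in[OF ev(2) a])
        have "(?ev a \<in> {f \<in> carrier C.A. restrict f (C.zeros ?M) = \<zero>\<^bsub>?B\<^esub>}) = (?ev a \<in> ?M)"
          by (rule arg_cong[OF res(4)])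
        then have "?h a = \<zero>\<^bsub>?B\<^esub> \<longleftrightarrow> ?ev a \<notin> Units C.A"
          by (simp only: mem_Collect_eq Diff_iff eva simp_thms)
        also have "\<dots> \<longleftrightarrow> a \<notin> Units A"
          using ring_iso_Units[OF A.ring_axioms B.A.ring_axioms ring_iso a] by (simp only:)
        finally show ?thesis .
      qed
      then show ?thesis by blast
    qed
    ultimately have "algebra_isomorphic k (quotient_algebra A (Jac A)) ?B"
      by (rule residue_algebra_iso[OF x nontriv])
    then obtain f where f: "f \<in> algebra_iso k (quotient_algebra A (Jac A)) ?B"
      by (auto simp: algebra_isomorphic_def)
    obtain g where g: "g \<in> algebra_iso k (quotient_algebra A (Jac A)) E"
      using iso by (auto simp: algebra_isomorphic_def)
    have J: "ideal (Jac A) A" unfolding Jac_nonunits[OF x nontriv] by (rule nonunits_ideal[OF x nontriv])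
    have sub: "submodule k (Jac A) A"
      using x principal_submodules(1)[OF uniformizer_closed[OF x nontriv]]
      unfolding Jac_nonunits[OF x nontriv] by (simp add: uniformizer_def)
    show ?thesis
      unfolding C.coradical_eq[OF y nontriv'] algebra_isomorphic_def
      using algebra_iso_compose[OF algebra_iso_inverse[OF quotient_module[OF sub] quotient_ring[OF J] g] f] by blast
  qed
  ultimately show ?thesis
    unfolding fin_dim_chain_coalgebra_of_type_def using C.fin_dim by blast
qed

lemma (in fin_dim_algebra) residue_nontrivial:
  assumes E: "division_algebra k E" and iso: "algebra_isomorphic k (quotient_algebra A N) E"
  shows "\<one>\<^bsub>A\<^esub> \<noteq> \<zero>\<^bsub>A\<^esub>"
proof
  interpret E: division_algebra k E by (rule E)
  assume "\<one>\<^bsub>A\<^esub> = \<zero>\<^bsub>A\<^esub>"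
  then have "carrier A = {\<zero>\<^bsub>A\<^esub>}" by (rule trivial_carrier)
  then have Q: "carrier (quotient_algebra A N) = {N +>\<^bsub>A\<^esub> \<zero>\<^bsub>A\<^esub>}" by (simp add: A_RCOSETS_def')
  obtain h where "h \<in> algebra_iso k (quotient_algebra A N) E" using iso by (auto simp: algebra_isomorphic_def)
  from algebra_isoD(3)[OF this] have "carrier E = {h (N +>\<^bsub>A\<^esub> \<zero>\<^bsub>A\<^esub>)}" unfolding Q by (simp add: bij_betw_def)
  then have "\<one>\<^bsub>E\<^esub> = \<zero>\<^bsub>E\<^esub>" using E.A.one_closed E.M.zero_closed by (metis singletonD)
  then show False using E.one_neq_zero by simp
qed

theorem corollary5p5:
  fixes k :: "('k, 'r) ring_scheme" and D :: "('k, 'd, 'n) module_scheme"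
  assumes "field k" and "division_algebra k D" and "vectorspace.fin_dim k D"
  shows "(\<forall>C :: ('k, 'c, 'm) coalgebra_scheme.
            fin_dim_chain_coalgebra_of_type k D C \<longrightarrow>
            chain_ring_with_residue_field k D (dual_algebra k C))
       \<and> (\<forall>(C :: ('k, 'c, 'm) coalgebra_scheme) (C' :: ('k, 'c2, 'm2) coalgebra_scheme).
            fin_dim_chain_coalgebra_of_type k D C \<and> fin_dim_chain_coalgebra_of_type k D C' \<longrightarrow>
            (coalgebra_isomorphic k C C' \<longleftrightarrow>
             algebra_isomorphic k (dual_algebra k C) (dual_algebra k C')))
       \<and> (\<forall>A :: ('k, 'a, 'l) module_scheme.
            chain_ring_with_residue_field k D A \<longrightarrow>
            (\<exists>C :: ('k, 'a \<Rightarrow> 'k) coalgebra.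
              fin_dim_chain_coalgebra_of_type k D C \<and>
              algebra_isomorphic k A (dual_algebra k C)))"
proof (intro conjI allI impI)
  fix C :: "('k, 'c, 'm) coalgebra_scheme"
  assume C: "fin_dim_chain_coalgebra_of_type k D C"
  then interpret C: fin_dim_coalgebra k C
    by (simp add: fin_dim_chain_coalgebra_of_type_def chain_coalgebra_def
        fin_dim_coalgebra_def fin_dim_coalgebra_axioms_def)
  show "chain_ring_with_residue_field k D (dual_algebra k C)"
    by (rule C.dual_chain_ring[OF assms(2)]) (use C in \<open>simp_all add: fin_dim_chain_coalgebra_of_type_def\<close>)
next
  fix C :: "('k, 'c, 'm) coalgebra_scheme" and C' :: "('k, 'c2, 'm2) coalgebra_scheme"
  assume "fin_dim_chain_coalgebra_of_type k D C \<and> fin_dim_chain_coalgebra_of_type k D C'"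
  then show "coalgebra_isomorphic k C C' \<longleftrightarrow> algebra_isomorphic k (dual_algebra k C) (dual_algebra k C')"
    by (intro coalgebra_isomorphic_iff_dual)
      (simp_all add: fin_dim_chain_coalgebra_of_type_def chain_coalgebra_def
        fin_dim_coalgebra_def fin_dim_coalgebra_axioms_def)
next
  fix A :: "('k, 'a, 'l) module_scheme"
  assume A: "chain_ring_with_residue_field k D A"
  then interpret A: fin_dim_algebra k A
    by (simp add: chain_ring_with_residue_field_def fin_dim_chain_ring_def
        fin_dim_algebra_def fin_dim_algebra_axioms_def)
  have chain: "I \<subseteq> J \<or> J \<subseteq> I" if "left_ideal I A" "left_ideal J A" for I J
    using A that by (simp add: chain_ring_with_residue_field_def fin_dim_chain_ring_def)
  have iso: "algebra_isomorphic k (quotient_algebra A (Jac A)) D"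
    using A by (simp add: chain_ring_with_residue_field_def)
  show "\<exists>C :: ('k, 'a \<Rightarrow> 'k) coalgebra. fin_dim_chain_coalgebra_of_type k D C \<and>
      algebra_isomorphic k A (dual_algebra k C)"
    using A.dual_coalgebra_chain[OF chain A.residue_nontrivial[OF assms(2) iso] iso] A.evaluation_iso
    unfolding algebra_isomorphic_def by blast
qed

end
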